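(* Let $G$ be a Hodge group with complex Lie algebra $\mathfrak{g}_{\mathbb C}=\mathfrak{e}_6(\mathbb{C})$ or $\mathfrak{g}_{\mathbb C}=\mathfrak{e}_7(\mathbb{C})$. Then $G$ does not admit a principal Hodge representation $(V,\varphi)$.
   Context: Hodge representations. Let $V$ be a (finite-dimensional) rational vector space, $w\in\mathbb{Z}$, and $Q:V\times V\to\mathbb{Q}$ a nondegenerate bilinear form with $Q(u,v)=(-1)^wQ(v,u)$. A $Q$-polarized Hodge structure of weight $w$ on $V$ is a nonconstant homomorphism $\phi:S^1\to\mathrm{Aut}(V_{\mathbb R},Q)$ of $\mathbb{R}$-algebraic groups with $\phi(-1)=(-1)^w\mathrm{Id}$ and $Q(v,\phi(\mathbf{i})\overline v)>0$ for all $0\ne v\in V_{\mathbb C}$. Its Hodge decomposition is $V_{\mathbb C}=\bigoplus_{p+q=w}V^{p,q}$, $V^{p,q}=\{v\in V_{\mathbb C}\mid \phi(z)v=z^{p-q}v\ \forall z\in S^1\}$. Let $G$ be a $\mathbb{Q}$-algebraic group, $\pi:G\to\mathrm{Aut}(V,Q)$ a homomorphism of $\mathbb{Q}$-algebraic groups such that $\pi_*:\mathfrak{g}_{\mathbb C}\to\mathrm{End}(V_{\mathbb C},Q)$ is injective, and $\varphi:S^1\to G_{\mathbb R}$ a nonconstant homomorphism of $\mathbb{R}$-algebraic groups. Then $(V,Q,\pi,\varphi)$, abbreviated $(V,\varphi)$, is a Hodge representation of $G$ if $\pi\circ\varphi$ is a $Q$-polarized Hodge structure on $V$. A $\mathbb{Q}$-algebraic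 group admitting a Hodge representation is a Hodge group. Principal. Let $V_\ell\subset V_{\mathbb C}$ denote $V^{p,q}$ with $\ell=(p-q)/2\in\tfrac12\mathbb{Z}$, and let $m$ be the largest $\ell$ with $V_\ell\neq 0$, so $V_{\mathbb C}=V_m\oplus V_{m-1}\oplus\cdots\oplus V_{1-m}\oplus V_{-m}$. The Hodge representation is principal if its Hodge numbers are $(1,1,\dots,1)$, i.e. $\dim_{\mathbb C}V_\ell=1$ for $\ell=m,m-1,\dots,-m$. *)

theory Defs
  imports Complex_Main "Jordan_Normal_Form.Matrix" "Jordan_Normal_Form.Determinant"
    "Jordan_Normal_Form.VS_Connect"
begin

text \<open>
  Linear algebraic groups over a subfield \<open>K\<close> of the complex numbers are treated in the classical
  way: such a group is a subgroup of \<open>GL\<^sub>n(\<complex>)\<close> (its group of complex points) which is the zero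
  locus of polynomials with coefficients in \<open>K\<close>; its morphisms are the maps given by regular
  functions with coefficients in \<open>K\<close>.  As the characteristic is zero this loses nothing.
  A \<open>\<rat>\<close>-algebraic group \<open>G\<close> and its base change \<open>G\<^sub>\<real>\<close> thus have the same underlying set.
\<close>

inductive_set polyfuns :: "complex set \<Rightarrow> nat \<Rightarrow> (complex mat \<Rightarrow> complex) set"
  for K :: "complex set" and n :: nat where
  const: "c \<in> K \<Longrightarrow> (\<lambda>g. c) \<in> polyfuns K n"
| coord: "i < n \<Longrightarrow> j < n \<Longrightarrow> (\<lambda>g. g $$ (i, j)) \<in> polyfuns K n"
| add: "p \<in> polyfuns K n \<Longrightarrow> q \<in> polyfuns K n \<Longrightarrow> (\<lambda>g. p g + q g) \<in> polyfuns K n"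
| mult: "p \<in> polyfuns K n \<Longrightarrow> q \<in> polyfuns K n \<Longrightarrow> (\<lambda>g. p g * q g) \<in> polyfuns K n"

definition alg_group :: "complex set \<Rightarrow> nat \<Rightarrow> complex mat set \<Rightarrow> bool" where
  "alg_group K n G \<longleftrightarrow>
     (\<exists>P \<subseteq> polyfuns K n. G = {g \<in> carrier_mat n n. det g \<noteq> 0 \<and> (\<forall>p\<in>P. p g = 0)}) \<and>
     1\<^sub>m n \<in> G \<and> (\<forall>g\<in>G. \<forall>h\<in>G. g * h \<in> G) \<and> (\<forall>g\<in>G. \<exists>h\<in>G. g * h = 1\<^sub>m n \<and> h * g = 1\<^sub>m n)"

definition regular_on :: "complex set \<Rightarrow> nat \<Rightarrow> complex mat set \<Rightarrow> (complex mat \<Rightarrow> complex) \<Rightarrow> bool" where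
  "regular_on K n G f \<longleftrightarrow> (\<exists>p \<in> polyfuns K n. \<exists>k::nat. \<forall>g\<in>G. f g = p g / det g ^ k)"

definition alg_hom :: "complex set \<Rightarrow> nat \<Rightarrow> complex mat set \<Rightarrow> nat \<Rightarrow> complex mat set
    \<Rightarrow> (complex mat \<Rightarrow> complex mat) \<Rightarrow> bool" where
  "alg_hom K n G m H f \<longleftrightarrow>
     (\<forall>g\<in>G. f g \<in> H) \<and> (\<forall>g\<in>G. \<forall>h\<in>G. f (g * h) = f g * f h) \<and>
     (\<forall>i<m. \<forall>j<m. regular_on K n G (\<lambda>g. f g $$ (i, j)))"

text \<open>The complex Lie algebra of \<open>G\<close> is the Zariski tangent space at the identity, with the
  commutator of matrices as bracket.\<close>

definition lie_algebra :: "nat \<Rightarrow> complex mat set \<Rightarrow> complex mat set" where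
  "lie_algebra n G = {X \<in> carrier_mat n n. \<forall>p \<in> polyfuns UNIV n. (\<forall>g\<in>G. p g = 0) \<longrightarrow>
      ((\<lambda>t::complex. p (1\<^sub>m n + t \<cdot>\<^sub>m X)) has_field_derivative 0) (at 0)}"

text \<open>The differential at the identity of a morphism of \<open>G\<close> into \<open>m \<times> m\<close> matrices.  An entry
  of \<open>f\<close> is the restriction to \<open>G\<close> of some \<open>p / det\<^sup>k\<close>; for \<open>X\<close> in the Lie algebra of \<open>G\<close> the
  derivative in direction \<open>X\<close> does not depend on the choice of \<open>p\<close> and \<open>k\<close>.\<close>

definition differential ::
    "nat \<Rightarrow> complex mat set \<Rightarrow> nat \<Rightarrow> (complex mat \<Rightarrow> complex mat) \<Rightarrow> complex mat \<Rightarrow> complex mat" where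
  "differential n G m f X = mat m m (\<lambda>(i, j). THE d. \<forall>p \<in> polyfuns UNIV n. \<forall>k::nat.
      (\<forall>g\<in>G. f g $$ (i, j) = p g / det g ^ k) \<longrightarrow>
      ((\<lambda>t::complex. p (1\<^sub>m n + t \<cdot>\<^sub>m X) / det (1\<^sub>m n + t \<cdot>\<^sub>m X) ^ k) has_field_derivative d) (at 0))"

text \<open>The circle \<open>S\<^sup>1\<close> as a real algebraic group is \<open>SO\<^sub>2\<close>; its real points are the unit complex
  numbers \<open>z = a + b\<i>\<close>, embedded as rotation matrices.\<close>

definition circle_group :: "complex mat set" where
  "circle_group = {A \<in> carrier_mat 2 2. A * transpose_mat A = 1\<^sub>m 2 \<and> det A = 1}"

definition circle_pt :: "complex \<Rightarrow> complex mat" where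
  "circle_pt z = map_mat complex_of_real (mat_of_rows_list 2 [[Re z, - Im z], [Im z, Re z]])"

text \<open>The rational vector space \<open>V\<close> is \<open>\<rat>\<^sup>d\<close>, and \<open>Q\<close> is given by its Gram matrix \<open>B\<close>.\<close>

definition bilin :: "rat mat \<Rightarrow> complex vec \<Rightarrow> complex vec \<Rightarrow> complex" where
  "bilin B u v = u \<bullet> (map_mat of_rat B *\<^sub>v v)"

definition aut_form :: "nat \<Rightarrow> rat mat \<Rightarrow> complex mat set" where
  "aut_form d B = {g \<in> carrier_mat d d. det g \<noteq> 0 \<and>
     (\<forall>u \<in> carrier_vec d. \<forall>v \<in> carrier_vec d. bilin B (g *\<^sub>v u) (g *\<^sub>v v) = bilin B u v)}"

definition polarization_form :: "nat \<Rightarrow> rat mat \<Rightarrow> int \<Rightarrow> bool" where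
  "polarization_form d B w \<longleftrightarrow>
     B \<in> carrier_mat d d \<and> det B \<noteq> 0 \<and> transpose_mat B = ((-1) powi w) \<cdot>\<^sub>m B"

definition nonconstant :: "(complex mat \<Rightarrow> complex mat) \<Rightarrow> bool" where
  "nonconstant f \<longleftrightarrow> (\<exists>x\<in>circle_group. \<exists>y\<in>circle_group. f x \<noteq> f y)"

definition polarized_hodge_structure ::
    "nat \<Rightarrow> rat mat \<Rightarrow> int \<Rightarrow> (complex mat \<Rightarrow> complex mat) \<Rightarrow> bool" where
  "polarized_hodge_structure d B w \<rho> \<longleftrightarrow>
     polarization_form d B w \<and>
     alg_hom \<real> 2 circle_group d (aut_form d B) \<rho> \<and> nonconstant \<rho> \<and>
     \<rho> (circle_pt (-1)) = ((-1) powi w) \<cdot>\<^sub>m 1\<^sub>m d \<and>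
     (\<forall>v \<in> carrier_vec d. v \<noteq> 0\<^sub>v d \<longrightarrow>
        bilin B v (\<rho> (circle_pt \<i>) *\<^sub>v map_vec cnj v) \<in> \<real> \<and>
        Re (bilin B v (\<rho> (circle_pt \<i>) *\<^sub>v map_vec cnj v)) > 0)"

definition hodge_space :: "nat \<Rightarrow> (complex mat \<Rightarrow> complex mat) \<Rightarrow> int \<Rightarrow> int \<Rightarrow> complex vec set" where
  "hodge_space d \<rho> p q = {v \<in> carrier_vec d. \<forall>z. cmod z = 1 \<longrightarrow>
     \<rho> (circle_pt z) *\<^sub>v v = (z powi (p - q)) \<cdot>\<^sub>v v}"

definition hodge_number :: "nat \<Rightarrow> (complex mat \<Rightarrow> complex mat) \<Rightarrow> int \<Rightarrow> int \<Rightarrow> nat" where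
  "hodge_number d \<rho> p q =
     vectorspace.dim class_ring (module_vec TYPE(complex) d\<lparr>carrier := hodge_space d \<rho> p q\<rparr>)"

definition hodge_representation :: "nat \<Rightarrow> complex mat set \<Rightarrow> nat \<Rightarrow> rat mat \<Rightarrow> int
    \<Rightarrow> (complex mat \<Rightarrow> complex mat) \<Rightarrow> (complex mat \<Rightarrow> complex mat) \<Rightarrow> bool" where
  "hodge_representation n G d B w \<pi> \<phi> \<longleftrightarrow>
     alg_group \<rat> n G \<and>
     alg_hom \<rat> n G d (aut_form d B) \<pi> \<and> inj_on (differential n G d \<pi>) (lie_algebra n G) \<and>
     alg_hom \<real> 2 circle_group n G \<phi> \<and> nonconstant \<phi> \<and>
     polarized_hodge_structure d B w (\<pi> \<circ> \<phi>)"

definition hodge_group :: "nat \<Rightarrow> complex mat set \<Rightarrow> bool" where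
  "hodge_group n G \<longleftrightarrow> alg_group \<rat> n G \<and> (\<exists>d B w \<pi> \<phi>. hodge_representation n G d B w \<pi> \<phi>)"

text \<open>In weight \<open>w = p + q\<close> we have \<open>\<ell> = (p - q)/2 = p - w/2\<close>, so that \<open>m = (p0 - q0)/2\<close> for the
  largest \<open>p0\<close> with \<open>V\<^bsup>p0,q0\<^esup> \<noteq> 0\<close>, and \<open>-m \<le> \<ell> \<le> m\<close> means \<open>q0 \<le> p \<le> p0\<close>.\<close>

definition principal_rep :: "nat \<Rightarrow> int \<Rightarrow> (complex mat \<Rightarrow> complex mat) \<Rightarrow> bool" where
  "principal_rep d w \<rho> \<longleftrightarrow> (\<exists>p0 q0. p0 + q0 = w \<and>
     hodge_space d \<rho> p0 q0 \<noteq> {0\<^sub>v d} \<and>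
     (\<forall>p q. p + q = w \<longrightarrow> p0 < p \<longrightarrow> hodge_space d \<rho> p q = {0\<^sub>v d}) \<and>
     (\<forall>p q. p + q = w \<longrightarrow> q0 \<le> p \<longrightarrow> p \<le> p0 \<longrightarrow> hodge_number d \<rho> p q = 1))"

text \<open>
  The complex simple Lie algebra of type \<open>E\<^sub>n\<close> (\<open>n = 6, 7\<close>; nodes \<open>1, \<dots>, n\<close> in Bourbaki's
  numbering), in its standard simply laced construction (Kac, Infinite dimensional Lie algebras,
  section 7.8): with \<open>(\<alpha>|\<beta>)\<close> the Cartan form on the root lattice \<open>\<int>\<^sup>n\<close> and
  \<open>\<Phi> = {\<alpha>. (\<alpha>|\<alpha>) = 2}\<close>, it has a basis of simple (co)roots \<open>\<alpha>\<^sub>i\<close>, spanning the Cartan subalgebra,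
  and root vectors \<open>E\<^sub>\<alpha>\<close>, with brackets
    \<open>[\<alpha>\<^sub>i, \<alpha>\<^sub>j] = 0\<close>, \<open>[\<alpha>\<^sub>i, E\<^sub>\<beta>] = (\<alpha>\<^sub>i|\<beta>) E\<^sub>\<beta>\<close>, \<open>[E\<^sub>\<alpha>, E\<^bsub>-\<alpha>\<^esub>] = - \<alpha>\<close>,
    \<open>[E\<^sub>\<alpha>, E\<^sub>\<beta>] = \<epsilon>(\<alpha>,\<beta>) E\<^bsub>\<alpha>+\<beta>\<^esub>\<close> if \<open>\<alpha> + \<beta> \<in> \<Phi>\<close>, and \<open>[E\<^sub>\<alpha>, E\<^sub>\<beta>] = 0\<close> otherwise,
  where \<open>\<epsilon>\<close> is the bimultiplicative sign with \<open>\<epsilon>(\<alpha>,\<alpha>) = (-1)\<^bsup>(\<alpha>|\<alpha>)/2\<^esup>\<close> coming from the orientation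
  of the Dynkin diagram by increasing labels.  An element is the pair of its coordinate functions
  \<open>(h, x)\<close>, for \<open>\<Sum>\<^sub>i h\<^sub>i \<alpha>\<^sub>i + \<Sum>\<^sub>\<alpha> x\<^sub>\<alpha> E\<^sub>\<alpha>\<close>.
\<close>

definition e_edges :: "(nat \<times> nat) set" where
  "e_edges = {(1, 3), (3, 4), (2, 4), (4, 5), (5, 6), (6, 7)}"

definition e_cartan :: "nat \<Rightarrow> nat \<Rightarrow> int" where
  "e_cartan i j = (if i = j then 2 else if (i, j) \<in> e_edges \<or> (j, i) \<in> e_edges then -1 else 0)"

definition e_form :: "nat \<Rightarrow> (nat \<Rightarrow> int) \<Rightarrow> (nat \<Rightarrow> int) \<Rightarrow> int" where
  "e_form n \<alpha> \<beta> = (\<Sum>i=1..n. \<Sum>j=1..n. e_cartan i j * \<alpha> i * \<beta> j)"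

definition e_roots :: "nat \<Rightarrow> (nat \<Rightarrow> int) set" where
  "e_roots n = {\<alpha>. (\<forall>i. i \<notin> {1..n} \<longrightarrow> \<alpha> i = 0) \<and> e_form n \<alpha> \<alpha> = 2}"

definition e_sign :: "nat \<Rightarrow> (nat \<Rightarrow> int) \<Rightarrow> (nat \<Rightarrow> int) \<Rightarrow> complex" where
  "e_sign n \<alpha> \<beta> = (-1) powi (\<Sum>i=1..n. \<Sum>j=1..n.
     (if i = j \<or> (i, j) \<in> e_edges then \<alpha> i * \<beta> j else 0))"

type_synonym e_elt = "(nat \<Rightarrow> complex) \<times> ((nat \<Rightarrow> int) \<Rightarrow> complex)"

definition e_carrier :: "nat \<Rightarrow> e_elt set" where
  "e_carrier n = {(h, x). (\<forall>i. i \<notin> {1..n} \<longrightarrow> h i = 0) \<and> (\<forall>\<alpha>. \<alpha> \<notin> e_roots n \<longrightarrow> x \<alpha> = 0)}"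

definition e_lincomb :: "complex \<Rightarrow> e_elt \<Rightarrow> complex \<Rightarrow> e_elt \<Rightarrow> e_elt" where
  "e_lincomb a u b v = ((\<lambda>i. a * fst u i + b * fst v i), (\<lambda>\<alpha>. a * snd u \<alpha> + b * snd v \<alpha>))"

text \<open>The scalar by which \<open>h\<close> in the Cartan subalgebra acts on the root space of \<open>\<gamma>\<close>.\<close>

definition e_weight :: "nat \<Rightarrow> (nat \<Rightarrow> int) \<Rightarrow> (nat \<Rightarrow> complex) \<Rightarrow> complex" where
  "e_weight n \<gamma> h = (\<Sum>i=1..n. \<Sum>j=1..n. h i * of_int (e_cartan i j * \<gamma> j))"

definition e_bracket :: "nat \<Rightarrow> e_elt \<Rightarrow> e_elt \<Rightarrow> e_elt" where
  "e_bracket n u v = (case (u, v) of ((h, x), (k, y)) \<Rightarrow>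
     ((\<lambda>i. - (\<Sum>\<alpha>\<in>e_roots n. x \<alpha> * y (- \<alpha>) * of_int (\<alpha> i))),
      (\<lambda>\<gamma>. if \<gamma> \<in> e_roots n
            then e_weight n \<gamma> h * y \<gamma> - e_weight n \<gamma> k * x \<gamma> +
                 (\<Sum>\<alpha> | \<alpha> \<in> e_roots n \<and> \<gamma> - \<alpha> \<in> e_roots n.
                    e_sign n \<alpha> (\<gamma> - \<alpha>) * x \<alpha> * y (\<gamma> - \<alpha>))
            else 0)))"

text \<open>A Lie algebra of \<open>N \<times> N\<close> matrices is isomorphic to the one of type \<open>E\<^sub>n\<close>.\<close>

definition lie_iso_E :: "nat \<Rightarrow> nat \<Rightarrow> complex mat set \<Rightarrow> bool" where
  "lie_iso_E n N L \<longleftrightarrow> (\<exists>F. bij_betw F (e_carrier n) L \<and>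
     (\<forall>u \<in> e_carrier n. \<forall>v \<in> e_carrier n.
        (\<forall>a b. F (e_lincomb a u b v) = a \<cdot>\<^sub>m F u + b \<cdot>\<^sub>m F v) \<and>
        F (e_bracket n u v) = F u * F v - F v * F u))"

end

theory Submission
  imports Defs "Jordan_Normal_Form.Char_Poly" "Jordan_Normal_Form.Schur_Decomposition"
begin

text \<open>
  Let \<open>T\<close> be the derivative of the circle action on \<open>V\<close>.  If the representation is principal, then
  \<open>T\<close> is diagonalisable with the \<open>d = dim V\<close> simple eigenvalues \<open>m, m - 2, \<dots>, - m\<close>, where
  \<open>d = m + 1\<close>, and \<open>T\<close> lies in the image of the Lie algebra \<open>g\<close> of \<open>G\<close>.
  The Weyl groups of \<open>E\<^sub>6\<close> and \<open>E\<^sub>7\<close> have no invariant of degree 4 except the square of the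
  quadratic one.  In infinitesimal form this says that an invariant symmetric quartic form on \<open>g\<close>
  vanishes as soon as it vanishes at one coroot, so that
  \<open>tr(x\<^sup>4) = c (tr(x\<^sup>2))\<^sup>2\<close> on all of \<open>g\<close>; in particular at \<open>T\<close>, although \<open>T\<close> need not lie in
  the standard Cartan subalgebra.  Three orthogonal coroots and Cauchy--Schwarz
  give \<open>c \<ge> 9/(5 d)\<close>, whereas the eigenvalues of \<open>T\<close> give
  \<open>c = 9 (d\<^sup>2 - 7/3) / (5 d (d\<^sup>2 - 1)) < 9/(5 d)\<close>.
\<close>

section \<open>Invariant quartic forms on \<open>E\<^sub>6\<close> and \<open>E\<^sub>7\<close>\<close>

text \<open>The basic invariants of the Weyl group have degrees 2, 5, 6, 8, 9, 12 for E_6 and 2, 6,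
  8, 10, 12, 14, 18 for E_7; this is why traces of fourth powers carry the argument. Invariant forms
  on all of g take the place of conjugating T into the standard Cartan subalgebra. With k pairwise
  orthogonal coroots the bound reads c \<ge> 3 k / ((k + 2) d), while the spectrum m, m - 2, ..., -m
  has c d tending to 9/5 from below as d grows. So k = 3 is the least number of coroots for which
  the bound settles every d. It meets the limit exactly, and the contradiction rests on the small
  gap between d^2 - 7/3 and d^2 - 1. Cauchy--Schwarz is an inequality between real numbers, whereas
  all traces are complex; reality of the coroot eigenvalues comes from sl_2-theory. Left invariant
  vector fields on regular functions transport such derivatives to every point of G and show that
  the differential is a Lie homomorphism.\<close>

lemma e_cartan_sym: "e_cartan i j = e_cartan j i"
  by (auto simp: e_cartan_def)

lemma e_cartan_diag [simp]: "e_cartan i i = 2"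
  by (simp add: e_cartan_def)

lemma e_cartan_offdiag: "i \<noteq> j \<Longrightarrow> e_cartan i j = 0 \<or> e_cartan i j = -1"
  by (auto simp: e_cartan_def)

lemma e_cartan_tree:
  "e_cartan i j = -1 \<Longrightarrow> e_cartan i k = -1 \<Longrightarrow> j \<noteq> k \<Longrightarrow> e_cartan j k = 0"
proof -
  assume c: "e_cartan i j = -1" "e_cartan i k = -1" and jk: "j \<noteq> k"
  let ?E = "{(1,3),(3,4),(2,4),(4,5),(5,6),(6,7),(3,1),(4,3),(4,2),(5,4),(6,5),(7,6::nat)}"
  have E: "(a, b) \<in> ?E" if "e_cartan a b = -1" for a b
  proof -
    have "(a, b) \<in> e_edges \<or> (b, a) \<in> e_edges" using that by (auto simp: e_cartan_def split: if_splits)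
    thus ?thesis unfolding e_edges_def by (elim disjE insertE emptyE) simp_all
  qed
  show "e_cartan j k = 0"
    using E[OF c(1)] E[OF c(2)] jk
    by (elim insertE emptyE) (simp_all add: e_cartan_def e_edges_def)
qed

text \<open>The list is split according to whether node 7 occurs, so that one enumeration serves
  both diagrams.\<close>

lemma e_orthogonal_pairs:
  assumes "i \<in> {1..7}" "j \<in> {1..7}" "e_cartan i j = 0" "i < j"
  shows "(i, j) \<in> {(1,2),(1,4),(1,5),(1,6),(2,3),(2,5),(2,6),(3,5),(3,6),(4,6)} \<union>
    {(1,7),(2,7),(3,7),(4,7),(5,7)}"
proof -
  have "i \<in> {1,2,3,4,5,6,7}" "j \<in> {1,2,3,4,5,6,7}" using assms(1,2) by auto
  thus ?thesis using assms(3,4)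
    by (elim insertE emptyE) (simp_all add: e_cartan_def e_edges_def)
qed

text \<open>\<open>g\<close> collects the values of an invariant symmetric quartic form on the simple coroots.  The
  assumptions \<open>cubic\<close> and \<open>refl\<close> say that a simple reflection fixes the form.  Without the branch node
  a one-parameter family of solutions would remain: it is node 4 with its three neighbours that
  forces the values on orthogonal pairs to vanish.\<close>

lemma simple_tensor_zero:
  fixes g :: "nat \<Rightarrow> nat \<Rightarrow> nat \<Rightarrow> nat \<Rightarrow> complex"
  assumes n: "n = 6 \<or> n = 7"
    and s12: "\<And>i j k l. g i j k l = g j i k l"
    and s23: "\<And>i j k l. g i j k l = g i k j l"
    and s34: "\<And>i j k l. g i j k l = g i j l k"
    and cubic: "\<And>i j. i \<in> {1..n} \<Longrightarrow> j \<in> {1..n} \<Longrightarrow>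
      g i i i j = of_int (e_cartan i j) / 2 * g i i i i"
    and refl: "\<And>i j k l. i \<in> {1..n} \<Longrightarrow> j \<in> {1..n} \<Longrightarrow> k \<in> {1..n} \<Longrightarrow> l \<in> {1..n} \<Longrightarrow>
      g i j k l = (of_int (e_cartan i j) * g i i k l + of_int (e_cartan i k) * g i i j l
        + of_int (e_cartan i l) * g i i j k) / 2
        - of_int (e_cartan i j * e_cartan i k * e_cartan i l) / 4 * g i i i i"
    and g1: "g 1 1 1 1 = 0"
    and ijkl: "i \<in> {1..n}" "j \<in> {1..n}" "k \<in> {1..n}" "l \<in> {1..n}"
  shows "g i j k l = 0"
proof -
  define I where "I = {1..n}"
  note cubic = cubic[folded I_def] and refl = refl[folded I_def] and ijkl = ijkl[folded I_def]
  \<comment> \<open>For adjacent nodes the entry with indices i, j, j, j is evaluated twice, by the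
    reflection in i and by the cubic relation at j. Exchanging i and j gives a second equation, and
    the two together determine the ratios. Along edges the vanishing at node 1 thus reaches every
    node.\<close>
  have adj: "g i i i i = g j j j j \<and> 2 * g i i j j = g i i i i"
    if "i \<in> I" "j \<in> I" "e_cartan i j = -1" for i j
  proof -
    have c: "e_cartan j i = -1" using that e_cartan_sym by metis
    have "g i j j j = -3/2 * g i i j j + 1/4 * g i i i i"
      using refl[of i j j j] that by simp
    moreover have "g j i i i = -3/2 * g j j i i + 1/4 * g j j j j"
      using refl[of j i i i] that c by simp
    moreover have "g j j j i = - g j j j j / 2" using cubic[of j i] that c by simp
    moreover have "g i i i j = - g i i i i / 2" using cubic[of i j] that by simp
    moreover have "g i j j j = g j j j i" by (metis s12 s23 s34)
    moreover have "g j i i i = g i i i j" by (metis s12 s23 s34)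
    moreover have "g j j i i = g i i j j" by (metis s12 s23 s34)
    ultimately have "- (g j j j j / 2) = -3/2 * g i i j j + 1/4 * g i i i i"
      "- (g i i i i / 2) = -3/2 * g i i j j + 1/4 * g j j j j" by simp_all
    hence "-2 * g j j j j = -6 * g i i j j + g i i i i"
      "-2 * g i i i i = -6 * g i i j j + g j j j j" by (simp_all add: field_simps)
    moreover have "x = y \<and> 2 * z = x" if "-2 * y = -6 * z + x" "-2 * x = -6 * z + y" for x y z :: complex
    proof -
      have "(-2 * y) - (-2 * x) = (-6 * z + x) - (-6 * z + y)" using that by simp
      hence "x = y" by (simp add: algebra_simps)
      thus ?thesis using that(1) by (simp add: algebra_simps)
    qed
    ultimately show ?thesis by blast
  qed
  have mem: "{1,2,3,4,5,6} \<subseteq> I" "7 \<in> I \<longleftrightarrow> n = 7" using n by (auto simp: I_def)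
  have Icases: "i = 1 \<or> i = 2 \<or> i = 3 \<or> i = 4 \<or> i = 5 \<or> i = 6 \<or> (i = 7 \<and> n = 7)" if "i \<in> I" for i
    using that n by (auto simp: I_def)
  have c: "e_cartan 1 3 = -1" "e_cartan 3 4 = -1" "e_cartan 2 4 = -1" "e_cartan 4 5 = -1"
    "e_cartan 5 6 = -1" "e_cartan 6 7 = -1" by (auto simp: e_cartan_def e_edges_def)
  have diag: "g i i i i = 0" if "i \<in> I" for i
  proof -
    have 3: "g 3 3 3 3 = 0" using adj[of 1 3] c mem g1 by auto
    have 4: "g 4 4 4 4 = 0" using adj[of 3 4] c mem 3 by auto
    have 2: "g 2 2 2 2 = 0" using adj[of 2 4] c mem 4 by auto
    have 5: "g 5 5 5 5 = 0" using adj[of 4 5] c mem 4 by auto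
    have 6: "g 6 6 6 6 = 0" using adj[of 5 6] c mem 5 by auto
    have 7: "g 7 7 7 7 = 0" if "n = 7" using adj[of 6 7] c mem 6 that by auto
    show ?thesis using Icases[OF that] g1 2 3 4 5 6 7 by auto
  qed
  have c3: "g i i i j = 0" if "i \<in> I" "j \<in> I" for i j using cubic diag that by simp
  have refl': "g i j k l = (of_int (e_cartan i j) * g i i k l + of_int (e_cartan i k) * g i i j l
        + of_int (e_cartan i l) * g i i j k) / 2"
    if "i \<in> I" "j \<in> I" "k \<in> I" "l \<in> I" for i j k l
    using refl[OF that] diag that by simp
  define A where "A i j = g i i j j" for i j
  have As: "A i j = A j i" for i j unfolding A_def by (metis s12 s23 s34)
  \<comment> \<open>The entry with indices i, i, j, k can be reduced by the reflection in j or by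
    that in k. Hence \<open>A i\<close> is constant along each edge of the part of the diagram
    orthogonal to i.\<close>
  have Aeq: "A i j = A i k"
    if "i \<in> I" "j \<in> I" "k \<in> I" "e_cartan j k = -1" "e_cartan i j = 0" "e_cartan i k = 0" for i j k
  proof -
    have c': "e_cartan k j = -1" "e_cartan j i = 0" "e_cartan k i = 0" using that e_cartan_sym by metis+
    have "g j i i k = - A j i / 2" using refl'[of j i i k] that c' by (simp add: A_def)
    moreover have "g k i i j = - A k i / 2" using refl'[of k i i j] that c' by (simp add: A_def)
    moreover have "g k i i j = g j i i k" by (metis s12 s23 s34)
    ultimately show ?thesis using As by simp
  qed
  have "A 2 3 = A 2 1" "A 1 2 = A 1 4" "A 1 4 = A 1 5" "A 1 5 = A 1 6" "A 5 1 = A 5 3" "A 3 5 = A 3 6"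
    "A 6 3 = A 6 4" "A 6 4 = A 6 2" "A 2 6 = A 2 5"
    by (rule Aeq; use mem in \<open>simp add: e_cartan_def e_edges_def\<close>)+
  note ch = this
  have ch7: "A 1 6 = A 1 7" "A 7 1 = A 7 3" "A 7 3 = A 7 4" "A 7 4 = A 7 2" "A 7 4 = A 7 5" if "n = 7"
    by (rule Aeq; use mem that in \<open>simp add: e_cartan_def e_edges_def\<close>)+
  \<comment> \<open>The branch node enters here: reducing \<open>g 4 2 3 5\<close> at node 4 gives
    minus a quarter of the sum, while reducing it at node 2 gives 0. Since the three summands are
    equal by the chains above, each of them vanishes.\<close>
  have d4: "A 2 3 + A 2 5 + A 3 5 = 0"
  proof -
    have m: "2 \<in> I" "3 \<in> I" "4 \<in> I" "5 \<in> I" using mem by auto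
    have e: "e_cartan 4 2 = -1" "e_cartan 4 3 = -1" "e_cartan 4 5 = -1" "e_cartan 2 4 = -1" "e_cartan 3 4 = -1"
      "e_cartan 2 3 = 0" "e_cartan 2 5 = 0" "e_cartan 3 5 = 0" "e_cartan 3 2 = 0"
      by (auto simp: e_cartan_def e_edges_def)
    have z: "g 4 4 i j = A i j / 2" if "i \<in> I" "j \<in> I" "e_cartan i 4 = -1" "e_cartan j 4 = -1" "i \<noteq> j" for i j
    proof -
      have ij: "e_cartan i j = 0" "e_cartan j i = 0"
        using e_cartan_tree[of 4 i j] e_cartan_tree[of 4 j i] that e_cartan_sym by metis+
      have "g 4 4 i j = g i 4 4 j" by (metis s12 s23)
      also have "\<dots> = - g i i 4 j" using refl'[of i 4 4 j] that m ij by simp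
      also have "g i i 4 j = g j i i 4" by (metis s12 s23 s34)
      also have "\<dots> = - g j j i i / 2" using refl'[of j i i 4] that m ij by simp
      finally show ?thesis using As by (simp add: A_def)
    qed
    have e': "e_cartan 5 4 = -1" by (simp add: e_cartan_def e_edges_def)
    have "g 4 2 3 5 = - (g 4 4 3 5 + g 4 4 2 5 + g 4 4 2 3) / 2"
      using refl'[of 4 2 3 5] m e by simp
    also have "\<dots> = - (A 3 5 + A 2 5 + A 2 3) / 4"
    proof -
      have z3: "g 4 4 3 5 = A 3 5 / 2" "g 4 4 2 5 = A 2 5 / 2" "g 4 4 2 3 = A 2 3 / 2"
        by (rule z; use m e e' in simp)+
      show ?thesis unfolding z3 by (simp add: field_simps)
    qed
    finally have 1: "g 4 2 3 5 = - (A 3 5 + A 2 5 + A 2 3) / 4" .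
    have "g 4 2 3 5 = g 2 4 3 5" by (rule s12)
    also have "\<dots> = - g 2 2 3 5 / 2" using refl'[of 2 4 3 5] m e by simp
    also have "g 2 2 3 5 = g 3 2 2 5" by (metis s12 s23)
    also have "\<dots> = 0" using refl'[of 3 2 2 5] m e by simp
    finally have "- (A 3 5 + A 2 5 + A 2 3) / 4 = 0" using 1 by simp
    moreover have "x = 0" if "- x / 4 = 0" for x :: complex using that by simp
    ultimately have "A 3 5 + A 2 5 + A 2 3 = 0" by blast
    thus ?thesis by (simp add: add_ac)
  qed
  have A23: "A 2 3 = 0"
  proof -
    have "A 2 5 = A 2 3" "A 3 5 = A 2 3" using ch As by metis+
    thus ?thesis using d4 by simp
  qed
  have Aorth: "A i j = 0" if "i \<in> I" "j \<in> I" "e_cartan i j = 0" for i j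
  proof -
    have 6: "\<forall>p\<in>{(1,2),(1,4),(1,5),(1,6),(2,3),(2,5),(2,6),(3,5),(3,6),(4,6)}. A (fst p) (snd p) = 0"
      using ch As A23 by (simp; metis)
    have 7: "\<forall>p\<in>{(1,7),(2,7),(3,7),(4,7),(5,7)}. A (fst p) (snd p) = 0" if "n = 7"
      using ch ch7[OF that] As A23 by (simp; metis)
    have *: "A i j = 0" if I: "i \<in> I" "j \<in> I" "e_cartan i j = 0" "i < j" for i j
    proof -
      have "i \<in> {1..7}" "j \<in> {1..7}" "7 \<in> {i, j} \<Longrightarrow> n = 7" using I n by (auto simp: I_def)
      thus ?thesis using e_orthogonal_pairs[of i j] I(3,4) 6 7 by force
    qed
    show ?thesis
    proof (rule linorder_cases[of i j])
      assume "i = j" thus ?thesis using that by simp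
    next
      assume "j < i" thus ?thesis using * that As e_cartan_sym by metis
    qed (use * that in blast)
  qed
  have A0: "A i j = 0" if "i \<in> I" "j \<in> I" for i j
  proof -
    consider "i = j" | "e_cartan i j = 0" | "e_cartan i j = -1" using e_cartan_offdiag by blast
    thus ?thesis
    proof cases
      case 1 thus ?thesis using diag that by (simp add: A_def)
    next
      case 2 thus ?thesis using Aorth that by blast
    next
      case 3 thus ?thesis using adj[of i j] diag that by (simp add: A_def)
    qed
  qed
  \<comment> \<open>Reducing at j instead of i moves the repeated index; the term with two repeated
    indices is already known to vanish.\<close>
  have B: "g i i j k = of_int (e_cartan i j) * g j j i k"
    if "i \<in> I" "j \<in> I" "k \<in> I" for i j k
  proof -
    have "g i i j k = g j i i k" by (metis s12 s23)
    also have "\<dots> = of_int (e_cartan i j) * g j j i k"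
      using refl'[of j i i k] that A0[of j i] e_cartan_sym[of j i] by (simp add: A_def)
    finally show ?thesis .
  qed
  have gii: "g i i j k = 0" if "i \<in> I" "j \<in> I" "k \<in> I" for i j k
  proof (cases "i = j \<or> i = k \<or> j = k")
    case True
    thus ?thesis using c3 A0 that s34 by (metis A_def)
  next
    case False
    consider "e_cartan i j = 0" | "e_cartan i k = 0" | "e_cartan i j = -1" "e_cartan i k = -1"
      using False e_cartan_offdiag by blast
    thus ?thesis
    proof cases
      case 1 thus ?thesis using B[OF that] by simp
    next
      case 2
      have "g i i j k = g i i k j" by (rule s34)
      also have "\<dots> = 0" using B[OF that(1,3,2)] 2 by simp
      finally show ?thesis .
    next
      case 3
      \<comment> \<open>The diagram has no triangle, so j and k are orthogonal and the entry with j
        repeated vanishes; \<open>B\<close> then moves the repetition back to i.\<close>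
      have "g j j k i = 0" using B[OF that(2,3,1)] e_cartan_tree[OF 3] False by simp
      hence "g j j i k = 0" using s34[of j j i k] by simp
      thus ?thesis using B[OF that] by simp
    qed
  qed
  show ?thesis using refl'[OF ijkl] gii ijkl by simp
qed

section \<open>Roots, coroots and root vectors in the coordinate model\<close>

definition eh :: "nat \<Rightarrow> e_elt" where
  "eh i = ((\<lambda>j. if j = i then 1 else 0), (\<lambda>_. 0))"

definition ee :: "(nat \<Rightarrow> int) \<Rightarrow> e_elt" where
  "ee \<alpha> = ((\<lambda>_. 0), (\<lambda>\<beta>. if \<beta> = \<alpha> then 1 else 0))"

text \<open>In the simply laced case a root and its coroot have the same coordinates, so the Cartan
  form on the root lattice also gives the pairing of a root with a coroot.\<close>

definition coroot :: "(nat \<Rightarrow> int) \<Rightarrow> e_elt" where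
  "coroot \<alpha> = ((\<lambda>i. of_int (\<alpha> i)), (\<lambda>_. 0))"

definition simple_root :: "nat \<Rightarrow> nat \<Rightarrow> int" where
  "simple_root i = (\<lambda>j. if j = i then 1 else 0)"

definition e_cartan_alg :: "nat \<Rightarrow> e_elt set" where
  "e_cartan_alg n = {u \<in> e_carrier n. snd u = (\<lambda>_. 0)}"

abbreviation wt :: "nat \<Rightarrow> (nat \<Rightarrow> int) \<Rightarrow> e_elt \<Rightarrow> complex" where
  "wt n \<alpha> u \<equiv> e_weight n \<alpha> (fst u)"

lemma e_form_minus: "e_form n (- \<alpha>) (- \<alpha>) = e_form n \<alpha> \<alpha>"
  by (simp add: e_form_def)

lemma e_roots_uminus: "\<alpha> \<in> e_roots n \<Longrightarrow> - \<alpha> \<in> e_roots n"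
  by (simp add: e_roots_def e_form_minus)

lemma zero_notin_e_roots: "(\<lambda>_. 0) \<notin> e_roots n"
  by (simp add: e_roots_def e_form_def)

lemma e_roots_double: assumes "\<alpha> \<in> e_roots n" shows "(\<lambda>i. 2 * \<alpha> i) \<notin> e_roots n"
proof -
  have "e_form n (\<lambda>i. 2 * \<alpha> i) (\<lambda>i. 2 * \<alpha> i) = 4 * e_form n \<alpha> \<alpha>"
    by (simp add: e_form_def sum_distrib_left algebra_simps)
  thus ?thesis using assms by (simp add: e_roots_def)
qed

lemma e_form_simple_root:
  assumes "i \<in> {1..n}"
  shows "e_form n (simple_root i) (simple_root i) = 2"
proof -
  have "e_form n (simple_root i) (simple_root i) =
    (\<Sum>a=1..n. \<Sum>b=1..n. if b = i then (if a = i then 2 else 0) else 0)"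
    unfolding e_form_def simple_root_def by (intro sum.cong) auto
  also have "\<dots> = 2" using assms by simp
  finally show ?thesis .
qed

lemma simple_root_in: "i \<in> {1..n} \<Longrightarrow> simple_root i \<in> e_roots n"
  using e_form_simple_root[of i n] by (auto simp: e_roots_def simple_root_def)

lemma coroot_simple: "coroot (simple_root i) = eh i"
  by (auto simp: coroot_def simple_root_def eh_def)

lemma wt_coroot: "wt n \<alpha> (coroot \<alpha>) = of_int (e_form n \<alpha> \<alpha>)"
  by (simp add: e_weight_def coroot_def e_form_def mult_ac)

lemma wt_eh: assumes "i \<in> {1..n}" "j \<in> {1..n}"
  shows "wt n (simple_root i) (eh j) = of_int (e_cartan i j)"
proof -
  have "wt n (simple_root i) (eh j) =
     (\<Sum>a=1..n. \<Sum>b=1..n. if b = i then (if a = j then of_int (e_cartan i j) else 0) else 0)"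
    unfolding e_weight_def simple_root_def eh_def using e_cartan_sym[of i j] by (intro sum.cong) auto
  also have "\<dots> = of_int (e_cartan i j)" using assms by simp
  finally show ?thesis .
qed

lemma wt_lincomb: "wt n \<alpha> (e_lincomb a u b v) = a * wt n \<alpha> u + b * wt n \<alpha> v"
  by (simp add: e_weight_def e_lincomb_def sum_distrib_left sum.distrib distrib_right mult.assoc)

lemma e_bracket_carrier: "e_bracket n u v \<in> e_carrier n"
proof -
  have "\<alpha> i = 0" if "\<alpha> \<in> e_roots n" "i \<notin> {1..n}" for \<alpha> i using that by (simp add: e_roots_def)
  thus ?thesis by (auto simp: e_bracket_def e_carrier_def split: prod.splits)
qed

lemma eh_cartan: "i \<in> {1..n} \<Longrightarrow> eh i \<in> e_cartan_alg n"
  by (auto simp: eh_def e_carrier_def e_cartan_alg_def)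

lemma coroot_cartan: "\<alpha> \<in> e_roots n \<Longrightarrow> coroot \<alpha> \<in> e_cartan_alg n"
  by (auto simp: coroot_def e_carrier_def e_cartan_alg_def e_roots_def)

lemma lincomb_cartan:
  "u \<in> e_cartan_alg n \<Longrightarrow> v \<in> e_cartan_alg n \<Longrightarrow> e_lincomb a u b v \<in> e_cartan_alg n"
  by (auto simp: e_lincomb_def e_carrier_def e_cartan_alg_def)

text \<open>The scalar multiple is written \<open>e_lincomb c u 0 u\<close> because linearity of
  forms and representations is stated for \<open>e_lincomb\<close>; the result can then be rewritten
  directly. The same shape is used for the other brackets of root vectors.\<close>

lemma bracket_root_cartan:
  assumes "\<alpha> \<in> e_roots n" "u \<in> e_cartan_alg n"
  shows "e_bracket n (ee \<alpha>) u = e_lincomb (- wt n \<alpha> u) (ee \<alpha>) 0 (ee \<alpha>)"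
proof -
  have "snd u = (\<lambda>_. 0)" using assms by (simp add: e_cartan_alg_def)
  then obtain k where "u = (k, \<lambda>_. 0)" by (metis prod.collapse)
  thus ?thesis using assms
    by (intro prod_eqI ext) (auto simp: e_bracket_def ee_def e_lincomb_def e_weight_def)
qed

lemma bracket_root_neg:
  assumes "\<alpha> \<in> e_roots n" "finite (e_roots n)"
  shows "e_bracket n (ee \<alpha>) (ee (- \<alpha>)) = e_lincomb (-1) (coroot \<alpha>) 0 (coroot \<alpha>)"
proof -
  have m: "- \<alpha> \<in> e_roots n" using assms e_roots_uminus by blast
  have "(\<Sum>\<beta>\<in>e_roots n. (if \<beta> = \<alpha> then 1 else 0) * (if - \<beta> = - \<alpha> then 1 else 0) * of_int (\<beta> i))
      = (of_int (\<alpha> i) :: complex)" for i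
  proof -
    have "(\<Sum>\<beta>\<in>e_roots n. (if \<beta> = \<alpha> then 1 else 0) * (if - \<beta> = - \<alpha> then 1 else 0) * of_int (\<beta> i))
      = (\<Sum>\<beta>\<in>e_roots n. if \<beta> = \<alpha> then (of_int (\<alpha> i) :: complex) else 0)"
      by (intro sum.cong) auto
    thus ?thesis using assms by simp
  qed
  moreover have "(\<Sum>\<beta> | \<beta> \<in> e_roots n \<and> \<gamma> - \<beta> \<in> e_roots n.
      e_sign n \<beta> (\<gamma> - \<beta>) * (if \<beta> = \<alpha> then 1 else 0) * (if \<gamma> - \<beta> = - \<alpha> then 1 else 0)) = 0"
    if "\<gamma> \<in> e_roots n" for \<gamma>
  proof (rule sum.neutral, clarify)
    fix \<beta> assume "\<gamma> - \<beta> \<in> e_roots n"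
    have "\<not> (\<beta> = \<alpha> \<and> \<gamma> - \<beta> = - \<alpha>)"
    proof
      assume "\<beta> = \<alpha> \<and> \<gamma> - \<beta> = - \<alpha>"
      hence "\<gamma> = (\<lambda>_. 0)" by (auto simp: fun_eq_iff)
      thus False using that zero_notin_e_roots by simp
    qed
    thus "e_sign n \<beta> (\<gamma> - \<beta>) * (if \<beta> = \<alpha> then 1 else 0) * (if \<gamma> - \<beta> = - \<alpha> then 1 else 0) = 0" by auto
  qed
  ultimately show ?thesis
    by (intro prod_eqI ext) (auto simp: e_bracket_def ee_def e_lincomb_def e_weight_def coroot_def)
qed

text \<open>Antisymmetry cannot be read off from the formula defining the bracket. Two facts about
  roots replace it: a root differs from its negative, which kills the Cartan part, and its double is
  not a root, which kills the root part.\<close>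

lemma bracket_root_self:
  assumes "\<alpha> \<in> e_roots n"
  shows "e_bracket n (ee \<alpha>) (ee \<alpha>) = e_lincomb 0 (ee \<alpha>) 0 (ee \<alpha>)"
proof -
  have a0: "\<alpha> \<noteq> - \<alpha>"
  proof
    assume "\<alpha> = - \<alpha>"
    hence "\<alpha> i = - \<alpha> i" for i by (metis uminus_apply)
    hence "\<alpha> = (\<lambda>_. 0)" by (auto simp: fun_eq_iff)
    thus False using assms zero_notin_e_roots by simp
  qed
  have "(\<Sum>\<beta>\<in>e_roots n. (if \<beta> = \<alpha> then 1 else 0) * (if - \<beta> = \<alpha> then 1 else 0) * of_int (\<beta> i))
      = (0 :: complex)" for i
    using a0 by (intro sum.neutral) auto
  moreover have "(\<Sum>\<beta> | \<beta> \<in> e_roots n \<and> \<gamma> - \<beta> \<in> e_roots n.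
      e_sign n \<beta> (\<gamma> - \<beta>) * (if \<beta> = \<alpha> then 1 else 0) * (if \<gamma> - \<beta> = \<alpha> then 1 else 0)) = 0"
    if "\<gamma> \<in> e_roots n" for \<gamma>
  proof (rule sum.neutral, clarify)
    fix \<beta> assume "\<gamma> - \<beta> \<in> e_roots n"
    have "\<not> (\<beta> = \<alpha> \<and> \<gamma> - \<beta> = \<alpha>)"
    proof
      assume "\<beta> = \<alpha> \<and> \<gamma> - \<beta> = \<alpha>"
      hence "\<gamma> = (\<lambda>i. 2 * \<alpha> i)" by (auto simp: fun_eq_iff algebra_simps)
      thus False using that e_roots_double assms by simp
    qed
    thus "e_sign n \<beta> (\<gamma> - \<beta>) * (if \<beta> = \<alpha> then 1 else 0) * (if \<gamma> - \<beta> = \<alpha> then 1 else 0) = 0" by auto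
  qed
  ultimately show ?thesis
    by (intro prod_eqI ext) (auto simp: e_bracket_def ee_def e_lincomb_def e_weight_def coroot_def)
qed

text \<open>The Cartan form is positive definite: completing squares along the Dynkin diagram,
  from the leaves to node 4, bounds every coordinate.\<close>

lemma finite_e_roots:
  assumes "n = 6 \<or> n = 7"
  shows "finite (e_roots n)"
proof -
  have bound: "\<bar>\<alpha> i\<bar> \<le> 4" if \<alpha>: "\<alpha> \<in> e_roots n" for \<alpha> i
  proof -
    have small: "\<bar>y\<bar> \<le> 4" if "y\<^sup>2 \<le> 24" for y :: int
    proof (rule ccontr)
      assume "\<not> \<bar>y\<bar> \<le> 4"
      hence "5\<^sup>2 \<le> \<bar>y\<bar>\<^sup>2" by (intro power_mono) auto
      thus False using that by simp
    qed
    have 7: "e_form 7 \<alpha> \<alpha> = 2"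
    proof (cases "n = 6")
      case True
      have "\<alpha> 7 = 0" using \<alpha> True by (simp add: e_roots_def)
      moreover have "{1..7} = insert 7 {1..6::nat}" by auto
      ultimately have "e_form 7 \<alpha> \<alpha> = e_form 6 \<alpha> \<alpha>" by (simp add: e_form_def)
      thus ?thesis using \<alpha> True by (simp add: e_roots_def)
    qed (use assms \<alpha> in \<open>simp add: e_roots_def\<close>)
    have 17: "{1..7} = {1,2,3,4,5,6,7::nat}" by auto
    \<comment> \<open>After completing squares from the leaves, the coefficient left for the square
      of \<alpha> 4 is 2 - 3/4 - 2/3 - 1/2 = 1/12; the factor 12 clears all denominators. At a root
      the total is 24, which is below 5^2.\<close>
    have "12 * e_form 7 \<alpha> \<alpha> = (\<alpha> 4)\<^sup>2 + (4 * \<alpha> 5 - 3 * \<alpha> 4)\<^sup>2 + 2 * (3 * \<alpha> 3 - 2 * \<alpha> 4)\<^sup>2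
      + 2 * (3 * \<alpha> 6 - 2 * \<alpha> 5)\<^sup>2 + 6 * (2 * \<alpha> 1 - \<alpha> 3)\<^sup>2 + 6 * (2 * \<alpha> 2 - \<alpha> 4)\<^sup>2
      + 6 * (2 * \<alpha> 7 - \<alpha> 6)\<^sup>2"
      unfolding e_form_def 17 by (simp add: e_cartan_def e_edges_def power2_eq_square algebra_simps)
    hence sum: "(\<alpha> 4)\<^sup>2 + (4 * \<alpha> 5 - 3 * \<alpha> 4)\<^sup>2 + 2 * (3 * \<alpha> 3 - 2 * \<alpha> 4)\<^sup>2
      + 2 * (3 * \<alpha> 6 - 2 * \<alpha> 5)\<^sup>2 + 6 * (2 * \<alpha> 1 - \<alpha> 3)\<^sup>2 + 6 * (2 * \<alpha> 2 - \<alpha> 4)\<^sup>2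
      + 6 * (2 * \<alpha> 7 - \<alpha> 6)\<^sup>2 = 24"
      using 7 by simp
    note pos = zero_le_power2[of "\<alpha> 4"] zero_le_power2[of "4 * \<alpha> 5 - 3 * \<alpha> 4"]
      zero_le_power2[of "3 * \<alpha> 3 - 2 * \<alpha> 4"] zero_le_power2[of "3 * \<alpha> 6 - 2 * \<alpha> 5"]
      zero_le_power2[of "2 * \<alpha> 1 - \<alpha> 3"] zero_le_power2[of "2 * \<alpha> 2 - \<alpha> 4"]
      zero_le_power2[of "2 * \<alpha> 7 - \<alpha> 6"]
    have b4: "\<bar>\<alpha> 4\<bar> \<le> 4" by (rule small) (use sum pos in linarith)
    have "\<bar>4 * \<alpha> 5 - 3 * \<alpha> 4\<bar> \<le> 4" by (rule small) (use sum pos in linarith)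
    hence b5: "\<bar>\<alpha> 5\<bar> \<le> 4" using b4 by linarith
    have "\<bar>3 * \<alpha> 3 - 2 * \<alpha> 4\<bar> \<le> 4" by (rule small) (use sum pos in linarith)
    hence b3: "\<bar>\<alpha> 3\<bar> \<le> 4" using b4 by linarith
    have "\<bar>3 * \<alpha> 6 - 2 * \<alpha> 5\<bar> \<le> 4" by (rule small) (use sum pos in linarith)
    hence b6: "\<bar>\<alpha> 6\<bar> \<le> 4" using b5 by linarith
    have "\<bar>2 * \<alpha> 1 - \<alpha> 3\<bar> \<le> 4" by (rule small) (use sum pos in linarith)
    hence b1: "\<bar>\<alpha> 1\<bar> \<le> 4" using b3 by linarith
    have "\<bar>2 * \<alpha> 2 - \<alpha> 4\<bar> \<le> 4" by (rule small) (use sum pos in linarith)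
    hence b2: "\<bar>\<alpha> 2\<bar> \<le> 4" using b4 by linarith
    have "\<bar>2 * \<alpha> 7 - \<alpha> 6\<bar> \<le> 4" by (rule small) (use sum pos in linarith)
    hence b7: "\<bar>\<alpha> 7\<bar> \<le> 4" using b6 by linarith
    note b = b1 b2 b3 b4 b5 b6 b7
    show ?thesis
    proof (cases "i \<in> {1..7}")
      case True
      thus ?thesis using b unfolding 17 by blast
    next
      case False
      hence "\<alpha> i = 0" using \<alpha> assms by (auto simp: e_roots_def)
      thus ?thesis by simp
    qed
  qed
  have "finite {\<alpha>. \<forall>i. (i \<in> {1..n} \<longrightarrow> \<alpha> i \<in> {-4..4::int}) \<and> (i \<notin> {1..n} \<longrightarrow> \<alpha> i = 0)}"
    by (rule finite_set_of_finite_funs) auto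
  moreover have "e_roots n \<subseteq> {\<alpha>. \<forall>i. (i \<in> {1..n} \<longrightarrow> \<alpha> i \<in> {-4..4}) \<and> (i \<notin> {1..n} \<longrightarrow> \<alpha> i = 0)}"
  proof (intro subsetI CollectI allI conjI impI)
    fix \<alpha> i assume a: "\<alpha> \<in> e_roots n"
    show "\<alpha> i \<in> {-4..4}" using bound[OF a, of i] by auto
    assume "i \<notin> {1..n}"
    thus "\<alpha> i = 0" using a by (auto simp: e_roots_def)
  qed
  ultimately show ?thesis by (rule rev_finite_subset)
qed

text \<open>The hypothesis on root vectors is conditional so that the lemma serves twice: on the
  Cartan subalgebra, where the condition fails and only the simple coroots matter, and on the whole
  Lie algebra.\<close>

lemma linear_form_vanishes:
  fixes f :: "e_elt \<Rightarrow> complex"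
  assumes lin: "\<And>a u b v. f (e_lincomb a u b v) = a * f u + b * f v"
    and u: "u \<in> e_carrier n" and fin: "finite (e_roots n)"
    and h: "\<And>i. i \<in> {1..n} \<Longrightarrow> f (eh i) = 0"
    and e: "snd u \<noteq> (\<lambda>_. 0) \<Longrightarrow> \<forall>\<alpha> \<in> e_roots n. f (ee \<alpha>) = 0"
  shows "f u = 0"
proof -
  obtain k x where kx: "u = (k, x)" by fastforce
  have z: "f ((\<lambda>_. 0), (\<lambda>_. 0)) = 0"
    using lin[of 0 "eh 0" 0 "eh 0"] by (simp add: e_lincomb_def)
  have 1: "f ((\<lambda>i. if i \<in> A then k i else 0), (\<lambda>_. 0)) = 0" if "finite A" "A \<subseteq> {1..n}" for A
    using that
  proof (induction A rule: finite_induct)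
    case empty show ?case using z by simp
  next
    case (insert a A)
    have "((\<lambda>i. if i \<in> insert a A then k i else 0), (\<lambda>_. 0)) =
      e_lincomb (k a) (eh a) 1 ((\<lambda>i. if i \<in> A then k i else 0), (\<lambda>_. 0))"
      using insert.hyps by (auto simp: e_lincomb_def eh_def)
    thus ?case using lin insert h by simp
  qed
  have 2: "f ((\<lambda>_. 0), (\<lambda>\<alpha>. if \<alpha> \<in> A then x \<alpha> else 0)) = 0"
    if "finite A" "A \<subseteq> e_roots n" "x \<noteq> (\<lambda>_. 0)" for A
    using that
  proof (induction A rule: finite_induct)
    case empty show ?case using z by simp
  next
    case (insert a A)
    have "((\<lambda>_. 0), (\<lambda>\<alpha>. if \<alpha> \<in> insert a A then x \<alpha> else 0)) =
      e_lincomb (x a) (ee a) 1 ((\<lambda>_. 0), (\<lambda>\<alpha>. if \<alpha> \<in> A then x \<alpha> else 0))"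
      using insert.hyps by (auto simp: e_lincomb_def ee_def)
    thus ?case using lin insert e kx by simp
  qed
  have k: "(\<lambda>i. if i \<in> {1..n} then k i else 0) = k" using u kx by (auto simp: e_carrier_def)
  have x: "(\<lambda>\<alpha>. if \<alpha> \<in> e_roots n then x \<alpha> else 0) = x" using u kx by (auto simp: e_carrier_def)
  have "f (k, \<lambda>_. 0) = 0" using 1[of "{1..n}"] k by simp
  moreover have "f (\<lambda>_. 0, x) = 0" using 2[of "e_roots n"] fin x z by (cases "x = (\<lambda>_. 0)") simp_all
  moreover have "u = e_lincomb 1 (k, \<lambda>_. 0) 1 (\<lambda>_. 0, x)" using kx by (simp add: e_lincomb_def)
  ultimately show ?thesis using lin by simp
qed

text \<open>The form is determined on the Cartan subalgebra by the simple \<open>sl\<^sub>2\<close>-triples.  Applying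
  \<open>E\<^sub>\<alpha>\<close> to a tuple with one more Cartan argument then trades Cartan arguments for root vectors, one
  at a time; the \<open>polarize\<close> lemmas undo the symmetrisation that this entails.\<close>

locale invariant_quartic =
  fixes n :: nat and F :: "e_elt \<Rightarrow> e_elt \<Rightarrow> e_elt \<Rightarrow> e_elt \<Rightarrow> complex"
  assumes n: "n = 6 \<or> n = 7"
    and s12: "F u v w x = F v u w x"
    and s23: "F u v w x = F u w v x"
    and s34: "F u v w x = F u v x w"
    and lin: "F (e_lincomb a u b u') v w x = a * F u v w x + b * F u' v w x"
    and inv: "F (e_bracket n y u) v w x + F u (e_bracket n y v) w x
      + F u v (e_bracket n y w) x + F u v w (e_bracket n y x) = 0"
begin

lemma lin2: "F u (e_lincomb a v b v') w x = a * F u v w x + b * F u v' w x"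
  using lin s12 by metis
lemma lin3: "F u v (e_lincomb a w b w') x = a * F u v w x + b * F u v w' x"
  using lin2 s23 by metis
lemma lin4: "F u v w (e_lincomb a x b x') = a * F u v w x + b * F u v w x'"
  using lin3 s34 by metis
lemmas lins = lin lin2 lin3 lin4

lemma fin: "finite (e_roots n)" using n by (rule finite_e_roots)

text \<open>Let E, F' be the root vectors of the simple root and its negative. Apply invariance
  under E to the tuple (F', x, y, z): the Cartan arguments lie in the kernel of the root, so only
  [E, F'] survives, which is minus the coroot. This expresses that a form fixed by the simple
  reflection has no part of degree one in the coroot.\<close>

lemma odd_zero:
  assumes i: "i \<in> {1..n}" and "x \<in> e_cartan_alg n" "y \<in> e_cartan_alg n" "z \<in> e_cartan_alg n"
    and "wt n (simple_root i) x = 0" "wt n (simple_root i) y = 0" "wt n (simple_root i) z = 0"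
  shows "F (eh i) x y z = 0"
  using inv[of "ee (simple_root i)" "ee (- simple_root i)" x y z] assms simple_root_in[OF i] fin
  by (simp add: bracket_root_cartan bracket_root_neg lins coroot_simple)

text \<open>The part of degree three in the coroot, by two applications of E. On (f, f, e, x) it
  kills the mixed value at (coroot, f, e, x), since [e, e] = 0 and x is in the kernel of the root;
  on (f, coroot, coroot, x) it then leaves only the desired value.\<close>

lemma cubic_zero:
  assumes i: "i \<in> {1..n}" and "x \<in> e_cartan_alg n" and "wt n (simple_root i) x = 0"
  shows "F (eh i) (eh i) (eh i) x = 0"
proof -
  let ?e = "ee (simple_root i)" and ?f = "ee (- simple_root i)"
  have w: "wt n (simple_root i) (eh i) = 2" using wt_eh[OF i i] by simp
  have "- F (eh i) ?f ?e x - F ?f (eh i) ?e x = 0"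
    using inv[of ?e ?f ?f ?e x] assms simple_root_in[OF i] fin
    by (simp add: bracket_root_cartan bracket_root_neg bracket_root_self lins coroot_simple)
  hence 1: "F (eh i) ?f ?e x = 0" using s12[of "eh i" ?f] by simp
  have "- F (eh i) (eh i) (eh i) x - 2 * F ?f ?e (eh i) x - 2 * F ?f (eh i) ?e x = 0"
    using inv[of ?e ?f "eh i" "eh i" x] assms simple_root_in[OF i] fin eh_cartan[OF i] w
    by (simp add: bracket_root_cartan bracket_root_neg bracket_root_self lins coroot_simple)
  moreover have "F ?f ?e (eh i) x = 0" "F ?f (eh i) ?e x = 0" using 1 by (metis s12 s23)+
  ultimately show ?thesis by simp
qed

lemma zero_cartan:
  assumes 1: "F (eh 1) (eh 1) (eh 1) (eh 1) = 0"
    and u: "u \<in> e_cartan_alg n" "v \<in> e_cartan_alg n" "w \<in> e_cartan_alg n" "x \<in> e_cartan_alg n"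
  shows "F u v w x = 0"
proof -
  \<comment> \<open>Twice the projection of the coroot j to the kernel of the root i along the
    coroot i; the factor 2 avoids denominators.\<close>
  define p where "p i j = e_lincomb 2 (eh j) (- of_int (e_cartan i j)) (eh i)" for i j
  have p: "p i j \<in> e_cartan_alg n" "wt n (simple_root i) (p i j) = 0"
    if "i \<in> {1..n}" "j \<in> {1..n}" for i j
    using that by (auto simp: p_def wt_lincomb wt_eh intro!: lincomb_cartan eh_cartan)
  define g where "g i j k l = F (eh i) (eh j) (eh k) (eh l)" for i j k l
  have gs: "g i j k l = g j i k l" "g i j k l = g i k j l" "g i j k l = g i j l k" for i j k l
    unfolding g_def by (rule s12 s23 s34)+
  have cub: "g i i i j = of_int (e_cartan i j) / 2 * g i i i i" if "i \<in> {1..n}" "j \<in> {1..n}" for i j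
    using cubic_zero[OF that(1) p[OF that]] by (simp add: p_def lins g_def field_simps)
  have g0: "g i j k l = 0" if I: "i \<in> {1..n}" "j \<in> {1..n}" "k \<in> {1..n}" "l \<in> {1..n}" for i j k l
  proof (rule simple_tensor_zero[OF n, of g])
    fix i j k l assume I: "i \<in> {1..n}" "j \<in> {1..n}" "k \<in> {1..n}" "l \<in> {1..n}"
    have e: "g i j i i = g i i i j" "g i i k i = g i i i k" "g i j k i = g i i j k"
      "g i j i l = g i i j l" by (metis gs)+
    \<comment> \<open>Expanding the three projections yields 8 times the reflection identity, once
      the terms with index i occurring three times have been rewritten by the cubic
      relation.\<close>
    from odd_zero[OF I(1) p(1)[OF I(1,2)] p(1)[OF I(1,3)] p(1)[OF I(1,4)]
        p(2)[OF I(1,2)] p(2)[OF I(1,3)] p(2)[OF I(1,4)]]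
    have "8 * g i j k l - 4 * (of_int (e_cartan i j) * g i i k l + of_int (e_cartan i k) * g i i j l
        + of_int (e_cartan i l) * g i i j k)
      + 2 * (of_int (e_cartan i j) * of_int (e_cartan i k) * g i i i l
        + of_int (e_cartan i j) * of_int (e_cartan i l) * g i i i k
        + of_int (e_cartan i k) * of_int (e_cartan i l) * g i i i j)
      - of_int (e_cartan i j) * of_int (e_cartan i k) * of_int (e_cartan i l) * g i i i i = 0"
      unfolding p_def lins g_def[symmetric] e by (simp add: algebra_simps)
    hence "8 * g i j k l = 4 * (of_int (e_cartan i j) * g i i k l + of_int (e_cartan i k) * g i i j l
        + of_int (e_cartan i l) * g i i j k)
      - 2 * (of_int (e_cartan i j) * of_int (e_cartan i k) * of_int (e_cartan i l) * g i i i i)"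
      unfolding cub[OF I(1,2)] cub[OF I(1,3)] cub[OF I(1,4)] by (simp add: algebra_simps)
    thus "g i j k l = (of_int (e_cartan i j) * g i i k l + of_int (e_cartan i k) * g i i j l
        + of_int (e_cartan i l) * g i i j k) / 2
        - of_int (e_cartan i j * e_cartan i k * e_cartan i l) / 4 * g i i i i"
      by (simp add: field_simps)
  qed (use 1 gs cub I in \<open>auto simp: g_def\<close>)
  have ext: "f u = 0" if "\<And>a u b v. f (e_lincomb a u b v) = a * f u + b * f v"
      "\<And>i. i \<in> {1..n} \<Longrightarrow> f (eh i) = 0" "u \<in> e_cartan_alg n" for f and u
    using linear_form_vanishes[of f u n] that fin by (simp add: e_cartan_alg_def)
  have "F u v w x = 0" if "u \<in> e_cartan_alg n" "v \<in> e_cartan_alg n" "w \<in> e_cartan_alg n" "x \<in> e_cartan_alg n"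
    for u v w x
    apply (rule ext[of "\<lambda>u. F u v w x"], rule lins)
     apply (rule ext[of "\<lambda>v. F (eh _) v w x"], rule lins)
      apply (rule ext[of "\<lambda>w. F (eh _) (eh _) w x"], rule lins)
       apply (rule ext[of "\<lambda>x. F (eh _) (eh _) (eh _) x"], rule lins)
    using g0 that by (auto simp: g_def)
  thus ?thesis using u by blast
qed

text \<open>A root takes the value 2 on its own coroot. Substituting the coroot for all arguments,
  then for all but one, and so on, frees the arguments of \<open>G\<close> one at a time; the
  versions with more arguments follow the same scheme.\<close>

lemma polarize1:
  assumes "\<alpha> \<in> e_roots n"
    and "\<And>v w. v \<in> e_cartan_alg n \<Longrightarrow> w \<in> e_cartan_alg n \<Longrightarrow> wt n \<alpha> v * G w + wt n \<alpha> w * G v = 0"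
    and "w \<in> e_cartan_alg n"
  shows "G w = (0::complex)"
proof -
  have c: "coroot \<alpha> \<in> e_cartan_alg n" "wt n \<alpha> (coroot \<alpha>) = 2"
    using assms coroot_cartan by (auto simp: wt_coroot e_roots_def)
  show ?thesis using assms(2)[OF c(1) c(1)] assms(2)[OF c(1) assms(3)] c by simp
qed

lemma polarize2:
  assumes "\<alpha> \<in> e_roots n"
    and G: "\<And>v w x. v \<in> e_cartan_alg n \<Longrightarrow> w \<in> e_cartan_alg n \<Longrightarrow> x \<in> e_cartan_alg n \<Longrightarrow>
      wt n \<alpha> v * G w x + wt n \<alpha> w * G v x + wt n \<alpha> x * G v w = 0"
    and w: "w \<in> e_cartan_alg n" "x \<in> e_cartan_alg n"
  shows "G w x = (0::complex)"
proof -
  define c where "c = coroot \<alpha>"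
  have c: "c \<in> e_cartan_alg n" "wt n \<alpha> c = 2"
    using assms coroot_cartan by (auto simp: wt_coroot e_roots_def c_def)
  have 0: "G c c = 0" using G[OF c(1) c(1) c(1)] c by simp
  have "G c x = 0" if "x \<in> e_cartan_alg n" for x using G[OF c(1) c(1) that] c 0 by simp
  thus ?thesis using G[OF c(1) w] w c by simp
qed

lemma polarize3:
  assumes "\<alpha> \<in> e_roots n"
    and G: "\<And>u v w x. u \<in> e_cartan_alg n \<Longrightarrow> v \<in> e_cartan_alg n \<Longrightarrow> w \<in> e_cartan_alg n \<Longrightarrow> x \<in> e_cartan_alg n \<Longrightarrow>
      wt n \<alpha> u * G v w x + wt n \<alpha> v * G u w x + wt n \<alpha> w * G u v x + wt n \<alpha> x * G u v w = 0"
    and w: "v \<in> e_cartan_alg n" "w \<in> e_cartan_alg n" "x \<in> e_cartan_alg n"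
  shows "G v w x = (0::complex)"
proof -
  define c where "c = coroot \<alpha>"
  have c: "c \<in> e_cartan_alg n" "wt n \<alpha> c = 2"
    using assms coroot_cartan by (auto simp: wt_coroot e_roots_def c_def)
  have 0: "G c c c = 0" using G[OF c(1) c(1) c(1) c(1)] c by simp
  have 1: "G c c x = 0" if "x \<in> e_cartan_alg n" for x using G[OF c(1) c(1) c(1) that] c 0 by simp
  have "G c w x = 0" if "w \<in> e_cartan_alg n" "x \<in> e_cartan_alg n" for w x
    using G[OF c(1) c(1) that] c 1 that by simp
  thus ?thesis using G[OF c(1) w] w c by simp
qed

theorem vanishes:
  assumes 1: "F (eh 1) (eh 1) (eh 1) (eh 1) = 0"
    and u: "u \<in> e_carrier n" "v \<in> e_carrier n" "w \<in> e_carrier n" "x \<in> e_carrier n"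
  shows "F u v w x = 0"
proof -
  let ?H = "e_cartan_alg n" and ?C = "e_carrier n"
  note K0 = zero_cartan[OF 1]
  have ext: "f u = 0" if "\<And>a u b v. f (e_lincomb a u b v) = a * f u + b * f v"
      "\<And>u. u \<in> ?H \<Longrightarrow> f u = 0" "\<And>\<alpha>. \<alpha> \<in> e_roots n \<Longrightarrow> f (ee \<alpha>) = 0" "u \<in> ?C" for f and u
    using linear_form_vanishes[of f u n] that fin eh_cartan by blast
  have K1: "F u v w x = 0" if "u \<in> ?C" "v \<in> ?H" "w \<in> ?H" "x \<in> ?H" for u v w x
  proof (rule ext[of "\<lambda>u. F u v w x"])
    fix \<alpha> assume a: "\<alpha> \<in> e_roots n"
    show "F (ee \<alpha>) v w x = 0"
    proof (rule polarize3[OF a])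
      fix u v w x assume "u \<in> ?H" "v \<in> ?H" "w \<in> ?H" "x \<in> ?H"
      hence "wt n \<alpha> u * F (ee \<alpha>) v w x + wt n \<alpha> v * F u (ee \<alpha>) w x
        + wt n \<alpha> w * F u v (ee \<alpha>) x + wt n \<alpha> x * F u v w (ee \<alpha>) = 0"
        using inv[of "ee \<alpha>" u v w x] a by (simp add: bracket_root_cartan lins add_eq_0_iff algebra_simps)
      moreover have "F u (ee \<alpha>) w x = F (ee \<alpha>) u w x" "F u v (ee \<alpha>) x = F (ee \<alpha>) u v x"
        "F u v w (ee \<alpha>) = F (ee \<alpha>) u v w" by (metis s12 s23 s34)+
      ultimately show "wt n \<alpha> u * F (ee \<alpha>) v w x + wt n \<alpha> v * F (ee \<alpha>) u w x
        + wt n \<alpha> w * F (ee \<alpha>) u v x + wt n \<alpha> x * F (ee \<alpha>) u v w = 0" by simp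
    qed (use that in auto)
  qed (use that K0 in \<open>auto simp: lins\<close>)
  have K2: "F u v w x = 0" if "u \<in> ?C" "v \<in> ?C" "w \<in> ?H" "x \<in> ?H" for u v w x
  proof (rule ext[of "\<lambda>v. F u v w x"])
    fix \<alpha> assume a: "\<alpha> \<in> e_roots n"
    show "F u (ee \<alpha>) w x = 0"
    proof (rule polarize2[OF a, of "\<lambda>w x. F u (ee \<alpha>) w x"])
      fix v w x assume H: "v \<in> ?H" "w \<in> ?H" "x \<in> ?H"
      \<comment> \<open>The root vector also acts on the argument that is already arbitrary. The
        result is again an element of the Lie algebra, so this contribution vanishes by the previous
        stage.\<close>
      hence "F (e_bracket n (ee \<alpha>) u) v w x = 0" using K1 e_bracket_carrier by blast
      hence "wt n \<alpha> v * F u (ee \<alpha>) w x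
        + wt n \<alpha> w * F u v (ee \<alpha>) x + wt n \<alpha> x * F u v w (ee \<alpha>) = 0"
        using inv[of "ee \<alpha>" u v w x] a H by (simp add: bracket_root_cartan lins add_eq_0_iff algebra_simps)
      moreover have "F u v (ee \<alpha>) x = F u (ee \<alpha>) v x"
        "F u v w (ee \<alpha>) = F u (ee \<alpha>) v w" by (metis s12 s23 s34)+
      ultimately show "wt n \<alpha> v * F u (ee \<alpha>) w x
        + wt n \<alpha> w * F u (ee \<alpha>) v x + wt n \<alpha> x * F u (ee \<alpha>) v w = 0" by simp
    qed (use that in auto)
  qed (use that K1 in \<open>auto simp: lins\<close>)
  have K3: "F u v w x = 0" if "u \<in> ?C" "v \<in> ?C" "w \<in> ?C" "x \<in> ?H" for u v w x
  proof (rule ext[of "\<lambda>w. F u v w x"])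
    fix \<alpha> assume a: "\<alpha> \<in> e_roots n"
    show "F u v (ee \<alpha>) x = 0"
    proof (rule polarize1[OF a, of "\<lambda>x. F u v (ee \<alpha>) x"])
      fix w x assume H: "w \<in> ?H" "x \<in> ?H"
      hence "F (e_bracket n (ee \<alpha>) u) v w x = 0" "F u (e_bracket n (ee \<alpha>) v) w x = 0"
        using K2 e_bracket_carrier that by blast+
      hence "wt n \<alpha> w * F u v (ee \<alpha>) x + wt n \<alpha> x * F u v w (ee \<alpha>) = 0"
        using inv[of "ee \<alpha>" u v w x] a H by (simp add: bracket_root_cartan lins add_eq_0_iff algebra_simps)
      thus "wt n \<alpha> w * F u v (ee \<alpha>) x + wt n \<alpha> x * F u v (ee \<alpha>) w = 0" using s34 by metis
    qed (use that in auto)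
  qed (use that K2 in \<open>auto simp: lins\<close>)
  show ?thesis
  proof (rule ext[of "\<lambda>x. F u v w x"])
    fix \<alpha> assume a: "\<alpha> \<in> e_roots n"
    have c: "coroot \<alpha> \<in> ?H" "wt n \<alpha> (coroot \<alpha>) = 2"
      using a coroot_cartan by (auto simp: wt_coroot e_roots_def)
    \<comment> \<open>With a single Cartan argument left no symmetrisation occurs: the coroot is
      inserted, three terms vanish by the previous stage, and the fourth is -2 times the wanted
      value.\<close>
    have "F (e_bracket n (ee \<alpha>) u) v w (coroot \<alpha>) = 0" "F u (e_bracket n (ee \<alpha>) v) w (coroot \<alpha>) = 0"
      "F u v (e_bracket n (ee \<alpha>) w) (coroot \<alpha>) = 0"
      using K3 e_bracket_carrier u c by blast+
    thus "F u v w (ee \<alpha>) = 0"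
      using inv[of "ee \<alpha>" u v w "coroot \<alpha>"] a c by (simp add: bracket_root_cartan lins)
  qed (use u K3 in \<open>auto simp: lins\<close>)
qed

end

section \<open>Traces and eigenvectors of complex matrices\<close>

lemma mult_square_carrier:
  "A \<in> carrier_mat n n \<Longrightarrow> B \<in> carrier_mat n n \<Longrightarrow> A * B \<in> carrier_mat n n"
  by (rule mult_carrier_mat)

definition tr :: "complex mat \<Rightarrow> complex" where
  "tr A = (\<Sum>i<dim_row A. A $$ (i, i))"

lemma tr_mult:
  assumes "A \<in> carrier_mat n m" "B \<in> carrier_mat m n"
  shows "tr (A * B) = (\<Sum>i<n. \<Sum>j<m. A $$ (i, j) * B $$ (j, i))"
  using assms by (auto simp: tr_def scalar_prod_def atLeast0LessThan intro!: sum.cong)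

lemma tr_comm:
  assumes "A \<in> carrier_mat n m" "B \<in> carrier_mat m n"
  shows "tr (A * B) = tr (B * A)"
  unfolding tr_mult[OF assms] tr_mult[OF assms(2,1)] by (subst sum.swap) (simp add: mult.commute)

lemma tr_add: "A \<in> carrier_mat n n \<Longrightarrow> B \<in> carrier_mat n n \<Longrightarrow> tr (A + B) = tr A + tr B"
  by (simp add: tr_def sum.distrib)

lemma tr_minus: "A \<in> carrier_mat n n \<Longrightarrow> B \<in> carrier_mat n n \<Longrightarrow> tr (A - B) = tr A - tr B"
  by (simp add: tr_def sum_subtractf)

lemma tr_smult: "A \<in> carrier_mat n n \<Longrightarrow> tr (c \<cdot>\<^sub>m A) = c * tr A"
  by (simp add: tr_def sum_distrib_left)

text \<open>The d + 1 vectors become the columns of a square matrix with an added zero row; its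
  determinant is 0, and a kernel vector gives the coefficients.\<close>

lemma krylov_dependent:
  fixes K :: "nat \<Rightarrow> complex vec"
  assumes "\<And>k. K k \<in> carrier_vec d"
  shows "\<exists>c. (\<exists>k\<le>d. c k \<noteq> 0) \<and> (\<forall>i<d. (\<Sum>k\<le>d. c k * K k $ i) = 0)"
proof -
  define C where "C = mat (Suc d) (Suc d) (\<lambda>(i, j). if i < d then K j $ i else 0)"
  have C: "C \<in> carrier_mat (Suc d) (Suc d)" by (simp add: C_def)
  have "C = mat\<^sub>r (Suc d) (Suc d) (\<lambda>i. if i = d then 0\<^sub>v (Suc d) else row C i)"
    by (rule eq_matI) (auto simp: C_def)
  moreover have "det (mat\<^sub>r (Suc d) (Suc d) (\<lambda>i. if i = d then 0\<^sub>v (Suc d) else row C i)) = 0"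
    by (rule det_row_0) (use C in auto)
  ultimately have "det C = 0" by simp
  then obtain v where v: "v \<in> carrier_vec (Suc d)" "v \<noteq> 0\<^sub>v (Suc d)" "C *\<^sub>v v = 0\<^sub>v (Suc d)"
    using det_0_iff_vec_prod_zero[OF C] by blast
  have "\<exists>k\<le>d. v $ k \<noteq> 0"
  proof (rule ccontr)
    assume "\<not> ?thesis"
    hence "v = 0\<^sub>v (Suc d)" using v(1) by (intro eq_vecI) auto
    thus False using v by simp
  qed
  moreover have "(\<Sum>k\<le>d. v $ k * K k $ i) = 0" if "i < d" for i
  proof -
    have "(C *\<^sub>v v) $ i = (\<Sum>k<Suc d. K k $ i * v $ k)"
      using that v(1) by (simp add: C_def scalar_prod_def atLeast0LessThan)
    also have "(C *\<^sub>v v) $ i = 0" using v(3) that by simp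
    finally show ?thesis by (simp add: mult.commute lessThan_Suc_atMost)
  qed
  ultimately show ?thesis by blast
qed

text \<open>The eigenvector is \<open>q(A) v\<close>, where \<open>(x - r) q\<close> is the minimal polynomial of \<open>v\<close>; so it inherits
  from \<open>v\<close> all eigenvector equations of operators that commute with \<open>A\<close>.\<close>

lemma common_eigenvector:
  fixes A :: "complex mat"
  assumes A: "A \<in> carrier_mat d d" and v: "v \<in> carrier_vec d" "v \<noteq> 0\<^sub>v d"
  shows "\<exists>w r. w \<in> carrier_vec d \<and> w \<noteq> 0\<^sub>v d \<and> A *\<^sub>v w = r \<cdot>\<^sub>v w \<and>
    (\<forall>B b. B \<in> carrier_mat d d \<longrightarrow> A * B = B * A \<longrightarrow> B *\<^sub>v v = b \<cdot>\<^sub>v v \<longrightarrow> B *\<^sub>v w = b \<cdot>\<^sub>v w)"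
proof -
  define K where "K k = (((*\<^sub>v) A) ^^ k) v" for k
  have K: "K k \<in> carrier_vec d" "K (Suc k) = A *\<^sub>v K k" for k
  proof -
    show "K k \<in> carrier_vec d" by (induction k) (use A v in \<open>auto simp: K_def\<close>)
  qed (simp add: K_def)
  \<comment> \<open>This is p(A) v as soon as \<open>N\<close> exceeds the degree of p; a separate
    bound lets p and its quotient by a linear factor be summed over matching ranges.\<close>
  define ap where "ap N p = vec d (\<lambda>i. \<Sum>k<N. coeff p k * K k $ i)" for N p
  have ap: "ap N p \<in> carrier_vec d" for N p by (simp add: ap_def)
  have lin: "B *\<^sub>v ap N p = vec d (\<lambda>i. \<Sum>k<N. coeff p k * (B *\<^sub>v K k) $ i)" if B: "B \<in> carrier_mat d d" for B N p
  proof (rule eq_vecI)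
    fix i assume "i < dim_vec (vec d (\<lambda>i. \<Sum>k<N. coeff p k * (B *\<^sub>v K k) $ i))"
    hence i: "i < d" by simp
    have dK: "dim_vec (K k) = d" for k using K(1)[of k] by simp
    have "(B *\<^sub>v ap N p) $ i = (\<Sum>j<d. \<Sum>k<N. B $$ (i, j) * (coeff p k * K k $ j))"
      using B i by (simp add: ap_def scalar_prod_def atLeast0LessThan sum_distrib_left)
    also have "\<dots> = (\<Sum>k<N. \<Sum>j<d. B $$ (i, j) * (coeff p k * K k $ j))" by (rule sum.swap)
    also have "\<dots> = (\<Sum>k<N. coeff p k * (B *\<^sub>v K k) $ i)"
      using B i dK by (simp add: scalar_prod_def atLeast0LessThan sum_distrib_left mult_ac)
    finally show "(B *\<^sub>v ap N p) $ i = vec d (\<lambda>i. \<Sum>k<N. coeff p k * (B *\<^sub>v K k) $ i) $ i" using i by simp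
  qed (use that in simp)
  define P where "P m \<longleftrightarrow> (\<exists>p N. p \<noteq> 0 \<and> degree p = m \<and> m < N \<and> ap N p = 0\<^sub>v d)" for m
  obtain c where c: "\<exists>k\<le>d. c k \<noteq> 0" "\<And>i. i < d \<Longrightarrow> (\<Sum>k\<le>d. c k * K k $ i) = 0"
    using krylov_dependent[of K d] K by blast
  have "\<exists>m. P m"
  proof -
    define p where "p = (\<Sum>k\<le>d. monom (c k) k)"
    have cp: "coeff p k = (if k \<le> d then c k else 0)" for k
      by (simp add: p_def coeff_sum)
    hence "p \<noteq> 0" using c(1) by (metis coeff_0)
    moreover have "degree p < Suc d" using cp by (intro degree_lessI) auto
    moreover have "ap (Suc d) p = 0\<^sub>v d"
      by (rule eq_vecI) (use c(2) cp in \<open>simp_all add: ap_def lessThan_Suc_atMost\<close>)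
    ultimately show ?thesis unfolding P_def by blast
  qed
  then obtain m where m: "P m" "\<And>m'. P m' \<Longrightarrow> m \<le> m'" using exists_least_iff[of P] by (metis not_less)
  obtain p N where p: "p \<noteq> 0" "degree p = m" "m < N" "ap N p = 0\<^sub>v d" using m(1) P_def by blast
  have "m \<noteq> 0"
  proof
    assume m0: "m = 0"
    obtain a where a: "p = [:a:]" using p(2) m0 degree_eq_zeroE by blast
    have "ap N p = a \<cdot>\<^sub>v v"
    proof (rule eq_vecI)
      fix i assume "i < dim_vec (a \<cdot>\<^sub>v v)"
      hence i: "i < d" using v by simp
      have "(\<Sum>k<N. coeff p k * K k $ i) = (\<Sum>k<N. if k = 0 then a * v $ i else 0)"
        by (intro sum.cong) (auto simp: a K_def coeff_pCons split: nat.splits)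
      also have "\<dots> = a * v $ i" using p(3) m0 by simp
      finally show "ap N p $ i = (a \<cdot>\<^sub>v v) $ i" using i v by (simp add: ap_def)
    qed (use v in \<open>simp add: ap_def\<close>)
    hence "a \<cdot>\<^sub>v v = 0\<^sub>v d" using p by simp
    moreover have "a \<noteq> 0" using p(1) a by auto
    ultimately have "v = 0\<^sub>v d"
      using v(1) by (intro eq_vecI) (auto dest!: arg_cong[of _ _ "\<lambda>x. x $ _"] simp: vec_eq_iff)
    thus False using v by simp
  qed
  hence "\<not> constant (poly p)" using p(2) by (simp add: constant_degree)
  then obtain r where r: "poly p r = 0" using fundamental_theorem_of_algebra by blast
  then obtain q where q: "p = [:- r, 1:] * q" using poly_eq_0_iff_dvd dvdE by blast
  have q0: "q \<noteq> 0" using p(1) q by auto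
  have dq: "m = Suc (degree q)"
  proof -
    have "degree p = degree [:- r, 1:] + degree q" unfolding q using q0 by (intro degree_mult_eq) auto
    thus ?thesis using p(2) by simp
  qed
  obtain N' where N': "N = Suc N'" using p(3) by (cases N) auto
  have N'q: "degree q < N'" using p(3) dq N' by simp
  define w where "w = ap N' q"
  have w0: "w \<noteq> 0\<^sub>v d"
  proof
    assume "w = 0\<^sub>v d"
    hence "P (degree q)" unfolding P_def w_def using q0 N'q by blast
    thus False using m(2) dq by fastforce
  qed
  have Aw: "A *\<^sub>v w = r \<cdot>\<^sub>v w"
  proof (rule eq_vecI)
    fix i assume "i < dim_vec (r \<cdot>\<^sub>v w)"
    hence i: "i < d" by (simp add: w_def ap_def)
    have cf: "coeff p k = (case k of 0 \<Rightarrow> 0 | Suc l \<Rightarrow> coeff q l) - r * coeff q k" for k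
      unfolding q by (simp add: coeff_pCons split: nat.splits)
    have "0 = ap N p $ i" using p(4) i by simp
    also have "\<dots> = (\<Sum>k<N. (case k of 0 \<Rightarrow> 0 | Suc l \<Rightarrow> coeff q l) * K k $ i) - (\<Sum>k<N. r * coeff q k * K k $ i)"
      using i by (simp add: ap_def cf left_diff_distrib sum_subtractf)
    also have "(\<Sum>k<N. (case k of 0 \<Rightarrow> 0 | Suc l \<Rightarrow> coeff q l) * K k $ i) = (\<Sum>k<N'. coeff q k * K (Suc k) $ i)"
      unfolding N' sum.lessThan_Suc_shift by simp
    also have "\<dots> = (A *\<^sub>v w) $ i" unfolding w_def lin[OF A] using i by (simp add: K(2))
    also have "(\<Sum>k<N. r * coeff q k * K k $ i) = r * (\<Sum>k<N'. coeff q k * K k $ i)"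
      unfolding N' using N'q by (simp add: coeff_eq_0 sum_distrib_left mult_ac)
    also have "\<dots> = (r \<cdot>\<^sub>v w) $ i" using i by (simp add: w_def ap_def)
    finally show "(A *\<^sub>v w) $ i = (r \<cdot>\<^sub>v w) $ i" by simp
  qed (use A in \<open>simp add: w_def ap_def\<close>)
  have "B *\<^sub>v w = b \<cdot>\<^sub>v w" if B: "B \<in> carrier_mat d d" "A * B = B * A" "B *\<^sub>v v = b \<cdot>\<^sub>v v" for B b
  proof -
    have BK: "B *\<^sub>v K k = b \<cdot>\<^sub>v K k" for k
    proof (induction k)
      case 0 show ?case using B by (simp add: K_def)
    next
      case (Suc k)
      have "B *\<^sub>v K (Suc k) = (B * A) *\<^sub>v K k" using A B K by (simp add: assoc_mult_mat_vec[of _ d d _ d])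
      also have "\<dots> = A *\<^sub>v (B *\<^sub>v K k)" unfolding B(2)[symmetric] using A B(1) K by (simp add: assoc_mult_mat_vec[of _ d d _ d])
      also have "\<dots> = b \<cdot>\<^sub>v K (Suc k)" unfolding Suc K(2) using A K by (simp add: mult_mat_vec[of _ d d])
      finally show ?case .
    qed
    have "dim_vec (K k) = d" for k using K(1)[of k] by simp
    thus ?thesis unfolding w_def lin[OF B(1)] BK
      by (intro eq_vecI) (auto simp: ap_def sum_distrib_left mult_ac intro!: sum.cong)
  qed
  thus ?thesis using Aw w0 ap w_def by blast
qed

section \<open>Finiteness and reality of eigenvalues\<close>

lemma finite_eigenvalues:
  fixes A :: "complex mat"
  assumes "A \<in> carrier_mat d d"
  shows "finite {k. eigenvalue A k}"
proof -
  have "char_poly A \<noteq> 0" using degree_monic_char_poly[OF assms] by auto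
  thus ?thesis using poly_roots_finite eigenvalue_root_char_poly[OF assms] by simp
qed

text \<open>Nonzero terms would be eigenvectors for infinitely many distinct eigenvalues. This ends
  the strings obtained by raising and lowering operators.\<close>

lemma eigenvector_sequence_terminates:
  fixes H :: "complex mat" and s :: complex
  assumes H: "H \<in> carrier_mat d d" and x: "\<And>k. x k \<in> carrier_vec d"
    and e: "\<And>k. H *\<^sub>v x k = (a + s * of_nat k) \<cdot>\<^sub>v x k" and s: "s \<noteq> 0"
  shows "\<exists>k. x k = 0\<^sub>v d"
proof (rule ccontr)
  assume "\<not> ?thesis"
  hence "eigenvalue H (a + s * of_nat k)" for k
    unfolding eigenvalue_def eigenvector_def using H x e by (metis carrier_matD(1))
  hence "range (\<lambda>k::nat. a + s * of_nat k) \<subseteq> {k. eigenvalue H k}" by auto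
  moreover have "infinite (range (\<lambda>k::nat. a + s * of_nat k))"
    using s by (intro range_inj_infinite) (auto intro: injI)
  ultimately show False using finite_eigenvalues[OF H] finite_subset by blast
qed

text \<open>Raising v ends at a nonzero vector w of weight g = h + 2 k' killed by E. The lowering
  string of w also ends, and E F^(l+1) w = (l+1) (g - l) F^l w at its last nonzero term F^l w forces
  g = l. So h is even an integer; complete reducibility does not enter.\<close>

lemma sl2_eigenvalue_real:
  fixes E F H :: "complex mat"
  assumes c: "E \<in> carrier_mat d d" "F \<in> carrier_mat d d" "H \<in> carrier_mat d d"
    and HE: "H * E = E * H + 2 \<cdot>\<^sub>m E" and HF: "H * F = F * H - 2 \<cdot>\<^sub>m F" and EF: "E * F = F * E + H"
    and v: "v \<in> carrier_vec d" "v \<noteq> 0\<^sub>v d" "H *\<^sub>v v = h \<cdot>\<^sub>v v"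
  shows "h \<in> \<real>"
proof -
  have up: "H *\<^sub>v (E *\<^sub>v y) = (a + 2) \<cdot>\<^sub>v (E *\<^sub>v y)" if "y \<in> carrier_vec d" "H *\<^sub>v y = a \<cdot>\<^sub>v y" for y a
  proof -
    have "H *\<^sub>v (E *\<^sub>v y) = (H * E) *\<^sub>v y" using c that by (simp add: assoc_mult_mat_vec[of _ d d _ d])
    also have "\<dots> = E *\<^sub>v (H *\<^sub>v y) + 2 \<cdot>\<^sub>v (E *\<^sub>v y)" unfolding HE using c that(1)
      by (simp add: add_mult_distrib_mat_vec[of _ d d] assoc_mult_mat_vec[of _ d d _ d])
        (auto simp: scalar_prod_def sum_distrib_left mult_ac)
    also have "\<dots> = (a + 2) \<cdot>\<^sub>v (E *\<^sub>v y)" unfolding that(2) using c that(1)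
      by (simp add: mult_mat_vec[of _ d d] add_smult_distrib_vec)
    finally show ?thesis .
  qed
  have down: "H *\<^sub>v (F *\<^sub>v y) = (a - 2) \<cdot>\<^sub>v (F *\<^sub>v y)" if "y \<in> carrier_vec d" "H *\<^sub>v y = a \<cdot>\<^sub>v y" for y a
  proof -
    have "H *\<^sub>v (F *\<^sub>v y) = (H * F) *\<^sub>v y" using c that by (simp add: assoc_mult_mat_vec[of _ d d _ d])
    also have "\<dots> = F *\<^sub>v (H *\<^sub>v y) - 2 \<cdot>\<^sub>v (F *\<^sub>v y)" unfolding HF using c that(1)
      by (simp add: minus_mult_distrib_mat_vec[of _ d d] assoc_mult_mat_vec[of _ d d _ d])
        (auto simp: scalar_prod_def sum_distrib_left mult_ac)
    also have "\<dots> = (a - 2) \<cdot>\<^sub>v (F *\<^sub>v y)" unfolding that(2) using c that(1)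
      by (simp add: mult_mat_vec[of _ d d]) (auto simp: algebra_simps)
    finally show ?thesis .
  qed
  define x where "x k = (((*\<^sub>v) E) ^^ k) v" for k
  have x: "x k \<in> carrier_vec d" "H *\<^sub>v x k = (h + 2 * of_nat k) \<cdot>\<^sub>v x k" for k
  proof -
    have "x k \<in> carrier_vec d \<and> H *\<^sub>v x k = (h + 2 * of_nat k) \<cdot>\<^sub>v x k"
    proof (induction k)
      case (Suc k)
      have "x (Suc k) = E *\<^sub>v x k" by (simp add: x_def)
      thus ?case using up[of "x k"] Suc c by (simp add: algebra_simps)
    qed (use v in \<open>simp add: x_def\<close>)
    thus "x k \<in> carrier_vec d" "H *\<^sub>v x k = (h + 2 * of_nat k) \<cdot>\<^sub>v x k" by auto
  qed
  obtain k where "x k = 0\<^sub>v d" using eigenvector_sequence_terminates[OF c(3) x] by auto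
  then obtain k where k: "x k = 0\<^sub>v d" "\<And>l. l < k \<Longrightarrow> x l \<noteq> 0\<^sub>v d"
    using exists_least_iff[of "\<lambda>k. x k = 0\<^sub>v d"] by metis
  have "k \<noteq> 0" using k(1) v(2) by (auto simp: x_def)
  then obtain k' where k': "k = Suc k'" by (cases k) auto
  define w where "w = x k'"
  define g where "g = h + 2 * of_nat k'"
  have w: "w \<in> carrier_vec d" "w \<noteq> 0\<^sub>v d" "H *\<^sub>v w = g \<cdot>\<^sub>v w" "E *\<^sub>v w = 0\<^sub>v d"
    using x[of k'] k(1) k(2)[of k'] k' by (auto simp: w_def g_def x_def)
  define y where "y k = (((*\<^sub>v) F) ^^ k) w" for k
  have ys: "y (Suc k) = F *\<^sub>v y k" for k by (simp add: y_def)
  have y: "y k \<in> carrier_vec d" "H *\<^sub>v y k = (g + - 2 * of_nat k) \<cdot>\<^sub>v y k" for k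
  proof -
    have "y k \<in> carrier_vec d \<and> H *\<^sub>v y k = (g + - 2 * of_nat k) \<cdot>\<^sub>v y k"
    proof (induction k)
      case (Suc k)
      thus ?case using down[of "y k"] ys[of k] c by (simp add: algebra_simps)
    qed (use w in \<open>simp add: y_def\<close>)
    thus "y k \<in> carrier_vec d" "H *\<^sub>v y k = (g + - 2 * of_nat k) \<cdot>\<^sub>v y k" by auto
  qed
  have Ey: "E *\<^sub>v y (Suc k) = (of_nat (Suc k) * (g - of_nat k)) \<cdot>\<^sub>v y k" for k
  proof (induction k)
    have EFy: "E *\<^sub>v y (Suc k) = F *\<^sub>v (E *\<^sub>v y k) + H *\<^sub>v y k" for k
    proof -
      have "E *\<^sub>v y (Suc k) = (E * F) *\<^sub>v y k" using c y by (simp add: ys assoc_mult_mat_vec[of _ d d _ d])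
      also have "\<dots> = F *\<^sub>v (E *\<^sub>v y k) + H *\<^sub>v y k" unfolding EF using c y
        by (simp add: add_mult_distrib_mat_vec[of _ d d] assoc_mult_mat_vec[of _ d d _ d])
      finally show ?thesis .
    qed
    {
      case 0
      have "y 0 = w" by (simp add: y_def)
      moreover have "F *\<^sub>v 0\<^sub>v d = 0\<^sub>v d" using c by (intro eq_vecI) auto
      ultimately show ?case using EFy[of 0] w c by simp
    next
      case (Suc k)
      have "E *\<^sub>v y (Suc (Suc k)) = (of_nat (Suc k) * (g - of_nat k)) \<cdot>\<^sub>v y (Suc k)
          + (g + - 2 * of_nat (Suc k)) \<cdot>\<^sub>v y (Suc k)"
        unfolding EFy[of "Suc k"] Suc y(2) using c y by (simp add: mult_mat_vec[of _ d d] ys)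
      also have "\<dots> = (of_nat (Suc (Suc k)) * (g - of_nat (Suc k))) \<cdot>\<^sub>v y (Suc k)"
        unfolding add_smult_distrib_vec[symmetric] by (simp add: algebra_simps)
      finally show ?case .
    }
  qed
  obtain k where "y k = 0\<^sub>v d" using eigenvector_sequence_terminates[OF c(3) y] by auto
  then obtain k where k: "y k = 0\<^sub>v d" "\<And>l. l < k \<Longrightarrow> y l \<noteq> 0\<^sub>v d"
    using exists_least_iff[of "\<lambda>k. y k = 0\<^sub>v d"] by metis
  have "k \<noteq> 0" using k(1) w(2) by (auto simp: y_def)
  then obtain l where l: "k = Suc l" by (cases k) auto
  have "(of_nat (Suc l) * (g - of_nat l)) \<cdot>\<^sub>v y l = 0\<^sub>v d"
  proof -
    have "E *\<^sub>v 0\<^sub>v d = 0\<^sub>v d" using c by (intro eq_vecI) auto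
    thus ?thesis using Ey[of l] k(1) l by simp
  qed
  moreover obtain i where "i < d" "y l $ i \<noteq> 0"
    using k(2)[of l] l y(1)[of l] by (metis carrier_vecD eq_vecI index_zero_vec lessI)
  ultimately have "of_nat (Suc l) * (g - of_nat l) = 0"
    using y(1)[of l] by (metis carrier_vecD index_smult_vec(1) index_zero_vec(1) mult_eq_0_iff)
  hence "g = of_nat l" by (metis eq_iff_diff_eq_0 mult_eq_0_iff of_nat_neq_0)
  hence "h = of_int (int l - 2 * int k')" by (simp add: g_def algebra_simps)
  thus ?thesis by (metis Reals_of_int)
qed

text \<open>Triangularisation is enough: the diagonal of the square of an upper triangular matrix
  consists of the squares of its diagonal entries, which are the eigenvalues with
  multiplicity.\<close>

lemma real_eigenvalues_trace:
  fixes A :: "complex mat"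
  assumes A: "A \<in> carrier_mat d d" and re: "\<And>k. eigenvalue A k \<Longrightarrow> k \<in> \<real>"
  shows "\<exists>s :: nat \<Rightarrow> real. tr A = of_real (\<Sum>i<d. s i) \<and> tr (A * A) = of_real (\<Sum>i<d. (s i)\<^sup>2)"
proof -
  obtain es where es: "char_poly A = (\<Prod>a \<leftarrow> es. [:- a, 1:])" "length es = d"
    using char_poly_factorized[OF A] by blast
  obtain B P Q where "schur_decomposition A es = (B, P, Q)" by (metis prod_cases3)
  from schur_decomposition[OF A es(1) this]
  have B: "similar_mat_wit A B P Q" "upper_triangular B" "diag_mat B = es" by auto
  hence c: "B \<in> carrier_mat d d" "P \<in> carrier_mat d d" "Q \<in> carrier_mat d d"
    "P * Q = 1\<^sub>m d" "Q * P = 1\<^sub>m d" "A = P * B * Q"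
    using A unfolding similar_mat_wit_def Let_def by auto
  have trsim: "tr (P * X * Q) = tr X" if X: "X \<in> carrier_mat d d" for X
  proof -
    have "tr (P * X * Q) = tr (Q * (P * X))" using c X by (intro tr_comm) auto
    also have "Q * (P * X) = Q * P * X" using c(1-3) X by (simp add: assoc_mult_mat[of Q d d P d X d])
    also have "\<dots> = X" unfolding c(5) using X by simp
    finally show ?thesis .
  qed
  have AA: "A * A = P * (B * B) * Q"
  proof -
    have "A * A = P * B * (Q * P) * B * Q"
      unfolding c(6) using c(1,2,3) by (simp add: assoc_mult_mat[of _ d d _ d _ d])
    thus ?thesis using c(1,2,3,5) by (simp add: assoc_mult_mat[of _ d d _ d _ d])
  qed
  define s where "s i = Re (B $$ (i, i))" for i
  have s: "B $$ (i, i) = of_real (s i)" if "i < d" for i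
  proof -
    have "B $$ (i, i) \<in> set es" using that c(1) by (auto simp: B(3)[symmetric] diag_mat_def)
    hence "poly (char_poly A) (B $$ (i, i)) = 0"
      unfolding es(1) by (auto simp: poly_prod_list prod_list_zero_iff)
    hence "B $$ (i, i) \<in> \<real>" using re eigenvalue_root_char_poly[OF A] by blast
    thus ?thesis by (simp add: s_def)
  qed
  have "(B * B) $$ (i, i) = of_real ((s i)\<^sup>2)" if i: "i < d" for i
  proof -
    have "(B * B) $$ (i, i) = (\<Sum>j<d. B $$ (i, j) * B $$ (j, i))"
      using c(1) i by (simp add: scalar_prod_def atLeast0LessThan)
    also have "\<dots> = (\<Sum>j<d. if j = i then B $$ (i, i) * B $$ (i, i) else 0)"
    proof (intro sum.cong refl)
      fix j assume "j \<in> {..<d}"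
      hence "j < d" by simp
      consider "j = i" | "j < i" | "i < j" by linarith
      thus "B $$ (i, j) * B $$ (j, i) = (if j = i then B $$ (i, i) * B $$ (i, i) else 0)"
        using B(2) c(1) i \<open>j < d\<close> by cases (auto dest: upper_triangularD)
    qed
    finally show ?thesis using i s[OF i] by (simp add: power2_eq_square)
  qed
  hence "tr (B * B) = of_real (\<Sum>i<d. (s i)\<^sup>2)" using c(1) by (simp add: tr_def)
  moreover have "tr B = of_real (\<Sum>i<d. s i)" using c(1) s by (simp add: tr_def)
  moreover have "tr A = tr B" using trsim[OF c(1)] c(6) by simp
  moreover have "tr (A * A) = tr (B * B)" using AA trsim[of "B * B"] c(1) by simp
  ultimately show ?thesis by auto
qed

section \<open>Representations and the quartic trace identity\<close>

text \<open>The laws are imposed on all pairs of functions, including those outside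
  \<open>e_carrier n\<close>, which keeps the rewriting free of side conditions. A representation
  given on the carrier fits after composition with the projection onto it.\<close>

locale e_representation =
  fixes n d :: nat and \<psi> :: "e_elt \<Rightarrow> complex mat"
  assumes n: "n = 6 \<or> n = 7"
    and car [simp]: "\<psi> u \<in> carrier_mat d d"
    and lin: "\<psi> (e_lincomb a u b v) = a \<cdot>\<^sub>m \<psi> u + b \<cdot>\<^sub>m \<psi> v"
    and br: "\<psi> (e_bracket n u v) = \<psi> u * \<psi> v - \<psi> v * \<psi> u"
begin

lemma dim_\<psi> [simp]: "dim_row (\<psi> u) = d" "dim_col (\<psi> u) = d"
  using carrier_matD[OF car] by auto

declare mult_square_carrier [simp]

lemma lin_scale: "\<psi> (e_lincomb a u 0 u) = a \<cdot>\<^sub>m \<psi> u"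
  unfolding lin by (rule eq_matI) auto

definition form :: "e_elt \<Rightarrow> e_elt \<Rightarrow> complex" where
  "form u v = tr (\<psi> u * \<psi> v)"

definition quart :: "e_elt \<Rightarrow> e_elt \<Rightarrow> e_elt \<Rightarrow> e_elt \<Rightarrow> complex" where
  "quart u v w x = tr (\<psi> u * (\<psi> v * (\<psi> w * \<psi> x)))"

text \<open>Cyclic invariance of the trace allows the first argument to stay in place: the six
  orders of the others represent the full symmetrisation over 24 permutations.\<close>

definition sym_quart :: "e_elt \<Rightarrow> e_elt \<Rightarrow> e_elt \<Rightarrow> e_elt \<Rightarrow> complex" where
  "sym_quart u v w x = quart u v w x + quart u v x w + quart u w v x
    + quart u w x v + quart u x v w + quart u x w v"

definition sym_form2 :: "e_elt \<Rightarrow> e_elt \<Rightarrow> e_elt \<Rightarrow> e_elt \<Rightarrow> complex" where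
  "sym_form2 u v w x = form u v * form w x + form u w * form v x + form u x * form v w"

lemma tr_lin:
  assumes "M \<in> carrier_mat d d"
  shows "tr (\<psi> (e_lincomb a u b v) * M) = a * tr (\<psi> u * M) + b * tr (\<psi> v * M)"
proof -
  have "\<psi> (e_lincomb a u b v) * M = a \<cdot>\<^sub>m (\<psi> u * M) + b \<cdot>\<^sub>m (\<psi> v * M)"
    using assms by (simp add: lin add_mult_distrib_mat[of _ d d] mult_smult_assoc_mat[of _ d d])
  thus ?thesis using assms by (simp add: tr_add[of _ d] tr_smult[of _ d])
qed

lemma tr_br:
  assumes M: "M \<in> carrier_mat d d"
  shows "tr (\<psi> (e_bracket n u v) * M) = tr (\<psi> u * (\<psi> v * M)) - tr (\<psi> v * (\<psi> u * M))"
proof -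
  have "\<psi> (e_bracket n u v) * M = \<psi> u * (\<psi> v * M) - \<psi> v * (\<psi> u * M)"
    using M by (simp add: br minus_mult_distrib_mat[of _ d d] assoc_mult_mat[of _ d d _ d _ d])
  thus ?thesis using M by (simp add: tr_minus[of _ d])
qed

lemma form_sym: "form u v = form v u"
  unfolding form_def by (rule tr_comm) auto

lemma form_lin: "form (e_lincomb a u b v) w = a * form u w + b * form v w"
  by (simp add: form_def tr_lin)

lemma form_lin2: "form w (e_lincomb a u b v) = a * form w u + b * form w v"
  using form_lin form_sym by metis

lemma tr_rot: "M \<in> carrier_mat d d \<Longrightarrow> tr (\<psi> u * M) = tr (M * \<psi> u)"
  by (rule tr_comm) auto

lemma form_inv: "form (e_bracket n y u) v + form u (e_bracket n y v) = 0"
proof -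
  have "form (e_bracket n y u) v = tr (\<psi> y * (\<psi> u * \<psi> v)) - tr (\<psi> u * (\<psi> y * \<psi> v))"
    by (simp add: form_def tr_br)
  moreover have "form (e_bracket n y v) u = tr (\<psi> y * (\<psi> v * \<psi> u)) - tr (\<psi> v * (\<psi> y * \<psi> u))"
    by (simp add: form_def tr_br)
  moreover have "tr (\<psi> y * (\<psi> v * \<psi> u)) = tr (\<psi> u * (\<psi> y * \<psi> v))"
    by (subst (2) tr_rot) (auto simp: assoc_mult_mat[of _ d d _ d _ d])
  moreover have "tr (\<psi> y * (\<psi> u * \<psi> v)) = tr (\<psi> v * (\<psi> y * \<psi> u))"
    by (subst (2) tr_rot) (auto simp: assoc_mult_mat[of _ d d _ d _ d])
  ultimately show ?thesis using form_sym[of u] by simp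
qed

lemma quart_rot: "quart u v w x = quart v w x u"
  unfolding quart_def by (subst tr_rot) (auto simp: assoc_mult_mat[of _ d d _ d _ d])

lemma quart_lin: "quart (e_lincomb a u b u') v w x = a * quart u v w x + b * quart u' v w x"
  by (simp add: quart_def tr_lin)

text \<open>Each term is a difference of two traces of five factors. After cyclic rotation y moves
  through the word one place at a time and the sum telescopes.\<close>

lemma quart_inv:
  "quart (e_bracket n y u) v w x + quart u (e_bracket n y v) w x
    + quart u v (e_bracket n y w) x + quart u v w (e_bracket n y x) = 0"
proof -
  define W where "W a b c e f = tr (\<psi> a * (\<psi> b * (\<psi> c * (\<psi> e * \<psi> f))))" for a b c e f
  have rot: "W a b c e f = W b c e f a" for a b c e f
    unfolding W_def by (subst tr_rot) (auto simp: assoc_mult_mat[of _ d d _ d _ d])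
  have b: "quart (e_bracket n y a) b c e = W y a b c e - W a y b c e" for a b c e
    by (simp add: quart_def W_def tr_br)
  have "quart u (e_bracket n y v) w x = W y v w x u - W v y w x u"
    using b quart_rot by metis
  moreover have "quart u v (e_bracket n y w) x = W y w x u v - W w y x u v"
    using b quart_rot by metis
  moreover have "quart u v w (e_bracket n y x) = W y x u v w - W x y u v w"
    using b quart_rot by metis
  moreover have "W y v w x u = W u y v w x" "W v y w x u = W u v y w x" "W y w x u v = W u v y w x"
    "W w y x u v = W u v w y x" "W y x u v w = W u v w y x" "W x y u v w = W y u v w x"
    using rot by metis+
  ultimately show ?thesis using b[of u v w x] by simp
qed

lemma sym_quart_inv:
  "sym_quart (e_bracket n y u) v w x + sym_quart u (e_bracket n y v) w x
    + sym_quart u v (e_bracket n y w) x + sym_quart u v w (e_bracket n y x) = 0"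
proof -
  define I where "I u v w x = quart (e_bracket n y u) v w x + quart u (e_bracket n y v) w x
    + quart u v (e_bracket n y w) x + quart u v w (e_bracket n y x)" for u v w x
  have "sym_quart (e_bracket n y u) v w x + sym_quart u (e_bracket n y v) w x
    + sym_quart u v (e_bracket n y w) x + sym_quart u v w (e_bracket n y x)
    = I u v w x + I u v x w + I u w v x + I u w x v + I u x v w + I u x w v"
    by (simp add: I_def sym_quart_def add_ac)
  thus ?thesis by (simp add: I_def quart_inv)
qed

lemma sym_form2_inv:
  "sym_form2 (e_bracket n y u) v w x + sym_form2 u (e_bracket n y v) w x
    + sym_form2 u v (e_bracket n y w) x + sym_form2 u v w (e_bracket n y x) = 0"
proof -
  define I where "I u v = form (e_bracket n y u) v + form u (e_bracket n y v)" for u v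
  have "sym_form2 (e_bracket n y u) v w x + sym_form2 u (e_bracket n y v) w x
    + sym_form2 u v (e_bracket n y w) x + sym_form2 u v w (e_bracket n y x)
    = I u v * form w x + form u v * I w x + I u w * form v x + form u w * I v x
      + I u x * form v w + form u x * I v w"
    by (simp add: I_def sym_form2_def algebra_simps)
  thus ?thesis by (simp add: I_def form_inv)
qed

lemma sym_quart_s12: "sym_quart u v w x = sym_quart v u w x"
proof -
  have "quart v u w x = quart u w x v" "quart v u x w = quart u x w v" "quart v w u x = quart u x v w"
    "quart v w x u = quart u v w x" "quart v x u w = quart u w v x" "quart v x w u = quart u v x w"
    using quart_rot by metis+
  thus ?thesis by (simp add: sym_quart_def)
qed

text \<open>The coefficients stay free for two uses: (0, 1) shows that the trace form does not
  vanish at the first simple coroot, and (1, -2 c) gives the quartic identity.\<close>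

lemma quartic: "invariant_quartic n (\<lambda>u v w x. a * sym_quart u v w x + b * sym_form2 u v w x)"
proof
  fix u v w x y s t u'
  show "n = 6 \<or> n = 7" by (rule n)
  show "a * sym_quart u v w x + b * sym_form2 u v w x = a * sym_quart v u w x + b * sym_form2 v u w x"
    using sym_quart_s12[of u v] form_sym[of u v] by (simp add: sym_form2_def algebra_simps)
  show "a * sym_quart u v w x + b * sym_form2 u v w x = a * sym_quart u w v x + b * sym_form2 u w v x"
    using form_sym[of v w] by (simp add: sym_form2_def sym_quart_def algebra_simps)
  show "a * sym_quart u v w x + b * sym_form2 u v w x = a * sym_quart u v x w + b * sym_form2 u v x w"
    using form_sym[of w x] by (simp add: sym_form2_def sym_quart_def algebra_simps)
  show "a * sym_quart (e_lincomb s u t u') v w x + b * sym_form2 (e_lincomb s u t u') v w x =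
    s * (a * sym_quart u v w x + b * sym_form2 u v w x) + t * (a * sym_quart u' v w x + b * sym_form2 u' v w x)"
    by (simp add: sym_form2_def sym_quart_def quart_lin form_lin algebra_simps)
  show "a * sym_quart (e_bracket n y u) v w x + b * sym_form2 (e_bracket n y u) v w x +
       (a * sym_quart u (e_bracket n y v) w x + b * sym_form2 u (e_bracket n y v) w x) +
       (a * sym_quart u v (e_bracket n y w) x + b * sym_form2 u v (e_bracket n y w) x) +
       (a * sym_quart u v w (e_bracket n y x) + b * sym_form2 u v w (e_bracket n y x)) = 0"
  proof -
    have "a * p1 + b * q1 + (a * p2 + b * q2) + (a * p3 + b * q3) + (a * p4 + b * q4)
      = a * (p1 + p2 + p3 + p4) + b * (q1 + q2 + q3 + q4)" for p1 p2 p3 p4 q1 q2 q3 q4 :: complex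
      by (simp add: algebra_simps)
    thus ?thesis by (simp add: sym_quart_inv sym_form2_inv)
  qed
qed

text \<open>The quadratic counterpart of \<open>odd_zero\<close>: a Cartan element in the kernel of
  the root i is orthogonal to the coroot i. Hence on the Cartan subalgebra the trace form is
  proportional to the Cartan matrix along the diagram.\<close>

lemma form_simple:
  assumes I: "i \<in> {1..n}" "j \<in> {1..n}"
  shows "2 * form (eh i) (eh j) = of_int (e_cartan i j) * form (eh i) (eh i)"
proof -
  let ?x = "e_lincomb 2 (eh j) (- of_int (e_cartan i j)) (eh i)"
  have x: "?x \<in> e_cartan_alg n" using I by (intro lincomb_cartan eh_cartan)
  have "wt n (simple_root i) ?x = 0" using I by (simp add: wt_lincomb wt_eh)
  hence "form (eh i) ?x = 0"
    using form_inv[of "ee (simple_root i)" "ee (- simple_root i)" ?x] simple_root_in[OF I(1)] x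
      finite_e_roots[OF n]
    by (simp add: bracket_root_cartan bracket_root_neg coroot_simple form_lin form_lin2)
  thus ?thesis by (simp add: form_lin2)
qed

lemma eh_commute:
  assumes "i \<in> {1..n}" "j \<in> {1..n}"
  shows "\<psi> (eh i) * \<psi> (eh j) = \<psi> (eh j) * \<psi> (eh i)"
proof -
  have "e_bracket n (eh i) (eh j) = e_lincomb 0 (eh i) 0 (eh i)"
    by (intro prod_eqI ext) (auto simp: e_bracket_def eh_def e_lincomb_def e_weight_def)
  hence z: "\<psi> (eh i) * \<psi> (eh j) - \<psi> (eh j) * \<psi> (eh i) = 0 \<cdot>\<^sub>m \<psi> (eh i)"
    using br lin_scale by metis
  show ?thesis
  proof (rule eq_matI)
    fix a b assume "a < dim_row (\<psi> (eh j) * \<psi> (eh i))" "b < dim_col (\<psi> (eh j) * \<psi> (eh i))"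
    thus "(\<psi> (eh i) * \<psi> (eh j)) $$ (a, b) = (\<psi> (eh j) * \<psi> (eh i)) $$ (a, b)"
      using arg_cong[OF z, of "\<lambda>M. M $$ (a, b)"] by simp
  qed auto
qed

lemma eh_eigenvalue_real:
  assumes i: "i \<in> {1..n}" and v: "v \<in> carrier_vec d" "v \<noteq> 0\<^sub>v d" "\<psi> (eh i) *\<^sub>v v = h \<cdot>\<^sub>v v"
  shows "h \<in> \<real>"
proof -
  let ?r = "simple_root i"
  \<comment> \<open>The sign in \<open>?F\<close> turns the convention [E, E_-] = - coroot of the
    model into the usual sl_2-relation.\<close>
  let ?E = "\<psi> (ee ?r)" and ?F = "(-1) \<cdot>\<^sub>m \<psi> (ee (- ?r))" and ?H = "\<psi> (eh i)"
  have r: "?r \<in> e_roots n" "- ?r \<in> e_roots n" using simple_root_in[OF i] e_roots_uminus by auto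
  have w: "wt n ?r (eh i) = 2" using wt_eh[OF i i] by simp
  moreover have "wt n (- ?r) (eh i) = - wt n ?r (eh i)"
    by (simp add: e_weight_def sum_negf)
  ultimately have w': "wt n (- ?r) (eh i) = -2" by simp
  have 1: "?E * ?H - ?H * ?E = (-2) \<cdot>\<^sub>m ?E"
    using br[of "ee ?r" "eh i"] bracket_root_cartan[OF r(1) eh_cartan[OF i]] w
    by (simp add: lin_scale)
  have 2: "\<psi> (ee (- ?r)) * ?H - ?H * \<psi> (ee (- ?r)) = 2 \<cdot>\<^sub>m \<psi> (ee (- ?r))"
    using br[of "ee (- ?r)" "eh i"] bracket_root_cartan[OF r(2) eh_cartan[OF i]] w'
    by (simp add: lin_scale)
  have 3: "?E * \<psi> (ee (- ?r)) - \<psi> (ee (- ?r)) * ?E = (-1) \<cdot>\<^sub>m ?H"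
    using br[of "ee ?r" "ee (- ?r)"] bracket_root_neg[OF r(1) finite_e_roots[OF n]]
    by (simp add: lin_scale coroot_simple)
  have ent: "A $$ (a, b) - B $$ (a, b) = C $$ (a, b)" if "A - B = C" "a < d" "b < d"
     "A \<in> carrier_mat d d" "B \<in> carrier_mat d d" for A B C :: "complex mat" and a b
    using that by auto
  note cm = mult_carrier_mat[OF car car]
  show ?thesis
  proof (rule sl2_eigenvalue_real[of ?E d ?F ?H])
    show "?H * ?E = ?E * ?H + 2 \<cdot>\<^sub>m ?E"
    proof (rule eq_matI)
      fix a b assume "a < dim_row (?E * ?H + 2 \<cdot>\<^sub>m ?E)" "b < dim_col (?E * ?H + 2 \<cdot>\<^sub>m ?E)"
      hence ab: "a < d" "b < d" using car by auto
      show "(?H * ?E) $$ (a, b) = (?E * ?H + 2 \<cdot>\<^sub>m ?E) $$ (a, b)"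
        using ent[OF 1 ab cm cm] ab car[of "ee ?r"] by (simp add: algebra_simps)
    qed (use car[of "ee ?r"] car[of "eh i"] in auto)
    have "?H * \<psi> (ee (- ?r)) = \<psi> (ee (- ?r)) * ?H - 2 \<cdot>\<^sub>m \<psi> (ee (- ?r))"
    proof (rule eq_matI)
      fix a b assume "a < dim_row (\<psi> (ee (- ?r)) * ?H - 2 \<cdot>\<^sub>m \<psi> (ee (- ?r)))" "b < dim_col (\<psi> (ee (- ?r)) * ?H - 2 \<cdot>\<^sub>m \<psi> (ee (- ?r)))"
      hence ab: "a < d" "b < d" using car[of "ee (- ?r)"] by auto
      show "(?H * \<psi> (ee (- ?r))) $$ (a, b) = (\<psi> (ee (- ?r)) * ?H - 2 \<cdot>\<^sub>m \<psi> (ee (- ?r))) $$ (a, b)"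
        using ent[OF 2 ab cm cm] ab car[of "ee (- ?r)"] by (simp add: algebra_simps)
    qed (use car[of "ee (- ?r)"] car[of "eh i"] in auto)
    thus "?H * ?F = ?F * ?H - 2 \<cdot>\<^sub>m ?F"
      unfolding mult_smult_distrib[OF car car] mult_smult_assoc_mat[OF car car]
      by (simp only:) (auto intro!: eq_matI simp: algebra_simps)
    show "?E * ?F = ?F * ?E + ?H"
    proof (rule eq_matI)
      fix a b assume "a < dim_row (?F * ?E + ?H)" "b < dim_col (?F * ?E + ?H)"
      hence ab: "a < d" "b < d" using car[of "eh i"] by auto
      show "(?E * ?F) $$ (a, b) = (?F * ?E + ?H) $$ (a, b)"
        unfolding mult_smult_distrib[OF car car] mult_smult_assoc_mat[OF car car]
        using ent[OF 3 ab cm cm] ab cm[of "ee ?r" "ee (- ?r)"] cm[of "ee (- ?r)" "ee ?r"] car[of "eh i"]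
        by (simp add: algebra_simps)
    qed (use car[of "ee ?r"] car[of "eh i"] car[of "ee (- ?r)"] in auto)
  qed (use v in auto)
qed

text \<open>The inequality is Cauchy--Schwarz for the eigenvalues of
  \<open>S = H\<^sub>2\<^sup>2 + H\<^sub>3\<^sup>2 + H\<^sub>5\<^sup>2\<close>, where \<open>H\<^sub>i\<close> represents the \<open>i\<close>-th simple coroot and the nodes 2, 3, 5
  are pairwise orthogonal: with \<open>b = tr H\<^sub>i\<^sup>2\<close> the quartic identity gives \<open>tr S = 3 b\<close> and
  \<open>tr S\<^sup>2 = 5 c b\<^sup>2\<close>.\<close>

theorem quartic_trace_identity:
  assumes u: "u \<in> e_carrier n" "tr (\<psi> u * \<psi> u) \<noteq> 0"
  shows "\<exists>c :: real. 9 \<le> 5 * d * c \<and> (\<forall>v \<in> e_carrier n.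
    tr (\<psi> v * (\<psi> v * (\<psi> v * \<psi> v))) = of_real c * (tr (\<psi> v * \<psi> v))\<^sup>2)"
proof -
  define b where "b = form (eh 1) (eh 1)"
  \<comment> \<open>If the trace form vanished at one coroot, the symmetrised square of the form
    would vanish identically, contradicting the assumption on u.\<close>
  have b0: "b \<noteq> 0"
  proof
    assume "b = 0"
    hence "1 * sym_form2 (eh 1) (eh 1) (eh 1) (eh 1) = 0" by (simp add: sym_form2_def b_def)
    with invariant_quartic.vanishes[OF quartic[of 0 1], of u u u u] u(1)
    have "sym_form2 u u u u = 0" by simp
    thus False using u(2) by (simp add: sym_form2_def form_def)
  qed
  define c where "c = quart (eh 1) (eh 1) (eh 1) (eh 1) / b\<^sup>2"
  \<comment> \<open>At the first simple coroot the symmetrised trace is 6 c b^2 and the symmetrised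
    square is 3 b^2; hence the factor 2 c.\<close>
  have F0: "sym_quart p q r s = 2 * c * sym_form2 p q r s"
    if "p \<in> e_carrier n" "q \<in> e_carrier n" "r \<in> e_carrier n" "s \<in> e_carrier n" for p q r s
  proof -
    have "1 * sym_quart (eh 1) (eh 1) (eh 1) (eh 1) + (-2 * c) * sym_form2 (eh 1) (eh 1) (eh 1) (eh 1) = 0"
      using b0 unfolding sym_quart_def sym_form2_def b_def[symmetric] c_def
      by (simp add: power2_eq_square)
    from invariant_quartic.vanishes[OF quartic[of 1 "-2 * c"] this that]
    show ?thesis by simp
  qed
  have id: "tr (\<psi> v * (\<psi> v * (\<psi> v * \<psi> v))) = c * (tr (\<psi> v * \<psi> v))\<^sup>2" if "v \<in> e_carrier n" for v
    using F0[OF that that that that]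
    by (simp add: sym_quart_def sym_form2_def quart_def form_def power2_eq_square)
  have I: "1 \<in> {1..n}" "2 \<in> {1..n}" "3 \<in> {1..n}" "4 \<in> {1..n}" "5 \<in> {1..n}" using n by auto
  have ehc: "eh i \<in> e_carrier n" if "i \<in> {1..n}" for i using eh_cartan[OF that] by (simp add: e_cartan_alg_def)
  have adj: "form (eh i) (eh i) = form (eh j) (eh j)"
    if "i \<in> {1..n}" "j \<in> {1..n}" "e_cartan i j = -1" for i j
  proof -
    have "e_cartan j i = -1" using that e_cartan_sym by metis
    thus ?thesis using form_simple[OF that(1,2)] form_simple[OF that(2,1)] that(3) form_sym[of "eh i" "eh j"]
      by simp
  qed
  have f: "form (eh 2) (eh 2) = b" "form (eh 3) (eh 3) = b" "form (eh 5) (eh 5) = b"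
  proof -
    have "form (eh 1) (eh 1) = form (eh 3) (eh 3)" "form (eh 3) (eh 3) = form (eh 4) (eh 4)"
      "form (eh 2) (eh 2) = form (eh 4) (eh 4)" "form (eh 4) (eh 4) = form (eh 5) (eh 5)"
      by (rule adj; use I in \<open>simp add: e_cartan_def e_edges_def\<close>)+
    thus "form (eh 2) (eh 2) = b" "form (eh 3) (eh 3) = b" "form (eh 5) (eh 5) = b"
      by (simp_all add: b_def)
  qed
  define H where "H i = \<psi> (eh i)" for i
  \<comment> \<open>The neighbours of the branch node. They are pairwise orthogonal and belong to
    both diagrams.\<close>
  define J where "J = {2, 3, 5::nat}"
  have JI: "i \<in> {1..n}" if "i \<in> J" for i using that I by (auto simp: J_def)
  have Hc: "H i \<in> carrier_mat d d" for i by (simp add: H_def)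
  have Hcom: "H i * H j = H j * H i" if "i \<in> J" "j \<in> J" for i j
    using eh_commute JI that by (simp add: H_def)
  have orth: "form (eh i) (eh j) = 0" if "i \<in> J" "j \<in> J" "i \<noteq> j" for i j
  proof -
    have "e_cartan i j = 0" using that by (auto simp: J_def e_cartan_def e_edges_def)
    thus ?thesis using form_simple JI that by fastforce
  qed
  have fJ: "form (eh i) (eh i) = b" if "i \<in> J" for i using that f by (auto simp: J_def)
  \<comment> \<open>Commuting operators make all six orders equal, so 6 times this trace is 2 c
    times 3 b^2 on the diagonal and 2 c times b^2 off it.\<close>
  have q: "quart (eh i) (eh i) (eh j) (eh j) = (if i = j then c * b\<^sup>2 else c * b\<^sup>2 / 3)"
    if "i \<in> J" "j \<in> J" for i j
  proof -
    note cm = mult_carrier_mat[OF Hc Hc]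
    have key: "H j * (H i * H j) = H i * (H j * H j)"
      using Hcom[OF that] Hc by (metis assoc_mult_mat)
    hence "H i * (H j * (H i * H j)) = H i * (H i * (H j * H j))" by simp
    moreover have "H i * (H j * (H j * H i)) = H i * (H i * (H j * H j))"
    proof -
      have "H j * (H j * H i) = H j * (H i * H j)" using Hcom[OF that] by simp
      thus ?thesis using key by simp
    qed
    ultimately have "sym_quart (eh i) (eh i) (eh j) (eh j) = 6 * quart (eh i) (eh i) (eh j) (eh j)"
      by (simp add: sym_quart_def quart_def H_def)
    moreover have "sym_form2 (eh i) (eh i) (eh j) (eh j) = (if i = j then 3 * b\<^sup>2 else b\<^sup>2)"
      using fJ that orth by (auto simp: sym_form2_def power2_eq_square)
    ultimately show ?thesis using F0[OF ehc ehc ehc ehc, of i i j j] JI that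
      by (cases "i = j") (auto simp: field_simps)
  qed
  define S where "S = H 2 * H 2 + H 3 * H 3 + H 5 * H 5"
  have Sc: "S \<in> carrier_mat d d" using Hc by (simp add: S_def)
  note cm = mult_carrier_mat[OF Hc Hc]
  have trS: "tr S = 3 * b"
    using f cm by (simp add: S_def tr_add[of _ d] form_def H_def)
  have qt: "tr (H i * H i * (H j * H j)) = quart (eh i) (eh i) (eh j) (eh j)" for i j
    unfolding quart_def H_def by (simp add: assoc_mult_mat[of _ d d _ d _ d])
  \<comment> \<open>Three diagonal terms c b^2 and six mixed terms c b^2 / 3 add up to 5 c
    b^2.\<close>
  have trSS: "tr (S * S) = 5 * c * b\<^sup>2"
  proof -
    have SS: "S * S = H 2 * H 2 * (H 2 * H 2) + (H 3 * H 3 * (H 2 * H 2) + H 5 * H 5 * (H 2 * H 2))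
      + (H 2 * H 2 * (H 3 * H 3) + (H 3 * H 3 * (H 3 * H 3) + H 5 * H 5 * (H 3 * H 3))
      + (H 2 * H 2 * (H 5 * H 5) + (H 3 * H 3 * (H 5 * H 5) + H 5 * H 5 * (H 5 * H 5))))"
    proof -
      have "(A + B + C) * (A + B + C) = A * A + (B * A + C * A)
        + (A * B + (B * B + C * B) + (A * C + (B * C + C * C)))"
        if "A \<in> carrier_mat d d" "B \<in> carrier_mat d d" "C \<in> carrier_mat d d" for A B C :: "complex mat"
        using that by (simp add: add_mult_distrib_mat[of _ d d] mult_add_distrib_mat[of _ d d])
      thus ?thesis using cm unfolding S_def by blast
    qed
    have tr9: "tr (M 2 2 + (M 3 2 + M 5 2)
      + (M 2 3 + (M 3 3 + M 5 3)
      + (M 2 5 + (M 3 5 + M 5 5)))) = tr (M 2 2) + (tr (M 3 2) + tr (M 5 2))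
      + (tr (M 2 3) + (tr (M 3 3) + tr (M 5 3))
      + (tr (M 2 5) + (tr (M 3 5) + tr (M 5 5))))"
      if "\<And>i j. M i j \<in> carrier_mat d d" for M :: "nat \<Rightarrow> nat \<Rightarrow> complex mat"
      using that by (simp add: tr_add[of _ d])
    have cc: "H i * H i * (H j * H j) \<in> carrier_mat d d" for i j
      using Hc by simp
    have "tr (S * S) = tr (H 2 * H 2 * (H 2 * H 2)) + (tr (H 3 * H 3 * (H 2 * H 2)) + tr (H 5 * H 5 * (H 2 * H 2)))
      + (tr (H 2 * H 2 * (H 3 * H 3)) + (tr (H 3 * H 3 * (H 3 * H 3)) + tr (H 5 * H 5 * (H 3 * H 3)))
      + (tr (H 2 * H 2 * (H 5 * H 5)) + (tr (H 3 * H 3 * (H 5 * H 5)) + tr (H 5 * H 5 * (H 5 * H 5)))))"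
      unfolding SS by (rule tr9[of "\<lambda>i j. H i * H i * (H j * H j)"]) (rule cc)
    also have "\<dots> = 5 * c * b\<^sup>2"
      unfolding qt using q by (simp add: J_def)
    finally show ?thesis .
  qed
  \<comment> \<open>From an eigenvector of S, common eigenvectors with the three commuting coroot
    operators are produced successively. The eigenvalue k is thereby a sum of squares of coroot
    eigenvalues, which are real.\<close>
  have "k \<in> \<real>" if k: "eigenvalue S k" for k
  proof -
    obtain v where v: "v \<in> carrier_vec d" "v \<noteq> 0\<^sub>v d" "S *\<^sub>v v = k \<cdot>\<^sub>v v"
      using k Sc unfolding eigenvalue_def eigenvector_def by auto
    have HS: "H i * S = S * H i" if i: "i \<in> J" for i
    proof -
      have "H i * (H j * H j) = H j * H j * H i" if "j \<in> J" for j
      proof -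
        have "H i * (H j * H j) = H i * H j * H j" by (rule assoc_mult_mat[OF Hc Hc Hc, symmetric])
        also have "\<dots> = H j * H i * H j" by (simp only: Hcom[OF i that])
        also have "\<dots> = H j * (H i * H j)" by (rule assoc_mult_mat[OF Hc Hc Hc])
        also have "\<dots> = H j * (H j * H i)" by (simp only: Hcom[OF i that])
        also have "\<dots> = H j * H j * H i" by (rule assoc_mult_mat[OF Hc Hc Hc, symmetric])
        finally show ?thesis .
      qed
      hence "H i * (H 2 * H 2) = H 2 * H 2 * H i" "H i * (H 3 * H 3) = H 3 * H 3 * H i"
        "H i * (H 5 * H 5) = H 5 * H 5 * H i" by (simp_all add: J_def)
      thus ?thesis unfolding S_def using Hc
        by (simp add: add_mult_distrib_mat[of _ d d _ _ d] mult_add_distrib_mat[of _ d d _ d])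
    qed
    have J: "2 \<in> J" "3 \<in> J" "5 \<in> J" by (auto simp: J_def)
    obtain v2 r2 where 2: "v2 \<in> carrier_vec d" "v2 \<noteq> 0\<^sub>v d" "H 2 *\<^sub>v v2 = r2 \<cdot>\<^sub>v v2" "S *\<^sub>v v2 = k \<cdot>\<^sub>v v2"
      using common_eigenvector[OF Hc v(1,2), of 2] v(3) Sc HS[OF J(1)] by metis
    obtain v3 r3 where 3: "v3 \<in> carrier_vec d" "v3 \<noteq> 0\<^sub>v d" "H 3 *\<^sub>v v3 = r3 \<cdot>\<^sub>v v3" "S *\<^sub>v v3 = k \<cdot>\<^sub>v v3"
      "H 2 *\<^sub>v v3 = r2 \<cdot>\<^sub>v v3"
      using common_eigenvector[OF Hc 2(1,2), of 3] 2(3,4) Sc HS[OF J(2)] Hc Hcom[OF J(2,1)] by metis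
    obtain v5 r5 where 5: "v5 \<in> carrier_vec d" "v5 \<noteq> 0\<^sub>v d" "H 5 *\<^sub>v v5 = r5 \<cdot>\<^sub>v v5" "S *\<^sub>v v5 = k \<cdot>\<^sub>v v5"
      "H 2 *\<^sub>v v5 = r2 \<cdot>\<^sub>v v5" "H 3 *\<^sub>v v5 = r3 \<cdot>\<^sub>v v5"
      using common_eigenvector[OF Hc 3(1,2), of 5] 3(3-5) Sc HS[OF J(3)] Hc Hcom[OF J(3,1)] Hcom[OF J(3,2)] by metis
    have sq: "(H i * H i) *\<^sub>v v5 = (r * r) \<cdot>\<^sub>v v5" if "H i *\<^sub>v v5 = r \<cdot>\<^sub>v v5" for i r
      using that 5(1) Hc by (simp add: assoc_mult_mat_vec[of _ d d _ d] mult_mat_vec[of _ d d] smult_smult_assoc)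
    have "S *\<^sub>v v5 = (r2 * r2 + r3 * r3 + r5 * r5) \<cdot>\<^sub>v v5"
      unfolding S_def using cm 5(1) sq[OF 5(5)] sq[OF 5(6)] sq[OF 5(3)]
      by (simp add: add_mult_distrib_mat_vec[of _ d d] add_smult_distrib_vec)
    moreover obtain i where "i < d" "v5 $ i \<noteq> 0"
      using 5(1,2) by (metis carrier_vecD eq_vecI index_zero_vec)
    ultimately have "k = r2 * r2 + r3 * r3 + r5 * r5"
      using 5(4,1) by (metis carrier_vecD index_smult_vec(1) mult_right_cancel)
    moreover have "r2 \<in> \<real>" "r3 \<in> \<real>" "r5 \<in> \<real>"
      using eh_eigenvalue_real[OF I(2) 5(1,2)] eh_eigenvalue_real[OF I(3) 5(1,2)]
        eh_eigenvalue_real[OF I(5) 5(1,2)] 5 unfolding H_def by blast+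
    ultimately show ?thesis by simp
  qed
  from real_eigenvalues_trace[OF Sc this] obtain s :: "nat \<Rightarrow> real" where
    s: "tr S = of_real (\<Sum>i<d. s i)" "tr (S * S) = of_real (\<Sum>i<d. (s i)\<^sup>2)" by blast
  \<comment> \<open>A priori b and c are complex; the real traces of S and of its square show that
    both are real.\<close>
  define b' where "b' = (\<Sum>i<d. s i) / 3"
  have b': "b = of_real b'"
  proof -
    have "b = 3 * b / 3" by simp
    also have "\<dots> = of_real b'" unfolding trS[symmetric] s(1) by (simp add: b'_def)
    finally show ?thesis .
  qed
  define c' where "c' = (\<Sum>i<d. (s i)\<^sup>2) / (5 * b'\<^sup>2)"
  have b'0: "b' \<noteq> 0" using b0 b' by auto
  have c': "c = of_real c'"
  proof -
    have "5 * c * b\<^sup>2 = of_real (\<Sum>i<d. (s i)\<^sup>2)" using s(2) trSS by simp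
    hence "c = of_real (\<Sum>i<d. (s i)\<^sup>2) / (5 * b\<^sup>2)" using b0 by (simp add: field_simps)
    thus ?thesis by (simp add: c'_def b')
  qed
  have "(\<Sum>i<d. s i)\<^sup>2 \<le> d * (\<Sum>i<d. (s i)\<^sup>2)"
  proof (cases "d = 0")
    case False
    define T where "T = (\<Sum>i<d. s i)"
    have "0 \<le> (\<Sum>i<d. (d * s i - T)\<^sup>2)" by (intro sum_nonneg) simp
    also have "\<dots> = (\<Sum>i<d. (real d)\<^sup>2 * (s i)\<^sup>2 - 2 * d * T * s i + T\<^sup>2)"
      by (intro sum.cong) (simp_all add: power2_eq_square algebra_simps)
    also have "\<dots> = (real d)\<^sup>2 * (\<Sum>i<d. (s i)\<^sup>2) - 2 * d * T * T + d * T\<^sup>2"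
      by (simp add: sum.distrib sum_subtractf T_def flip: sum_distrib_left)
    also have "\<dots> = d * (d * (\<Sum>i<d. (s i)\<^sup>2) - T\<^sup>2)"
      by (simp add: power2_eq_square algebra_simps)
    finally show ?thesis using False by (simp add: zero_le_mult_iff T_def)
  qed simp
  hence "9 * b'\<^sup>2 \<le> (5 * d * c') * b'\<^sup>2"
    using b'0 by (simp add: b'_def c'_def power2_eq_square field_simps)
  hence "9 \<le> 5 * d * c'" using b'0 by simp
  thus ?thesis using id c' by blast
qed

end

section \<open>Differentials of homomorphisms of algebraic groups\<close>

text \<open>Expressions for regular functions on \<open>GL\<^sub>N\<close>; \<open>Ent A B i j\<close> is the entry \<open>(A g B)\<^sub>i\<^sub>j\<close>, a shape that
  is preserved both by left translations and by left invariant vector fields.\<close>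

datatype rexp = Cst complex | Ent "complex mat" "complex mat" nat nat
  | Add rexp rexp | Mul rexp rexp | InvDet

primrec ev :: "rexp \<Rightarrow> complex mat \<Rightarrow> complex" where
  "ev (Cst c) g = c"
| "ev (Ent A B i j) g = (A * (g * B)) $$ (i, j)"
| "ev (Add e f) g = ev e g + ev f g"
| "ev (Mul e f) g = ev e g * ev f g"
| "ev InvDet g = 1 / det g"

text \<open>The left invariant vector field belonging to \<open>X\<close>, i.e. \<open>d/dt e(g (1 + t X))\<close> at \<open>t = 0\<close>.\<close>

primrec ld :: "complex mat \<Rightarrow> rexp \<Rightarrow> rexp" where
  "ld X (Cst c) = Cst 0"
| "ld X (Ent A B i j) = Ent A (X * B) i j"
| "ld X (Add e f) = Add (ld X e) (ld X f)"
| "ld X (Mul e f) = Add (Mul (ld X e) f) (Mul e (ld X f))"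
| "ld X InvDet = Mul (Cst (- tr X)) InvDet"

primrec wf_rexp :: "nat \<Rightarrow> rexp \<Rightarrow> bool" where
  "wf_rexp N (Cst c) \<longleftrightarrow> True"
| "wf_rexp N (Ent A B i j) \<longleftrightarrow> A \<in> carrier_mat N N \<and> B \<in> carrier_mat N N \<and> i < N \<and> j < N"
| "wf_rexp N (Add e f) \<longleftrightarrow> wf_rexp N e \<and> wf_rexp N f"
| "wf_rexp N (Mul e f) \<longleftrightarrow> wf_rexp N e \<and> wf_rexp N f"
| "wf_rexp N InvDet \<longleftrightarrow> True"

primrec translate :: "complex mat \<Rightarrow> rexp \<Rightarrow> rexp" where
  "translate A (Cst c) = Cst c"
| "translate A (Ent A' B i j) = Ent (A' * A) B i j"
| "translate A (Add e f) = Add (translate A e) (translate A f)"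
| "translate A (Mul e f) = Mul (translate A e) (translate A f)"
| "translate A InvDet = Mul (Cst (1 / det A)) InvDet"

primrec rsum :: "(nat \<Rightarrow> rexp) \<Rightarrow> nat \<Rightarrow> rexp" where
  "rsum f 0 = Cst 0"
| "rsum f (Suc n) = Add (rsum f n) (f n)"

lemma ev_rsum: "ev (rsum f n) g = (\<Sum>k<n. ev (f k) g)"
  by (induction n) auto

lemma ld_rsum: "ld X (rsum f n) = rsum (\<lambda>k. ld X (f k)) n"
  by (induction n) auto

lemma wf_rsum: "(\<And>k. k < n \<Longrightarrow> wf_rexp N (f k)) \<Longrightarrow> wf_rexp N (rsum f n)"
  by (induction n) auto

lemma wf_ld: "X \<in> carrier_mat N N \<Longrightarrow> wf_rexp N e \<Longrightarrow> wf_rexp N (ld X e)"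
  by (induction e) auto

lemma wf_translate: "A \<in> carrier_mat N N \<Longrightarrow> wf_rexp N e \<Longrightarrow> wf_rexp N (translate A e)"
  by (induction e) auto

lemma ev_translate:
  assumes "A \<in> carrier_mat N N" "g \<in> carrier_mat N N" "wf_rexp N e"
  shows "ev (translate A e) g = ev e (A * g)"
  using assms(3)
proof (induction e)
  case (Ent A' B i j)
  hence c: "A' \<in> carrier_mat N N" "B \<in> carrier_mat N N" by auto
  have "A' * A * (g * B) = A' * (A * (g * B))"
    using assms c by (intro assoc_mult_mat[of _ N N _ N _ N]) auto
  also have "A * (g * B) = A * g * B"
    using assms c by (simp add: assoc_mult_mat[of _ N N _ N _ N])
  finally show ?case by simp
qed (use assms in \<open>auto simp: det_mult[of _ N]\<close>)


text \<open>Left invariance of the vector field. It carries derivatives at the unit matrix to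
  arbitrary points.\<close>

lemma ev_ld_translate:
  assumes "A \<in> carrier_mat N N" "g \<in> carrier_mat N N" "X \<in> carrier_mat N N" "wf_rexp N e"
  shows "ev (ld X (translate A e)) g = ev (ld X e) (A * g)"
  using assms(4)
proof (induction e)
  case (Ent A' B i j)
  hence "wf_rexp N (Ent A' (X * B) i j)" using assms by auto
  from ev_translate[OF assms(1,2) this] show ?case by simp
next
  case (Mul e f)
  thus ?case using ev_translate[OF assms(1,2)] by simp
qed (use assms in \<open>auto simp: det_mult[of _ N]\<close>)

lemma ev_ld_linear:
  assumes c: "X \<in> carrier_mat N N" "Y \<in> carrier_mat N N" "g \<in> carrier_mat N N" "wf_rexp N e"
  shows "ev (ld (a \<cdot>\<^sub>m X + b \<cdot>\<^sub>m Y) e) g = a * ev (ld X e) g + b * ev (ld Y e) g"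
  using c(4)
proof (induction e)
  case (Ent A B i j)
  hence e: "A \<in> carrier_mat N N" "B \<in> carrier_mat N N" "i < N" "j < N" by auto
  have cc: "A * (g * (X * B)) \<in> carrier_mat N N" "A * (g * (Y * B)) \<in> carrier_mat N N"
    using c e by auto
  have "A * (g * ((a \<cdot>\<^sub>m X + b \<cdot>\<^sub>m Y) * B)) = a \<cdot>\<^sub>m (A * (g * (X * B))) + b \<cdot>\<^sub>m (A * (g * (Y * B)))"
    using c e by (simp add: mult_square_carrier add_mult_distrib_mat[of _ N N] mult_add_distrib_mat[of _ N N _ N]
      mult_smult_distrib[of _ N N _ N] mult_smult_assoc_mat[of _ N N _ N])
  thus ?case using cc e by simp
qed (use c in \<open>auto simp: algebra_simps tr_add[of _ N] tr_smult[of _ N] add_divide_distrib\<close>)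

text \<open>Matrix commutators correspond to commutators of derivations. In the product case the
  mixed first derivatives cancel, and for \<open>InvDet\<close> the trace of a commutator is
  0.\<close>

lemma ev_ld_commutator:
  assumes c: "X \<in> carrier_mat N N" "Y \<in> carrier_mat N N" "g \<in> carrier_mat N N" "wf_rexp N e"
  shows "ev (ld (Y * X - X * Y) e) g = ev (ld Y (ld X e)) g - ev (ld X (ld Y e)) g"
  using c(4)
proof (induction e)
  case (Ent A B i j)
  hence e: "A \<in> carrier_mat N N" "B \<in> carrier_mat N N" "i < N" "j < N" by auto
  have cc: "A * (g * (X * (Y * B))) \<in> carrier_mat N N" "A * (g * (Y * (X * B))) \<in> carrier_mat N N"
    using c e by auto
  have m: "Y * X \<in> carrier_mat N N" "X * Y \<in> carrier_mat N N" using c by auto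
  have "A * (g * ((Y * X - X * Y) * B)) = A * (g * (Y * (X * B))) - A * (g * (X * (Y * B)))"
    unfolding minus_mult_distrib_mat[OF m e(2)] using c e m
    by (simp add: mult_square_carrier mult_minus_distrib_mat[of _ N N _ N] assoc_mult_mat[of _ N N _ N _ N])
  thus ?case using cc e by simp
next
  case (Mul e f)
  hence IH: "ev (ld (Y * X - X * Y) e) g = ev (ld Y (ld X e)) g - ev (ld X (ld Y e)) g"
    "ev (ld (Y * X - X * Y) f) g = ev (ld Y (ld X f)) g - ev (ld X (ld Y f)) g" by auto
  show ?case unfolding ld.simps ev.simps IH by (simp add: algebra_simps)
next
  case InvDet
  have "tr (Y * X - X * Y) = 0"
    using c tr_comm[of X N N Y] by (simp add: tr_minus[of _ N])
  thus ?case by simp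
qed (use c in \<open>auto simp: algebra_simps\<close>)

text \<open>In the Leibniz expansion a permutation other than the identity moves at least two
  points. After differentiating one factor an off-diagonal entry of the unit matrix remains, so only
  the identity contributes.\<close>

lemma det_derivative_one:
  assumes \<gamma>: "\<And>s. \<gamma> s \<in> carrier_mat N N" "\<gamma> 0 = 1\<^sub>m N"
    and d: "\<And>i j. i < N \<Longrightarrow> j < N \<Longrightarrow> ((\<lambda>s::complex. \<gamma> s $$ (i, j)) has_field_derivative X $$ (i, j)) (at 0)"
    and X: "X \<in> carrier_mat N N"
  shows "((\<lambda>s. det (\<gamma> s)) has_field_derivative tr X) (at 0)"
proof -
  let ?P = "{p. p permutes {0..<N}}"
  have "((\<lambda>s. \<Sum>p\<in>?P. signof p * (\<Prod>i\<in>{0..<N}. \<gamma> s $$ (i, p i))) has_field_derivative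
    (\<Sum>p\<in>?P. signof p * (\<Sum>i\<in>{0..<N}. X $$ (i, p i) * (\<Prod>j\<in>{0..<N} - {i}. \<gamma> 0 $$ (j, p j))))) (at 0)"
  proof (intro DERIV_sum DERIV_cmult has_field_derivative_prod)
    fix p i assume "p \<in> ?P" "i \<in> {0..<N}"
    hence "i < N" "p i < N" using permutes_in_image by fastforce+
    thus "((\<lambda>s. \<gamma> s $$ (i, p i)) has_field_derivative X $$ (i, p i)) (at 0)" by (rule d)
  qed
  also have "(\<lambda>s. \<Sum>p\<in>?P. signof p * (\<Prod>i\<in>{0..<N}. \<gamma> s $$ (i, p i))) = (\<lambda>s. det (\<gamma> s))"
    using det_def'[OF \<gamma>(1)] by simp
  also have "(\<Sum>p\<in>?P. signof p * (\<Sum>i\<in>{0..<N}. X $$ (i, p i) * (\<Prod>j\<in>{0..<N} - {i}. \<gamma> 0 $$ (j, p j))))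
    = (\<Sum>p\<in>?P. if p = id then tr X else 0)"
  proof (intro sum.cong refl)
    fix p assume p: "p \<in> ?P"
    have "(\<Prod>j\<in>{0..<N} - {i}. \<gamma> 0 $$ (j, p j)) = 0" if "p \<noteq> id" "i < N" for i
    proof -
      have "\<exists>j\<in>{0..<N} - {i}. p j \<noteq> j"
      proof (rule ccontr)
        assume "\<not> ?thesis"
        hence fix': "p j = j" if "j \<noteq> i" for j using that p permutes_not_in[of p "{0..<N}"] by blast
        have "p i = i"
        proof (rule ccontr)
          assume "p i \<noteq> i"
          hence "p (p i) = p i" by (rule fix')
          hence "p i = i" using p permutes_inj injD by (metis mem_Collect_eq)
          thus False using \<open>p i \<noteq> i\<close> by simp
        qed
        hence "p = id" using fix' by (intro ext) (metis id_apply)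
        thus False using that by simp
      qed
      then obtain j where j: "j \<in> {0..<N} - {i}" "p j \<noteq> j" by blast
      moreover have "p j < N" using p j permutes_in_image by fastforce
      ultimately have "\<gamma> 0 $$ (j, p j) = 0" using \<gamma>(2) by auto
      thus ?thesis using j(1) by (intro prod_zero) auto
    qed
    moreover have "(\<Prod>j\<in>{0..<N} - {i}. \<gamma> 0 $$ (j, id j)) = 1" for i
      using \<gamma>(2) by (intro prod.neutral) auto
    ultimately have pr: "p \<noteq> id \<Longrightarrow> i < N \<Longrightarrow> (\<Prod>j\<in>{0..<N} - {i}. \<gamma> 0 $$ (j, p j)) = 0"
      "(\<Prod>j\<in>{0..<N} - {i}. \<gamma> 0 $$ (j, id j)) = 1" for i
      by blast+
    show "signof p * (\<Sum>i\<in>{0..<N}. X $$ (i, p i) * (\<Prod>j\<in>{0..<N} - {i}. \<gamma> 0 $$ (j, p j)))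
      = (if p = id then tr X else 0)"
    proof (cases "p = id")
      case True
      thus ?thesis using X pr(2) by (simp add: tr_def atLeast0LessThan)
    next
      case False
      have "(\<Sum>i\<in>{0..<N}. X $$ (i, p i) * (\<Prod>j\<in>{0..<N} - {i}. \<gamma> 0 $$ (j, p j))) = 0"
      proof (intro sum.neutral ballI)
        fix i assume "i \<in> {0..<N}"
        hence "(\<Prod>j\<in>{0..<N} - {i}. \<gamma> 0 $$ (j, p j)) = 0" using pr(1) False by simp
        thus "X $$ (i, p i) * (\<Prod>j\<in>{0..<N} - {i}. \<gamma> 0 $$ (j, p j)) = 0" by (simp only: mult_zero_right)
      qed
      thus ?thesis using False by simp
    qed
  qed
  also have "\<dots> = tr X" by (simp add: finite_permutations permutes_id)
  finally show ?thesis .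
qed

lemma mat_entry_derivative:
  assumes "A \<in> carrier_mat N N" "B \<in> carrier_mat N N" "\<And>s. \<gamma> s \<in> carrier_mat N N" "V \<in> carrier_mat N N"
    and d: "\<And>i j. i < N \<Longrightarrow> j < N \<Longrightarrow> ((\<lambda>s::complex. \<gamma> s $$ (i, j)) has_field_derivative V $$ (i, j)) (at 0)"
    and ij: "i < N" "j < N"
  shows "((\<lambda>s. (A * (\<gamma> s * B)) $$ (i, j)) has_field_derivative (A * (V * B)) $$ (i, j)) (at 0)"
proof -
  have e: "(A * (M * B)) $$ (i, j) = (\<Sum>k<N. A $$ (i, k) * (\<Sum>l<N. M $$ (k, l) * B $$ (l, j)))"
    if "M \<in> carrier_mat N N" for M
    using assms that by (simp add: scalar_prod_def atLeast0LessThan)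
  show ?thesis unfolding e[OF assms(3)] e[OF assms(4)]
    by (intro DERIV_sum DERIV_cmult DERIV_cmult_right d) auto
qed

lemma mat_inverse_exists:
  assumes "g \<in> carrier_mat N N" "det g \<noteq> (0 :: complex)"
  shows "\<exists>h \<in> carrier_mat N N. h * g = 1\<^sub>m N \<and> g * h = 1\<^sub>m N"
  using det_non_zero_imp_unit[OF assms, of "()"]
  unfolding Units_def ring_mat_def by auto

lemma det_derivative:
  assumes \<gamma>: "\<And>s. \<gamma> s \<in> carrier_mat N N" "\<gamma> 0 = g"
    and d: "\<And>i j. i < N \<Longrightarrow> j < N \<Longrightarrow> ((\<lambda>s::complex. \<gamma> s $$ (i, j)) has_field_derivative (g * X) $$ (i, j)) (at 0)"
    and X: "X \<in> carrier_mat N N" and g: "g \<in> carrier_mat N N" "det g \<noteq> 0"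
  shows "((\<lambda>s. det (\<gamma> s)) has_field_derivative det g * tr X) (at 0)"
proof -
  obtain h where h: "h \<in> carrier_mat N N" "h * g = 1\<^sub>m N" "g * h = 1\<^sub>m N" using mat_inverse_exists[OF g] by blast
  have "((\<lambda>s. det (h * (\<gamma> s * 1\<^sub>m N))) has_field_derivative tr X) (at 0)"
  proof (rule det_derivative_one[OF _ _ _ X])
    show "h * (\<gamma> s * 1\<^sub>m N) \<in> carrier_mat N N" for s using h \<gamma> by auto
    show "h * (\<gamma> 0 * 1\<^sub>m N) = 1\<^sub>m N" using h \<gamma> g by simp
    fix i j assume ij: "i < N" "j < N"
    have gX: "g * X \<in> carrier_mat N N" using g X by auto
    have "h * (g * X * 1\<^sub>m N) = X"
    proof -
      have "h * (g * X * 1\<^sub>m N) = h * (g * X)" by (simp only: right_mult_one_mat[OF gX])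
      also have "\<dots> = h * g * X" using assoc_mult_mat[OF h(1) g(1) X] by simp
      also have "\<dots> = X" unfolding h(2) using X by simp
      finally show ?thesis .
    qed
    thus "((\<lambda>s. (h * (\<gamma> s * 1\<^sub>m N)) $$ (i, j)) has_field_derivative X $$ (i, j)) (at 0)"
      using mat_entry_derivative[OF h(1) one_carrier_mat \<gamma>(1) gX d ij] by simp
  qed
  hence "((\<lambda>s. det g * det (h * (\<gamma> s * 1\<^sub>m N))) has_field_derivative det g * tr X) (at 0)"
    by (rule DERIV_cmult)
  moreover have "det g * det (h * (\<gamma> s * 1\<^sub>m N)) = det (\<gamma> s)" for s
  proof -
    have "det g * det (h * (\<gamma> s * 1\<^sub>m N)) = det g * det h * det (\<gamma> s)"
      unfolding right_mult_one_mat[OF \<gamma>(1)] det_mult[OF h(1) \<gamma>(1)] by simp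
    also have "det g * det h = 1" using h g by (simp flip: det_mult[of _ N])
    finally show ?thesis by simp
  qed
  ultimately show ?thesis by simp
qed

lemma ev_derivative:
  assumes \<gamma>: "\<And>s. \<gamma> s \<in> carrier_mat N N" "\<gamma> 0 = g"
    and d: "\<And>i j. i < N \<Longrightarrow> j < N \<Longrightarrow> ((\<lambda>s::complex. \<gamma> s $$ (i, j)) has_field_derivative (g * X) $$ (i, j)) (at 0)"
    and X: "X \<in> carrier_mat N N" and g: "g \<in> carrier_mat N N" "det g \<noteq> 0"
    and e: "wf_rexp N e"
  shows "((\<lambda>s. ev e (\<gamma> s)) has_field_derivative ev (ld X e) g) (at 0)"
  using e
proof (induction e)
  case (Ent A B i j)
  hence e: "A \<in> carrier_mat N N" "B \<in> carrier_mat N N" "i < N" "j < N" by auto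
  have gX: "g * X \<in> carrier_mat N N" using g X by auto
  have "g * X * B = g * (X * B)" using g X e by (simp add: assoc_mult_mat[of _ N N _ N _ N])
  thus ?case using mat_entry_derivative[OF e(1,2) \<gamma>(1) gX d e(3,4)] by simp
next
  case (Mul e f)
  thus ?case using \<gamma>(2) by (auto intro!: derivative_eq_intros)
next
  case InvDet
  have "((\<lambda>s. 1 / det (\<gamma> s)) has_field_derivative
      (0 * det (\<gamma> 0) - 1 * (det g * tr X)) / (det (\<gamma> 0) * det (\<gamma> 0))) (at 0)"
    using det_derivative[OF assms(1-6)] \<gamma>(2) g by (intro DERIV_divide DERIV_const) auto
  moreover have "(0 * det (\<gamma> 0) - 1 * (det g * tr X)) / (det (\<gamma> 0) * det (\<gamma> 0)) = - tr X * (1 / det g)"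
    using \<gamma>(2) g by simp
  ultimately show ?case by simp
qed (auto intro!: derivative_eq_intros)

lemma line_curve:
  assumes "X \<in> carrier_mat N N"
  shows "1\<^sub>m N + (s::complex) \<cdot>\<^sub>m X \<in> carrier_mat N N" "1\<^sub>m N + 0 \<cdot>\<^sub>m X = 1\<^sub>m N"
    and "i < N \<Longrightarrow> j < N \<Longrightarrow> ((\<lambda>s. (1\<^sub>m N + s \<cdot>\<^sub>m X) $$ (i, j)) has_field_derivative (1\<^sub>m N * X) $$ (i, j)) (at 0)"
proof -
  show "1\<^sub>m N + 0 \<cdot>\<^sub>m X = 1\<^sub>m N" using assms by (intro eq_matI) auto
  assume ij: "i < N" "j < N"
  have "((\<lambda>s. 1\<^sub>m N $$ (i, j) + s * X $$ (i, j)) has_field_derivative (1\<^sub>m N * X) $$ (i, j)) (at 0)"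
    using assms by (auto intro!: derivative_eq_intros)
  moreover have "(1\<^sub>m N + s \<cdot>\<^sub>m X) $$ (i, j) = 1\<^sub>m N $$ (i, j) + s * X $$ (i, j)" for s
    using ij assms by simp
  ultimately show "((\<lambda>s. (1\<^sub>m N + s \<cdot>\<^sub>m X) $$ (i, j)) has_field_derivative (1\<^sub>m N * X) $$ (i, j)) (at 0)" by presburger
qed (use assms in auto)

lemma ev_line_derivative:
  assumes "X \<in> carrier_mat N N" "wf_rexp N e"
  shows "((\<lambda>s. ev e (1\<^sub>m N + s \<cdot>\<^sub>m X)) has_field_derivative ev (ld X e) (1\<^sub>m N)) (at 0)"
  by (rule ev_derivative[of "\<lambda>s. 1\<^sub>m N + s \<cdot>\<^sub>m X" N]) (use assms line_curve[OF assms(1)] in auto)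

section \<open>Regular functions as polynomials divided by powers of the determinant\<close>

lemma polyfuns_mono: "p \<in> polyfuns K n \<Longrightarrow> p \<in> polyfuns UNIV n"
  by (induction rule: polyfuns.induct) (auto intro: polyfuns.intros)

lemma polyfuns_sum: "finite I \<Longrightarrow> (\<And>i. i \<in> I \<Longrightarrow> f i \<in> polyfuns UNIV n) \<Longrightarrow> (\<lambda>g. \<Sum>i\<in>I. f i g) \<in> polyfuns UNIV n"
  by (induction rule: finite_induct) (auto intro: polyfuns.intros)

lemma polyfuns_prod: "finite I \<Longrightarrow> (\<And>i. i \<in> I \<Longrightarrow> f i \<in> polyfuns UNIV n) \<Longrightarrow> (\<lambda>g. \<Prod>i\<in>I. f i g) \<in> polyfuns UNIV n"
  by (induction rule: finite_induct) (auto intro: polyfuns.intros)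

lemma polyfuns_power: "f \<in> polyfuns UNIV n \<Longrightarrow> (\<lambda>g. f g ^ k) \<in> polyfuns UNIV n"
  by (induction k) (auto intro: polyfuns.intros)

lemma det_polyfun: "\<exists>p \<in> polyfuns UNIV n. \<forall>g \<in> carrier_mat n n. p g = det g"
proof -
  have "(\<lambda>g. \<Sum>p\<in>{p. p permutes {0..<n}}. signof p * (\<Prod>i\<in>{0..<n}. g $$ (i, p i))) \<in> polyfuns UNIV n"
  proof (intro polyfuns_sum polyfuns.mult polyfuns.const polyfuns_prod polyfuns.coord)
    show "finite {p. p permutes {0..<n}}" by (simp add: finite_permutations)
    fix p i assume "p \<in> {p. p permutes {0..<n}}" "i \<in> {0..<n}"
    thus "i < n" "p i < n" using permutes_in_image by fastforce+
  qed auto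
  thus ?thesis by (rule bexI[rotated]) (simp add: det_def')
qed

lemma polyfun_rexp: "p \<in> polyfuns K N \<Longrightarrow> \<exists>e. wf_rexp N e \<and> (\<forall>g \<in> carrier_mat N N. ev e g = p g)"
proof (induction rule: polyfuns.induct)
  case (const c) show ?case by (rule exI[of _ "Cst c"]) simp
next
  case (coord i j)
  thus ?case by (intro exI[of _ "Ent (1\<^sub>m N) (1\<^sub>m N) i j"]) auto
next
  case (add p q)
  then obtain e f where "wf_rexp N e" "\<forall>g \<in> carrier_mat N N. ev e g = p g"
    "wf_rexp N f" "\<forall>g \<in> carrier_mat N N. ev f g = q g" by blast
  thus ?case by (intro exI[of _ "Add e f"]) simp
next
  case (mult p q)
  then obtain e f where "wf_rexp N e" "\<forall>g \<in> carrier_mat N N. ev e g = p g"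
    "wf_rexp N f" "\<forall>g \<in> carrier_mat N N. ev f g = q g" by blast
  thus ?case by (intro exI[of _ "Mul e f"]) simp
qed

text \<open>Membership in \<open>lie_algebra\<close> tests polynomials only; clearing determinants
  makes it applicable to all regular expressions.\<close>

lemma rexp_polyfun:
  assumes "wf_rexp N e"
  shows "\<exists>p \<in> polyfuns UNIV N. \<exists>k. \<forall>g \<in> carrier_mat N N. det g \<noteq> 0 \<longrightarrow> ev e g * det g ^ k = p g"
  using assms
proof (induction e)
  case (Cst c)
  show ?case by (intro bexI[of _ "\<lambda>g. c"] exI[of _ 0]) (auto intro: polyfuns.intros)
next
  case (Ent A B i j)
  have "(\<lambda>g. \<Sum>k<N. A $$ (i, k) * (\<Sum>l<N. g $$ (k, l) * B $$ (l, j))) \<in> polyfuns UNIV N"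
    by (intro polyfuns_sum polyfuns.mult polyfuns.const polyfuns.coord) auto
  moreover have "(A * (g * B)) $$ (i, j) = (\<Sum>k<N. A $$ (i, k) * (\<Sum>l<N. g $$ (k, l) * B $$ (l, j)))"
    if "g \<in> carrier_mat N N" for g
  proof -
    have "A \<in> carrier_mat N N" "B \<in> carrier_mat N N" "i < N" "j < N" using Ent by auto
    thus ?thesis using that by (simp add: scalar_prod_def atLeast0LessThan)
  qed
  ultimately show ?case by (intro bexI exI[of _ 0]) auto
next
  case (Add e f)
  then obtain p k q l where *: "p \<in> polyfuns UNIV N" "\<forall>g \<in> carrier_mat N N. det g \<noteq> 0 \<longrightarrow> ev e g * det g ^ k = p g"
    "q \<in> polyfuns UNIV N" "\<forall>g \<in> carrier_mat N N. det g \<noteq> 0 \<longrightarrow> ev f g * det g ^ l = q g" by auto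
  obtain D where D: "D \<in> polyfuns UNIV N" "\<forall>g \<in> carrier_mat N N. D g = det g" using det_polyfun by blast
  show ?case
  proof (intro bexI exI ballI impI)
    show "(\<lambda>g. p g * D g ^ l + q g * D g ^ k) \<in> polyfuns UNIV N"
      by (intro polyfuns.add polyfuns.mult polyfuns_power * D)
    fix g :: "complex mat" assume g: "g \<in> carrier_mat N N" "det g \<noteq> 0"
    hence "p g = ev e g * det g ^ k" "q g = ev f g * det g ^ l" "D g = det g" using * D by auto
    thus "ev (Add e f) g * det g ^ (k + l) = p g * D g ^ l + q g * D g ^ k"
      by (simp add: power_add algebra_simps)
  qed
next
  case (Mul e f)
  then obtain p k q l where *: "p \<in> polyfuns UNIV N" "\<forall>g \<in> carrier_mat N N. det g \<noteq> 0 \<longrightarrow> ev e g * det g ^ k = p g"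
    "q \<in> polyfuns UNIV N" "\<forall>g \<in> carrier_mat N N. det g \<noteq> 0 \<longrightarrow> ev f g * det g ^ l = q g" by auto
  show ?case
  proof (intro bexI exI ballI impI)
    show "(\<lambda>g. p g * q g) \<in> polyfuns UNIV N" by (intro polyfuns.mult *)
    fix g :: "complex mat" assume g: "g \<in> carrier_mat N N" "det g \<noteq> 0"
    hence "p g = ev e g * det g ^ k" "q g = ev f g * det g ^ l" using * by auto
    thus "ev (Mul e f) g * det g ^ (k + l) = p g * q g" by (simp add: power_add algebra_simps)
  qed
next
  case InvDet
  show ?case by (intro bexI[of _ "\<lambda>g. 1"] exI[of _ 1]) (auto intro: polyfuns.intros)
qed

section \<open>Tangent vectors of an algebraic group and the differential of a morphism\<close>

lemma alg_groupD:
  assumes "alg_group K N G"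
  shows "\<And>g. g \<in> G \<Longrightarrow> g \<in> carrier_mat N N" "\<And>g. g \<in> G \<Longrightarrow> det g \<noteq> 0" "1\<^sub>m N \<in> G"
    "\<And>g h. g \<in> G \<Longrightarrow> h \<in> G \<Longrightarrow> g * h \<in> G"
  using assms unfolding alg_group_def by auto

text \<open>A left invariant field with value in the Lie algebra is tangent to G everywhere. At the
  unit this is the definition after clearing denominators; at g it is applied to the translated
  expression, which also vanishes on G.\<close>

lemma tangent_vanishing:
  assumes G: "alg_group K N G" and X: "X \<in> lie_algebra N G" and e: "wf_rexp N e"
    and z: "\<And>g. g \<in> G \<Longrightarrow> ev e g = 0" and g: "g \<in> G"
  shows "ev (ld X e) g = 0"
proof -
  note Gd = alg_groupD[OF G]
  have Xc: "X \<in> carrier_mat N N" using X by (simp add: lie_algebra_def)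
  have at1: "ev (ld X f) (1\<^sub>m N) = 0" if f: "wf_rexp N f" "\<And>g. g \<in> G \<Longrightarrow> ev f g = 0" for f
  proof -
    obtain p k where p: "p \<in> polyfuns UNIV N"
      "\<And>g. g \<in> carrier_mat N N \<Longrightarrow> det g \<noteq> 0 \<Longrightarrow> ev f g * det g ^ k = p g" using rexp_polyfun[OF f(1)] by blast
    have "\<forall>g\<in>G. p g = 0" using p(2) f(2) Gd by (metis mult_zero_left)
    hence dp: "((\<lambda>t. p (1\<^sub>m N + t \<cdot>\<^sub>m X)) has_field_derivative 0) (at 0)"
      using X p(1) unfolding lie_algebra_def by blast
    obtain q where q: "wf_rexp N q" "\<forall>g \<in> carrier_mat N N. ev q g = p g" using polyfun_rexp[OF p(1)] by blast
    have "((\<lambda>t. p (1\<^sub>m N + t \<cdot>\<^sub>m X)) has_field_derivative ev (ld X q) (1\<^sub>m N)) (at 0)"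
      using ev_line_derivative[OF Xc q(1)] q(2) Xc by simp
    hence q0: "ev (ld X q) (1\<^sub>m N) = 0" using dp DERIV_unique by blast
    have q1: "ev q (1\<^sub>m N) = 0" using q(2) p(2)[of "1\<^sub>m N"] f(2)[OF Gd(3)] by simp
    define h where "h = Mul q (rec_nat (Cst 1) (\<lambda>_. Mul InvDet) k)"
    have wh: "wf_rexp N (rec_nat (Cst 1) (\<lambda>_. Mul InvDet) k)" by (induction k) auto
    have eh: "ev (rec_nat (Cst 1) (\<lambda>_. Mul InvDet) k) g = 1 / det g ^ k" for g
      by (induction k) (auto simp: field_simps)
    have feq: "ev f g = ev h g" if "g \<in> carrier_mat N N" "det g \<noteq> 0" for g
      using p(2)[OF that] q(2) that by (auto simp: h_def eh field_simps)
    have wfh: "wf_rexp N h" using q(1) wh by (simp add: h_def)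
    \<comment> \<open>The expressions f and h agree where the determinant is nonzero, hence near s =
      0 on the line, which suffices for equal derivatives.\<close>
    have "((\<lambda>s. ev f (1\<^sub>m N + s \<cdot>\<^sub>m X)) has_field_derivative ev (ld X h) (1\<^sub>m N)) (at 0)"
    proof (rule DERIV_cong_ev[THEN iffD1, OF refl _ refl, OF _ ev_line_derivative[OF Xc wfh]])
      have "((\<lambda>s. det (1\<^sub>m N + s \<cdot>\<^sub>m X)) has_field_derivative det (1\<^sub>m N) * tr X) (at 0)"
        by (rule det_derivative) (use line_curve[OF Xc] Xc in auto)
      hence "isCont (\<lambda>s. det (1\<^sub>m N + s \<cdot>\<^sub>m X)) 0" by (rule DERIV_isCont)
      hence "((\<lambda>s. det (1\<^sub>m N + s \<cdot>\<^sub>m X)) \<longlongrightarrow> det (1\<^sub>m N + 0 \<cdot>\<^sub>m X)) (nhds 0)"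
        unfolding isCont_def by (rule tendsto_at_iff_tendsto_nhds[THEN iffD1])
      hence "((\<lambda>s. det (1\<^sub>m N + s \<cdot>\<^sub>m X)) \<longlongrightarrow> 1) (nhds 0)"
        unfolding line_curve(2)[OF Xc] by simp
      hence "eventually (\<lambda>s. det (1\<^sub>m N + s \<cdot>\<^sub>m X) \<noteq> 0) (nhds 0)"
        by (rule tendsto_imp_eventually_ne) simp
      thus "\<forall>\<^sub>F s in nhds 0. ev h (1\<^sub>m N + s \<cdot>\<^sub>m X) = ev f (1\<^sub>m N + s \<cdot>\<^sub>m X)"
        by eventually_elim (use feq Xc in auto)
    qed
    hence "ev (ld X f) (1\<^sub>m N) = ev (ld X h) (1\<^sub>m N)" using ev_line_derivative[OF Xc f(1)] DERIV_unique by blast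
    thus ?thesis using q0 q1 by (simp add: h_def)
  qed
  have "ev (ld X (translate g e)) (1\<^sub>m N) = 0"
  proof (rule at1)
    show "wf_rexp N (translate g e)" using wf_translate Gd(1)[OF g] e by blast
    show "ev (translate g e) h = 0" if "h \<in> G" for h
      using ev_translate[OF Gd(1)[OF g] Gd(1)[OF that] e] z Gd(4)[OF g that] by simp
  qed
  thus ?thesis using ev_ld_translate[OF Gd(1)[OF g] one_carrier_mat Xc e] Gd(1)[OF g] by simp
qed

lemma curve_tangent:
  assumes G: "alg_group K N G" and \<gamma>: "\<And>s. \<gamma> s \<in> G" "\<gamma> 0 = 1\<^sub>m N" and X: "X \<in> carrier_mat N N"
    and d: "\<And>i j. i < N \<Longrightarrow> j < N \<Longrightarrow> ((\<lambda>s::complex. \<gamma> s $$ (i, j)) has_field_derivative X $$ (i, j)) (at 0)"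
  shows "X \<in> lie_algebra N G"
  unfolding lie_algebra_def
proof (intro CollectI conjI ballI impI X)
  fix p assume p: "p \<in> polyfuns UNIV N" "\<forall>g\<in>G. p g = 0"
  obtain q where q: "wf_rexp N q" "\<forall>g \<in> carrier_mat N N. ev q g = p g" using polyfun_rexp[OF p(1)] by blast
  have "((\<lambda>s. ev q (\<gamma> s)) has_field_derivative ev (ld X q) (1\<^sub>m N)) (at 0)"
    by (rule ev_derivative[of _ N]) (use alg_groupD[OF G] \<gamma> X d q in auto)
  moreover have "ev q (\<gamma> s) = 0" for s using p q \<gamma> alg_groupD[OF G] by metis
  ultimately have "((\<lambda>s::complex. 0) has_field_derivative ev (ld X q) (1\<^sub>m N)) (at 0)" by simp
  hence "ev (ld X q) (1\<^sub>m N) = 0" using DERIV_const DERIV_unique by blast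
  thus "((\<lambda>t. p (1\<^sub>m N + t \<cdot>\<^sub>m X)) has_field_derivative 0) (at 0)"
    using ev_line_derivative[OF X q(1)] q(2) X by simp
qed

locale regular_hom =
  fixes K :: "complex set" and N d :: nat and G H :: "complex mat set" and \<pi> :: "complex mat \<Rightarrow> complex mat"
  assumes G: "alg_group K N G" and hom: "alg_hom K N G d H \<pi>" and H: "H \<subseteq> carrier_mat d d"
begin

lemma \<pi>_carrier: "g \<in> G \<Longrightarrow> \<pi> g \<in> carrier_mat d d"
  using hom H unfolding alg_hom_def by blast

lemma polyfun_quotient_rexp:
  assumes "p \<in> polyfuns UNIV N"
  shows "\<exists>e. wf_rexp N e \<and> (\<forall>g \<in> carrier_mat N N. ev e g = p g / det g ^ k)"
proof -
  obtain q where q: "wf_rexp N q" "\<forall>g \<in> carrier_mat N N. ev q g = p g" using polyfun_rexp[OF assms] by blast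
  have "wf_rexp N (rec_nat (Cst 1) (\<lambda>_. Mul InvDet) k)" by (induction k) auto
  moreover have "ev (rec_nat (Cst 1) (\<lambda>_. Mul InvDet) k) g = 1 / det g ^ k" for g
    by (induction k) (auto simp: field_simps)
  ultimately show ?thesis using q by (intro exI[of _ "Mul q (rec_nat (Cst 1) (\<lambda>_. Mul InvDet) k)"]) auto
qed

text \<open>The last conjunct supplies one admissible quotient p / det^k, needed for uniqueness in
  the description that defines \<open>differential\<close>.\<close>

definition coord :: "nat \<Rightarrow> nat \<Rightarrow> rexp" where
  "coord i j = (SOME e. wf_rexp N e \<and> (\<forall>g\<in>G. ev e g = \<pi> g $$ (i, j)) \<and>
     (\<exists>p \<in> polyfuns UNIV N. \<exists>k. \<forall>g \<in> carrier_mat N N. ev e g = p g / det g ^ k))"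

lemma coord:
  assumes "i < d" "j < d"
  shows "wf_rexp N (coord i j)" "g \<in> G \<Longrightarrow> ev (coord i j) g = \<pi> g $$ (i, j)"
    "\<exists>p \<in> polyfuns UNIV N. \<exists>k. \<forall>g \<in> carrier_mat N N. ev (coord i j) g = p g / det g ^ k"
proof -
  obtain p k where p: "p \<in> polyfuns UNIV N" "\<forall>g\<in>G. \<pi> g $$ (i, j) = p g / det g ^ k"
    using hom assms polyfuns_mono unfolding alg_hom_def regular_on_def by metis
  obtain e where e: "wf_rexp N e" "\<forall>g \<in> carrier_mat N N. ev e g = p g / det g ^ k"
    using polyfun_quotient_rexp[OF p(1)] by blast
  have "wf_rexp N e \<and> (\<forall>g\<in>G. ev e g = \<pi> g $$ (i, j)) \<and>
     (\<exists>p \<in> polyfuns UNIV N. \<exists>k. \<forall>g \<in> carrier_mat N N. ev e g = p g / det g ^ k)"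
    using e p alg_groupD(1)[OF G] by auto
  from someI[of "\<lambda>e. wf_rexp N e \<and> (\<forall>g\<in>G. ev e g = \<pi> g $$ (i, j)) \<and>
     (\<exists>p \<in> polyfuns UNIV N. \<exists>k. \<forall>g \<in> carrier_mat N N. ev e g = p g / det g ^ k)", OF this]
  show "wf_rexp N (coord i j)" "g \<in> G \<Longrightarrow> ev (coord i j) g = \<pi> g $$ (i, j)"
    "\<exists>p \<in> polyfuns UNIV N. \<exists>k. \<forall>g \<in> carrier_mat N N. ev (coord i j) g = p g / det g ^ k"
    unfolding coord_def by auto
qed

abbreviation D :: "complex mat \<Rightarrow> complex mat" where "D \<equiv> differential N G d \<pi>"

lemma D_carrier: "D X \<in> carrier_mat d d"
  by (simp add: differential_def)

text \<open>Two regular expressions for the same entry agree on G, so their difference has zero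
  derivative in every tangent direction. This makes the definite description in
  \<open>differential\<close> well defined.\<close>

lemma D_entry:
  assumes X: "X \<in> lie_algebra N G" and ij: "i < d" "j < d"
  shows "D X $$ (i, j) = ev (ld X (coord i j)) (1\<^sub>m N)"
proof -
  have Xc: "X \<in> carrier_mat N N" using X by (simp add: lie_algebra_def)
  let ?v = "ev (ld X (coord i j)) (1\<^sub>m N)"
  have all: "((\<lambda>t. p (1\<^sub>m N + t \<cdot>\<^sub>m X) / det (1\<^sub>m N + t \<cdot>\<^sub>m X) ^ k) has_field_derivative ?v) (at 0)"
    if p: "p \<in> polyfuns UNIV N" "\<forall>g\<in>G. \<pi> g $$ (i, j) = p g / det g ^ k" for p k
  proof -
    obtain e where e: "wf_rexp N e" "\<forall>g \<in> carrier_mat N N. ev e g = p g / det g ^ k"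
      using polyfun_quotient_rexp[OF p(1)] by blast
    let ?f = "Add e (Mul (Cst (-1)) (coord i j))"
    have "ev (ld X ?f) (1\<^sub>m N) = 0"
      by (rule tangent_vanishing[OF G X]) (use e coord[OF ij] p alg_groupD[OF G] in auto)
    hence "ev (ld X e) (1\<^sub>m N) = ?v" by simp
    thus ?thesis using ev_line_derivative[OF Xc e(1)] e(2) Xc by simp
  qed
  obtain p k where pk: "p \<in> polyfuns UNIV N" "\<forall>g \<in> carrier_mat N N. ev (coord i j) g = p g / det g ^ k"
    using coord(3)[OF ij] by blast
  hence pk': "\<forall>g\<in>G. \<pi> g $$ (i, j) = p g / det g ^ k" using coord(2)[OF ij] alg_groupD(1)[OF G] by metis
  have "(THE v. \<forall>p \<in> polyfuns UNIV N. \<forall>k::nat. (\<forall>g\<in>G. \<pi> g $$ (i, j) = p g / det g ^ k) \<longrightarrow>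
      ((\<lambda>t::complex. p (1\<^sub>m N + t \<cdot>\<^sub>m X) / det (1\<^sub>m N + t \<cdot>\<^sub>m X) ^ k) has_field_derivative v) (at 0)) = ?v"
  proof (rule the_equality)
    fix v assume "\<forall>p \<in> polyfuns UNIV N. \<forall>k::nat. (\<forall>g\<in>G. \<pi> g $$ (i, j) = p g / det g ^ k) \<longrightarrow>
      ((\<lambda>t::complex. p (1\<^sub>m N + t \<cdot>\<^sub>m X) / det (1\<^sub>m N + t \<cdot>\<^sub>m X) ^ k) has_field_derivative v) (at 0)"
    hence "((\<lambda>t::complex. p (1\<^sub>m N + t \<cdot>\<^sub>m X) / det (1\<^sub>m N + t \<cdot>\<^sub>m X) ^ k) has_field_derivative v) (at 0)"
      using pk(1) pk' by blast
    thus "v = ?v" using all[OF pk(1) pk'] DERIV_unique by blast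
  qed (use all in blast)
  thus ?thesis using ij by (simp add: differential_def)
qed

text \<open>Closure of the Lie algebra under linear combinations is a hypothesis here, and closure
  under brackets in \<open>D_bracket\<close>; in the application both come from the isomorphism with
  type E.\<close>

lemma D_linear:
  assumes X: "X \<in> lie_algebra N G" "Y \<in> lie_algebra N G" "a \<cdot>\<^sub>m X + b \<cdot>\<^sub>m Y \<in> lie_algebra N G"
  shows "D (a \<cdot>\<^sub>m X + b \<cdot>\<^sub>m Y) = a \<cdot>\<^sub>m D X + b \<cdot>\<^sub>m D Y"
proof (rule eq_matI)
  fix i j assume "i < dim_row (a \<cdot>\<^sub>m D X + b \<cdot>\<^sub>m D Y)" "j < dim_col (a \<cdot>\<^sub>m D X + b \<cdot>\<^sub>m D Y)"
  hence ij: "i < d" "j < d" using carrier_matD[OF D_carrier] by auto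
  have c: "X \<in> carrier_mat N N" "Y \<in> carrier_mat N N" using X by (auto simp: lie_algebra_def)
  show "D (a \<cdot>\<^sub>m X + b \<cdot>\<^sub>m Y) $$ (i, j) = (a \<cdot>\<^sub>m D X + b \<cdot>\<^sub>m D Y) $$ (i, j)"
    using D_entry[OF X(1) ij] D_entry[OF X(2) ij] D_entry[OF X(3) ij] ij
      ev_ld_linear[OF c one_carrier_mat coord(1)[OF ij]] carrier_matD[OF D_carrier[of X]] carrier_matD[OF D_carrier[of Y]]
    by simp
qed (use carrier_matD[OF D_carrier] in auto)

text \<open>Differentiate \<pi>(g h) = \<pi>(g) \<pi>(h) with respect to h at the unit: along X the
  matrix \<pi> has derivative \<pi> times \<open>D X\<close>.\<close>

lemma ev_ld_coord:
  assumes X: "X \<in> lie_algebra N G" and ij: "i < d" "j < d" and g: "g \<in> G"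
  shows "ev (ld X (coord i j)) g = (\<Sum>l<d. \<pi> g $$ (i, l) * D X $$ (l, j))"
proof -
  note Gd = alg_groupD[OF G]
  have Xc: "X \<in> carrier_mat N N" using X by (simp add: lie_algebra_def)
  let ?f = "Add (translate g (coord i j)) (Mul (Cst (-1)) (rsum (\<lambda>l. Mul (Cst (\<pi> g $$ (i, l))) (coord l j)) d))"
  have "ev (ld X ?f) (1\<^sub>m N) = 0"
  proof (rule tangent_vanishing[OF G X])
    show "wf_rexp N ?f"
      using coord(1) ij wf_translate[OF Gd(1)[OF g] coord(1)[OF ij]] by (auto intro!: wf_rsum)
    fix h assume h: "h \<in> G"
    have "ev (translate g (coord i j)) h = \<pi> (g * h) $$ (i, j)"
      using ev_translate[OF Gd(1)[OF g] Gd(1)[OF h] coord(1)[OF ij]] coord(2)[OF ij Gd(4)[OF g h]] by simp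
    also have "\<pi> (g * h) = \<pi> g * \<pi> h" using hom g h unfolding alg_hom_def by blast
    also have "(\<pi> g * \<pi> h) $$ (i, j) = (\<Sum>l<d. \<pi> g $$ (i, l) * \<pi> h $$ (l, j))"
      using \<pi>_carrier[OF g] \<pi>_carrier[OF h] ij by (simp add: scalar_prod_def atLeast0LessThan)
    finally show "ev ?f h = 0" using coord(2)[OF _ ij(2) h] by (simp add: ev_rsum)
  qed (rule Gd(3))
  moreover have "ev (ld X (translate g (coord i j))) (1\<^sub>m N) = ev (ld X (coord i j)) g"
    using ev_ld_translate[OF Gd(1)[OF g] one_carrier_mat Xc coord(1)[OF ij]] Gd(1)[OF g] by simp
  ultimately show ?thesis using D_entry[OF X _ ij(2)] by (simp add: ld_rsum ev_rsum)
qed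

text \<open>On G the field of X sends \<pi> to \<pi> times \<open>D X\<close>. Applying Y at the
  unit, which is allowed because Y is tangent to G, gives \<open>D Y * D X\<close>; antisymmetrising
  and the commutator rule for derivations finish.\<close>

lemma D_bracket:
  assumes X: "X \<in> lie_algebra N G" "Y \<in> lie_algebra N G" "Y * X - X * Y \<in> lie_algebra N G"
  shows "D (Y * X - X * Y) = D Y * D X - D X * D Y"
proof (rule eq_matI)
  fix i j assume "i < dim_row (D Y * D X - D X * D Y)" "j < dim_col (D Y * D X - D X * D Y)"
  hence ij: "i < d" "j < d" using carrier_matD[OF D_carrier] by auto
  have c: "X \<in> carrier_mat N N" "Y \<in> carrier_mat N N" using X by (auto simp: lie_algebra_def)
  have second: "ev (ld Y (ld X (coord i j))) (1\<^sub>m N) = (D Y * D X) $$ (i, j)"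
    if X: "X \<in> lie_algebra N G" "Y \<in> lie_algebra N G" for X Y
  proof -
    have c: "X \<in> carrier_mat N N" "Y \<in> carrier_mat N N" using X by (auto simp: lie_algebra_def)
    let ?f = "Add (ld X (coord i j)) (Mul (Cst (-1)) (rsum (\<lambda>l. Mul (coord i l) (Cst (D X $$ (l, j)))) d))"
    have "ev (ld Y ?f) (1\<^sub>m N) = 0"
    proof (rule tangent_vanishing[OF G X(2)])
      show "wf_rexp N ?f" using coord(1) ij c by (auto intro!: wf_rsum wf_ld)
      fix g assume g: "g \<in> G"
      show "ev ?f g = 0" using ev_ld_coord[OF X(1) ij g] coord(2)[OF ij(1) _ g] by (simp add: ev_rsum)
    qed (rule alg_groupD(3)[OF G])
    thus ?thesis using D_entry[OF X(2) ij(1)] ij carrier_matD[OF D_carrier[of X]] carrier_matD[OF D_carrier[of Y]]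
      by (simp add: ld_rsum ev_rsum scalar_prod_def atLeast0LessThan)
  qed
  have "D (Y * X - X * Y) $$ (i, j) = (D Y * D X) $$ (i, j) - (D X * D Y) $$ (i, j)"
    using D_entry[OF X(3) ij] ev_ld_commutator[OF c one_carrier_mat coord(1)[OF ij]]
      second[OF X(1,2)] second[OF X(2,1)] by simp
  thus "D (Y * X - X * Y) $$ (i, j) = (D Y * D X - D X * D Y) $$ (i, j)"
    using ij carrier_matD[OF D_carrier[of X]] carrier_matD[OF D_carrier[of Y]] by simp
qed (use carrier_matD[OF D_carrier] in auto)

lemma D_curve:
  assumes \<gamma>: "\<And>s. \<gamma> s \<in> G" "\<gamma> 0 = 1\<^sub>m N" and X: "X \<in> lie_algebra N G"
    and d: "\<And>i j. i < N \<Longrightarrow> j < N \<Longrightarrow> ((\<lambda>s::complex. \<gamma> s $$ (i, j)) has_field_derivative X $$ (i, j)) (at 0)"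
    and ij: "i < d" "j < d"
  shows "((\<lambda>s. \<pi> (\<gamma> s) $$ (i, j)) has_field_derivative D X $$ (i, j)) (at 0)"
proof -
  have Xc: "X \<in> carrier_mat N N" using X by (simp add: lie_algebra_def)
  have "((\<lambda>s. ev (coord i j) (\<gamma> s)) has_field_derivative ev (ld X (coord i j)) (1\<^sub>m N)) (at 0)"
    by (rule ev_derivative[of _ N]) (use alg_groupD[OF G] \<gamma> Xc d coord[OF ij] in auto)
  thus ?thesis using coord(2)[OF ij \<gamma>(1)] D_entry[OF X ij] by simp
qed

end

section \<open>Representations of the circle\<close>

text \<open>The complex points of the circle group are parametrised by \<open>u = a + \<i> b\<close> in \<open>\<complex>\<^sup>*\<close>.\<close>

definition cpt :: "complex \<Rightarrow> complex mat" where
  "cpt u = mat 2 2 (\<lambda>(i, j). if i = j then (u + 1 / u) / 2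
     else if i < j then - (u - 1 / u) / (2 * \<i>) else (u - 1 / u) / (2 * \<i>))"

lemma cpt_carrier [simp]: "cpt u \<in> carrier_mat 2 2"
  by (simp add: cpt_def)

lemma cpt_unit:
  assumes "cmod z = 1"
  shows "circle_pt z = cpt z"
proof -
  have "z * cnj z = 1" using complex_norm_square[of z] assms by simp
  moreover have "z \<noteq> 0" using assms by auto
  ultimately have iz: "1 / z = cnj z" by (metis nonzero_mult_div_cancel_left)
  have e: "of_real (Re z) = (z + 1 / z) / 2" "of_real (Im z) = (z - 1 / z) / (2 * \<i>)"
    unfolding iz complex_add_cnj complex_diff_cnj by (simp_all add: complex_eq_iff)
  show ?thesis unfolding cpt_def e[symmetric] minus_divide_left[symmetric]
    by (intro eq_matI) (auto simp: circle_pt_def mat_of_rows_list_def less_2_cases_iff)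
qed

lemma cpt_mult:
  assumes "u \<noteq> 0" "v \<noteq> 0"
  shows "cpt u * cpt v = cpt (u * v)"
  using assms
  by (intro eq_matI) (auto simp: cpt_def scalar_prod_def less_2_cases_iff numeral_2_eq_2 field_simps)

lemma det_2: "A \<in> carrier_mat 2 2 \<Longrightarrow> det A = A $$ (0, 0) * A $$ (1, 1) - A $$ (0, 1) * A $$ (1, 0)"
  by (subst laplace_expansion_row[of A 2 0])
    (auto simp: numeral_2_eq_2 cofactor_def mat_delete_def det_single)

lemma cpt_circle:
  assumes "u \<noteq> 0"
  shows "cpt u \<in> circle_group"
proof -
  have "cpt u * transpose_mat (cpt u) = 1\<^sub>m 2" using assms
    by (intro eq_matI) (auto simp: cpt_def scalar_prod_def less_2_cases_iff numeral_2_eq_2 field_simps power2_eq_square)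
  moreover have "det (cpt u) = 1"
    unfolding det_2[OF cpt_carrier] using assms by (simp add: cpt_def field_simps)
  ultimately show ?thesis by (simp add: circle_group_def)
qed

lemma circle_cpt:
  assumes "g \<in> circle_group"
  shows "\<exists>u. u \<noteq> 0 \<and> g = cpt u"
proof -
  have c: "g \<in> carrier_mat 2 2" and o: "g * transpose_mat g = 1\<^sub>m 2" and d: "det g = 1"
    using assms by (auto simp: circle_group_def)
  define p q r s where "p = g $$ (0, 0)" and "q = g $$ (0, 1)" and "r = g $$ (1, 0)" and "s = g $$ (1, 1)"
  have e: "(g * transpose_mat g) $$ (i, j) = g $$ (i, 0) * g $$ (j, 0) + g $$ (i, 1) * g $$ (j, 1)"
    if "i < 2" "j < 2" for i j
    using that c by (simp add: scalar_prod_def numeral_2_eq_2)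
  have 1: "p * p + q * q = 1" "p * r + q * s = 0"
    using e[of 0 0] e[of 0 1] unfolding o p_def q_def r_def s_def by simp_all
  have 2: "p * s - q * r = 1" using d det_2[OF c] by (simp add: p_def q_def r_def s_def)
  have s: "s = p"
  proof -
    have "s = s * (p * p + q * q)" using 1 by simp
    also have "\<dots> = p * (p * s - q * r) + q * (p * r + q * s)" by (simp add: algebra_simps)
    finally show ?thesis using 1 2 by simp
  qed
  have r: "r = - q"
  proof -
    have "r = r * (p * p + q * q)" using 1 by simp
    also have "\<dots> = p * (p * r + q * s) - q * (p * s - q * r)" by (simp add: algebra_simps)
    finally show ?thesis using 1 2 by simp
  qed
  \<comment> \<open>The parameter a + \<i> b is read off from the first column; its inverse is a -
    \<i> b because a^2 + b^2 = 1.\<close>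
  define u where "u = p + \<i> * r"
  have uu: "u * (p - \<i> * r) = 1" using 1 r by (simp add: u_def algebra_simps)
  hence u0: "u \<noteq> 0" by auto
  hence iu: "1 / u = p - \<i> * r" using uu by (simp add: field_simps)
  have "g = cpt u"
    using c s r
    by (intro eq_matI) (auto simp: cpt_def less_2_cases_iff iu, auto simp: u_def p_def q_def r_def s_def)
  thus ?thesis using u0 by blast
qed

section \<open>Laurent expansions of circle homomorphisms\<close>

lemma polyfun_laurent:
  "p \<in> polyfuns K 2 \<Longrightarrow> \<exists>P k. \<forall>u. u \<noteq> 0 \<longrightarrow> p (cpt u) * u ^ k = poly P u"
proof (induction rule: polyfuns.induct)
  case (const c)
  show ?case by (rule exI[of _ "[:c:]"], rule exI[of _ 0]) simp
next
  case (coord i j)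
  define a where "a = (if i = j then 1 / 2 else if i < j then - 1 / (2 * \<i>) else 1 / (2 * \<i>))"
  define b where "b = (if i = j then 1 / 2 else if i < j then 1 / (2 * \<i>) else - 1 / (2 * \<i>))"
  have "cpt u $$ (i, j) * u ^ 1 = poly [:b, 0, a:] u" if "u \<noteq> 0" for u
    using coord that by (auto simp: cpt_def a_def b_def field_simps)
  thus ?case by blast
next
  case (add p q)
  then obtain P k Q l where *: "\<And>u. u \<noteq> 0 \<Longrightarrow> p (cpt u) * u ^ k = poly P u"
    "\<And>u. u \<noteq> 0 \<Longrightarrow> q (cpt u) * u ^ l = poly Q u" by blast
  have "(p (cpt u) + q (cpt u)) * u ^ (k + l) = poly (P * monom 1 l + Q * monom 1 k) u" if "u \<noteq> 0" for u
    using *(1)[OF that, symmetric] *(2)[OF that, symmetric] by (simp add: poly_monom power_add algebra_simps)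
  thus ?case by blast
next
  case (mult p q)
  then obtain P k Q l where *: "\<And>u. u \<noteq> 0 \<Longrightarrow> p (cpt u) * u ^ k = poly P u"
    "\<And>u. u \<noteq> 0 \<Longrightarrow> q (cpt u) * u ^ l = poly Q u" by blast
  have "(p (cpt u) * q (cpt u)) * u ^ (k + l) = poly (P * Q) u" if "u \<noteq> 0" for u
    using *(1)[OF that, symmetric] *(2)[OF that, symmetric] by (simp add: power_add algebra_simps)
  thus ?case by blast
qed

lemma circle_hom_laurent:
  assumes "alg_hom K 2 circle_group m H f" "i < m" "j < m"
  shows "\<exists>P k. \<forall>u. u \<noteq> 0 \<longrightarrow> f (cpt u) $$ (i, j) * u ^ k = poly P u"
proof -
  obtain p k where p: "p \<in> polyfuns K 2" "\<forall>g\<in>circle_group. f g $$ (i, j) = p g / det g ^ k"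
    using assms unfolding alg_hom_def regular_on_def by blast
  have "f (cpt u) $$ (i, j) = p (cpt u)" if "u \<noteq> 0" for u
    using p(2) cpt_circle[OF that] by (auto simp: circle_group_def)
  thus ?thesis using polyfun_laurent[OF p(1)] by metis
qed

lemma nonzero_poly_identity:
  assumes "\<And>u. u \<noteq> 0 \<Longrightarrow> (\<Sum>l<M. a l * u ^ l) = (\<Sum>l<M. b l * (u::complex) ^ l)" "l < M"
  shows "a l = b l"
proof -
  define P where "P = (\<Sum>l<M. monom (a l - b l) l)"
  have "poly P u = 0" if "u \<noteq> 0" for u
    using assms(1)[OF that] by (simp add: P_def poly_sum poly_monom left_diff_distrib sum_subtractf)
  hence "- {0} \<subseteq> {u. poly P u = 0}" by auto
  moreover have "infinite (- {0 :: complex})" by (simp add: finite_compl infinite_UNIV_char_0)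
  ultimately have "P = 0" using poly_roots_finite finite_subset by blast
  hence "coeff P l = 0" by simp
  thus ?thesis using assms(2) by (simp add: P_def coeff_sum)
qed

lemma polyfun_real:
  assumes "p \<in> polyfuns \<real> n" "\<And>i j. i < n \<Longrightarrow> j < n \<Longrightarrow> g $$ (i, j) \<in> \<real>"
  shows "p g \<in> \<real>"
  using assms by (induction rule: polyfuns.induct) auto

text \<open>The dimension is a least cardinality of a finite spanning set, so such a set must exist
  before anything can be concluded. Presenting W as the image of a matrix makes it a column space
  and provides one. The spanning vector is nonzero, as otherwise the empty set would span.\<close>

lemma dim_one_line:
  fixes d :: nat and W :: "complex vec set" and A :: "complex mat"
  assumes A: "A \<in> carrier_mat d d" and W: "W = {A *\<^sub>v x | x. x \<in> carrier_vec d}"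
    and dim: "vectorspace.dim class_ring (module_vec TYPE(complex) d\<lparr>carrier := W\<rparr>) = 1"
  shows "\<exists>v\<in>W. v \<noteq> 0\<^sub>v d \<and> (\<forall>w\<in>W. \<exists>a. w = a \<cdot>\<^sub>v v)"
proof -
  interpret vec_space "TYPE(complex)" d .
  have cols: "set (cols A) \<subseteq> carrier_vec d" using A cols_dim by blast
  have Wspan: "W = span (set (cols A))"
    using W A col_space_eq[OF A] by (auto simp: col_space_def)
  have sub: "VectorSpace.subspace class_ring W V" unfolding Wspan using cols by (intro span_is_subspace) simp
  hence vs: "vectorspace class_ring (vs W)" by (rule subspace_is_vs)
  have Wc: "W \<subseteq> carrier_vec d" using W A by auto
  let ?P = "\<lambda>n. \<exists>B. finite B \<and> card B = n \<and> B \<subseteq> W \<and> span B = W"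
  have spn: "LinearCombinations.module.span class_ring (vs W) B = span B" if "B \<subseteq> W" for B
    using span_li_not_depend(1)[OF that, of] sub by simp
  have dimW: "vectorspace.dim class_ring (vs W) = (LEAST n. ?P n)"
    unfolding vectorspace.dim_def[OF vs] using spn by (intro arg_cong[of _ _ Least] ext) auto
  have "\<exists>n. ?P n"
    using fin_dim_span_cols[OF A] vs unfolding Wspan[symmetric] vectorspace.fin_dim_def[OF vs]
    using spn by auto
  hence "?P (LEAST n. ?P n)" by (rule LeastI_ex)
  hence "?P 1" using dim dimW by simp
  then obtain v where v: "v \<in> W" "span {v} = W" by (auto simp: card_1_singleton_iff)
  have vc: "v \<in> carrier_vec d" using v Wc by auto
  have "\<exists>a. w = a \<cdot>\<^sub>v v" if "w \<in> W" for w
  proof -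
    have "w \<in> span {v}" using that v by simp
    then obtain a where "w = lincomb a {v}" using finite_in_span[of "{v}" w] vc by auto
    thus ?thesis using vc by (auto simp: lincomb_def)
  qed
  moreover have "v \<noteq> 0\<^sub>v d"
  proof
    assume v0: "v = 0\<^sub>v d"
    have "w = 0\<^sub>v d" if w: "w \<in> W" for w
    proof -
      obtain a where "w = a \<cdot>\<^sub>v 0\<^sub>v d" using calculation[OF w] v0 by blast
      thus ?thesis by (intro eq_vecI) auto
    qed
    hence "W = {0\<^sub>v d}" using v(1) v0 by blast
    hence "finite {} \<and> card {} = 0 \<and> {} \<subseteq> W \<and> span {} = W" using span_empty by simp
    hence "?P 0" by blast
    hence "(LEAST n. ?P n) = 0" by (intro Least_equality) auto
    thus False using dim dimW by simp
  qed
  ultimately show ?thesis using v(1) by blast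
qed

text \<open>The starting value x stays independent of the length m, so that induction on m applies;
  the spectrum of the representation is the case x = m.\<close>

lemma sum_squares_progression:
  "(\<Sum>j\<le>m. (x - 2 * real j)\<^sup>2) = (real m + 1) * (x\<^sup>2 - 2 * x * m + 2 * m * (2 * m + 1) / 3)"
  by (induction m) (simp_all add: field_simps power2_eq_square)

lemma sum_fourth_powers_progression:
  "(\<Sum>j\<le>m. (x - 2 * real j) ^ 4) = (real m + 1) * (x ^ 4 - 4 * x ^ 3 * m + 4 * x\<^sup>2 * m * (2 * m + 1)
     - 8 * x * m\<^sup>2 * (m + 1) + 8 * m * (2 * m + 1) * (3 * m\<^sup>2 + 3 * m - 1) / 15)"
  by (induction m) (simp_all add: field_simps power2_eq_square power3_eq_cube power4_eq_xxxx)

text \<open>\<open>alg_hom\<close> asks for multiplicativity only; this yields that the unit of the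
  circle acts as the identity.\<close>

lemma idempotent_invertible_is_one:
  assumes "A \<in> carrier_mat d d" "det A \<noteq> (0 :: complex)" "A * A = A"
  shows "A = 1\<^sub>m d"
proof -
  obtain h where h: "h \<in> carrier_mat d d" "h * A = 1\<^sub>m d" using mat_inverse_exists[OF assms(1,2)] by blast
  have "A = h * A * A" unfolding h(2) using assms by simp
  also have "\<dots> = h * A" using assoc_mult_mat[OF h(1) assms(1,1)] assms(3) by simp
  finally show ?thesis using h(2) by simp
qed

text \<open>The matrix \<open>A l\<close> is the coefficient of \<open>u\<^bsup>l-K\<^esup>\<close> in \<open>R u\<close>, that is, the projection to the
  subspace of weight \<open>l - K\<close>.\<close>

locale laurent_rep =
  fixes d :: nat and R :: "complex \<Rightarrow> complex mat" and K M :: nat and A :: "nat \<Rightarrow> complex mat"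
  assumes Rc: "u \<noteq> 0 \<Longrightarrow> R u \<in> carrier_mat d d"
    and Rmult: "u \<noteq> 0 \<Longrightarrow> v \<noteq> 0 \<Longrightarrow> R u * R v = R (u * v)"
    and Rone: "R 1 = 1\<^sub>m d"
    and Ac: "A l \<in> carrier_mat d d"
    and expansion: "u \<noteq> 0 \<Longrightarrow> i < d \<Longrightarrow> j < d \<Longrightarrow> R u $$ (i, j) * u ^ K = (\<Sum>l<M. A l $$ (i, j) * u ^ l)"
begin

lemma mult_entry:
  assumes "X \<in> carrier_mat d d" "Y \<in> carrier_mat d d" "i < d" "j < d"
  shows "(X * Y) $$ (i, j) = (\<Sum>m<d. X $$ (i, m) * Y $$ (m, j))"
  using assms by (simp add: scalar_prod_def atLeast0LessThan)

text \<open>Fix v and compare coefficients of powers of u in R(u) R(v) = R(u v).\<close>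

lemma AR:
  assumes "l < M" "v \<noteq> 0" "i < d" "j < d"
  shows "(A l * R v) $$ (i, j) * v ^ K = v ^ l * A l $$ (i, j)"
proof (rule nonzero_poly_identity[where a = "\<lambda>l. (A l * R v) $$ (i, j) * v ^ K" and b = "\<lambda>l. v ^ l * A l $$ (i, j)" and M = M])
  fix u :: complex assume u: "u \<noteq> 0"
  have "(\<Sum>l<M. (A l * R v) $$ (i, j) * v ^ K * u ^ l)
      = (\<Sum>l<M. \<Sum>m<d. A l $$ (i, m) * u ^ l * (R v $$ (m, j) * v ^ K))"
    unfolding mult_entry[OF Ac Rc[OF assms(2)] assms(3,4)] by (simp add: sum_distrib_left mult_ac)
  also have "\<dots> = (\<Sum>m<d. (\<Sum>l<M. A l $$ (i, m) * u ^ l) * (R v $$ (m, j) * v ^ K))"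
    by (subst sum.swap) (simp add: sum_distrib_right)
  also have "\<dots> = (\<Sum>m<d. R u $$ (i, m) * u ^ K * (R v $$ (m, j) * v ^ K))"
    using expansion[OF u assms(3)] by (intro sum.cong) auto
  also have "\<dots> = (R u * R v) $$ (i, j) * (u * v) ^ K"
    unfolding mult_entry[OF Rc[OF u] Rc[OF assms(2)] assms(3,4)]
    by (simp add: sum_distrib_left power_mult_distrib mult_ac)
  also have "\<dots> = (\<Sum>l<M. A l $$ (i, j) * (u * v) ^ l)"
    unfolding Rmult[OF u assms(2)] using expansion u assms by simp
  finally show "(\<Sum>l<M. (A l * R v) $$ (i, j) * v ^ K * u ^ l) = (\<Sum>l<M. v ^ l * A l $$ (i, j) * u ^ l)"
    by (simp add: power_mult_distrib mult_ac)
qed (rule assms)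

lemma RA:
  assumes "l < M" "v \<noteq> 0" "i < d" "j < d"
  shows "(R v * A l) $$ (i, j) * v ^ K = v ^ l * A l $$ (i, j)"
proof (rule nonzero_poly_identity[where a = "\<lambda>l. (R v * A l) $$ (i, j) * v ^ K" and b = "\<lambda>l. v ^ l * A l $$ (i, j)" and M = M])
  fix u :: complex assume u: "u \<noteq> 0"
  have "(\<Sum>l<M. (R v * A l) $$ (i, j) * v ^ K * u ^ l)
      = (\<Sum>l<M. \<Sum>m<d. R v $$ (i, m) * v ^ K * (A l $$ (m, j) * u ^ l))"
    unfolding mult_entry[OF Rc[OF assms(2)] Ac assms(3,4)] by (simp add: sum_distrib_left mult_ac)
  also have "\<dots> = (\<Sum>m<d. R v $$ (i, m) * v ^ K * (\<Sum>l<M. A l $$ (m, j) * u ^ l))"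
    by (subst sum.swap) (simp add: sum_distrib_left)
  also have "\<dots> = (\<Sum>m<d. R v $$ (i, m) * v ^ K * (R u $$ (m, j) * u ^ K))"
    using expansion[OF u _ assms(4)] by (intro sum.cong) auto
  also have "\<dots> = (R v * R u) $$ (i, j) * (v * u) ^ K"
    unfolding mult_entry[OF Rc[OF assms(2)] Rc[OF u] assms(3,4)]
    by (simp add: sum_distrib_left power_mult_distrib mult_ac)
  also have "\<dots> = (\<Sum>l<M. A l $$ (i, j) * (v * u) ^ l)"
    unfolding Rmult[OF assms(2) u] using expansion u assms by simp
  finally show "(\<Sum>l<M. (R v * A l) $$ (i, j) * v ^ K * u ^ l) = (\<Sum>l<M. v ^ l * A l $$ (i, j) * u ^ l)"
    by (simp add: power_mult_distrib mult_ac)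
qed (rule assms)

text \<open>Comparing coefficients once more, now in v, shows that the matrices \<open>A l\<close>
  are orthogonal idempotents.\<close>

lemma AA:
  assumes "l < M" "k < M" "i < d" "j < d"
  shows "(A l * A k) $$ (i, j) = (if k = l then A l $$ (i, j) else 0)"
proof (rule nonzero_poly_identity[where a = "\<lambda>k. (A l * A k) $$ (i, j)" and b = "\<lambda>k. if k = l then A l $$ (i, j) else 0" and M = M])
  fix v :: complex assume v: "v \<noteq> 0"
  have "(\<Sum>k<M. (A l * A k) $$ (i, j) * v ^ k) = (\<Sum>k<M. \<Sum>m<d. A l $$ (i, m) * (A k $$ (m, j) * v ^ k))"
    unfolding mult_entry[OF Ac Ac assms(3,4)] by (simp add: sum_distrib_left mult_ac)
  also have "\<dots> = (\<Sum>m<d. A l $$ (i, m) * (\<Sum>k<M. A k $$ (m, j) * v ^ k))"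
    by (subst sum.swap) (simp add: sum_distrib_left)
  also have "\<dots> = (\<Sum>m<d. A l $$ (i, m) * (R v $$ (m, j) * v ^ K))"
    using expansion[OF v _ assms(4)] by (intro sum.cong) auto
  also have "\<dots> = (A l * R v) $$ (i, j) * v ^ K"
    unfolding mult_entry[OF Ac Rc[OF v] assms(3,4)] by (simp add: sum_distrib_left mult_ac)
  also have "\<dots> = v ^ l * A l $$ (i, j)" by (rule AR[OF assms(1) v assms(3,4)])
  also have "\<dots> = (\<Sum>k<M. if k = l then A l $$ (i, j) * v ^ k else 0)" using assms(1) by simp
  also have "\<dots> = (\<Sum>k<M. (if k = l then A l $$ (i, j) else 0) * v ^ k)" by (intro sum.cong) auto
  finally show "(\<Sum>k<M. (A l * A k) $$ (i, j) * v ^ k) = (\<Sum>k<M. (if k = l then A l $$ (i, j) else 0) * v ^ k)" .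
qed (rule assms)

lemma sum_A: "i < d \<Longrightarrow> j < d \<Longrightarrow> (\<Sum>l<M. A l $$ (i, j)) = 1\<^sub>m d $$ (i, j)"
  using expansion[of 1 i j] Rone by simp

text \<open>The endomorphism acting on the weight space of index \<open>l\<close> by the scalar \<open>f l\<close>.\<close>

definition L :: "(nat \<Rightarrow> complex) \<Rightarrow> complex mat" where
  "L f = mat d d (\<lambda>(i, j). \<Sum>l<M. f l * A l $$ (i, j))"

lemma L_carrier: "L f \<in> carrier_mat d d"
  by (simp add: L_def)

lemma L_mult: "L f * L g = L (\<lambda>l. f l * g l)"
proof (rule eq_matI)
  fix i j assume "i < dim_row (L (\<lambda>l. f l * g l))" "j < dim_col (L (\<lambda>l. f l * g l))"
  hence ij: "i < d" "j < d" by (auto simp: L_def)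
  have "(L f * L g) $$ (i, j) = (\<Sum>m<d. (\<Sum>l<M. f l * A l $$ (i, m)) * (\<Sum>k<M. g k * A k $$ (m, j)))"
    unfolding mult_entry[OF L_carrier L_carrier ij] using ij by (simp add: L_def)
  also have "\<dots> = (\<Sum>m<d. \<Sum>l<M. \<Sum>k<M. f l * g k * (A l $$ (i, m) * A k $$ (m, j)))"
    unfolding sum_product by (simp add: mult_ac)
  also have "\<dots> = (\<Sum>l<M. \<Sum>m<d. \<Sum>k<M. f l * g k * (A l $$ (i, m) * A k $$ (m, j)))"
    by (rule sum.swap)
  also have "\<dots> = (\<Sum>l<M. \<Sum>k<M. \<Sum>m<d. f l * g k * (A l $$ (i, m) * A k $$ (m, j)))"
    by (intro sum.cong refl sum.swap)
  also have "\<dots> = (\<Sum>l<M. \<Sum>k<M. f l * g k * (A l * A k) $$ (i, j))"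
    unfolding mult_entry[OF Ac Ac ij] by (simp add: sum_distrib_left)
  also have "\<dots> = (\<Sum>l<M. \<Sum>k<M. if k = l then f l * g l * A l $$ (i, j) else 0)"
    using AA[OF _ _ ij] by (intro sum.cong) auto
  also have "\<dots> = (\<Sum>l<M. f l * g l * A l $$ (i, j))" by simp
  finally show "(L f * L g) $$ (i, j) = L (\<lambda>l. f l * g l) $$ (i, j)" using ij by (simp add: L_def)
qed (simp_all add: L_def)

lemma tr_L: "tr (L f) = (\<Sum>l<M. f l * tr (A l))"
proof -
  have "dim_row (A l) = d" for l using Ac[of l] by simp
  thus ?thesis by (simp add: tr_def L_def sum_distrib_left sum.swap[of _ _ "{..<d}"])
qed

text \<open>Tested on the unit circle only, as in \<open>hodge_space\<close>, so that a Hodge space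
  of type (p, q) is the weight space of p - q.\<close>

definition weight_space :: "int \<Rightarrow> complex vec set" where
  "weight_space k = {v \<in> carrier_vec d. \<forall>z. cmod z = 1 \<longrightarrow> R z *\<^sub>v v = (z powi k) \<cdot>\<^sub>v v}"

lemma weight_of_A:
  assumes "l < M" "v \<noteq> 0"
  shows "R v * A l = (v powi (int l - int K)) \<cdot>\<^sub>m A l" "A l * R v = (v powi (int l - int K)) \<cdot>\<^sub>m A l"
proof -
  have p: "v powi (int l - int K) = v ^ l / v ^ K" using assms(2) by (simp add: power_int_diff)
  have dims: "dim_row (A l) = d" "dim_col (A l) = d" "dim_row (R v) = d" "dim_col (R v) = d"
    using Ac[of l] Rc[OF assms(2)] by auto
  show "R v * A l = (v powi (int l - int K)) \<cdot>\<^sub>m A l"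
  proof (rule eq_matI)
    fix i j assume "i < dim_row (v powi (int l - int K) \<cdot>\<^sub>m A l)" "j < dim_col (v powi (int l - int K) \<cdot>\<^sub>m A l)"
    hence ij: "i < d" "j < d" using dims by auto
    show "(R v * A l) $$ (i, j) = (v powi (int l - int K) \<cdot>\<^sub>m A l) $$ (i, j)"
      using RA[OF assms ij] dims ij assms(2) by (simp add: p field_simps del: index_mult_mat)
  qed (use dims in auto)
  show "A l * R v = (v powi (int l - int K)) \<cdot>\<^sub>m A l"
  proof (rule eq_matI)
    fix i j assume "i < dim_row (v powi (int l - int K) \<cdot>\<^sub>m A l)" "j < dim_col (v powi (int l - int K) \<cdot>\<^sub>m A l)"
    hence ij: "i < d" "j < d" using dims by auto
    show "(A l * R v) $$ (i, j) = (v powi (int l - int K) \<cdot>\<^sub>m A l) $$ (i, j)"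
      using AR[OF assms ij] dims ij assms(2) by (simp add: p field_simps del: index_mult_mat)
  qed (use dims in auto)
qed

lemma smult_mat_vec: "X \<in> carrier_mat d d \<Longrightarrow> x \<in> carrier_vec d \<Longrightarrow> (c \<cdot>\<^sub>m X) *\<^sub>v x = c \<cdot>\<^sub>v (X *\<^sub>v (x :: complex vec))"
  by (intro eq_vecI) (auto simp: scalar_prod_def sum_distrib_left mult_ac)

lemma A_in_weight_space:
  assumes "l < M" "x \<in> carrier_vec d"
  shows "A l *\<^sub>v x \<in> weight_space (int l - int K)"
proof -
  have "R z *\<^sub>v (A l *\<^sub>v x) = (z powi (int l - int K)) \<cdot>\<^sub>v (A l *\<^sub>v x)" if "cmod z = 1" for z
  proof -
    have z: "z \<noteq> 0" using that by auto
    have "R z *\<^sub>v (A l *\<^sub>v x) = (R z * A l) *\<^sub>v x"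
      using assoc_mult_mat_vec[OF Rc[OF z] Ac assms(2)] by simp
    thus ?thesis unfolding weight_of_A(1)[OF assms(1) z] using smult_mat_vec[OF Ac assms(2)] by simp
  qed
  moreover have "A l *\<^sub>v x \<in> carrier_vec d" using Ac assms(2) by (rule mult_mat_vec_carrier)
  ultimately show ?thesis by (simp add: weight_space_def)
qed

lemma A_kills:
  assumes v: "v \<in> weight_space k" and l: "l < M" "int l - int K \<noteq> k"
  shows "A l *\<^sub>v v = 0\<^sub>v d"
proof -
  define m where "m = int l - int K - k"
  \<comment> \<open>A unit number separating the two weights: with m their difference, z^m = -1, so
    that \<open>A l *\<^sub>v v\<close> equals its own negative.\<close>
  define z where "z = cis (pi / of_int m)"
  have z: "cmod z = 1" "z \<noteq> 0" by (simp_all add: z_def)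
  have vc: "v \<in> carrier_vec d" and vz: "R z *\<^sub>v v = (z powi k) \<cdot>\<^sub>v v" using v z(1) by (auto simp: weight_space_def)
  have "z powi m = -1" using l by (simp add: z_def cis_power_int m_def)
  hence zm: "z powi (int l - int K) = - (z powi k)"
    using power_int_add[of z k m] z(2) by (simp add: m_def)
  have "(z powi (int l - int K)) \<cdot>\<^sub>v (A l *\<^sub>v v) = A l *\<^sub>v (R z *\<^sub>v v)"
    using assoc_mult_mat_vec[OF Ac Rc[OF z(2)] vc, of l] weight_of_A(2)[OF l(1) z(2)] smult_mat_vec[OF Ac vc] by simp
  also have "\<dots> = (z powi k) \<cdot>\<^sub>v (A l *\<^sub>v v)" unfolding vz using mult_mat_vec[OF Ac vc] by simp
  finally have eq: "(- (z powi k)) \<cdot>\<^sub>v (A l *\<^sub>v v) = (z powi k) \<cdot>\<^sub>v (A l *\<^sub>v v)" unfolding zm .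
  have Avc: "A l *\<^sub>v v \<in> carrier_vec d" using Ac vc by (rule mult_mat_vec_carrier)
  show ?thesis
  proof (rule eq_vecI)
    fix i assume "i < dim_vec (0\<^sub>v d :: complex vec)"
    hence i: "i < d" by simp
    have "- (z powi k) * (A l *\<^sub>v v) $ i = (z powi k) * (A l *\<^sub>v v) $ i"
      using arg_cong[OF eq, of "\<lambda>x. x $ i"] Ac[of l] i by (simp del: index_mult_mat_vec)
    hence "(A l *\<^sub>v v) $ i = 0" using z(2) by (simp del: index_mult_mat_vec)
    thus "(A l *\<^sub>v v) $ i = 0\<^sub>v d $ i" using i by (simp del: index_mult_mat_vec)
  qed (use Ac[of l] in auto)
qed

lemma sum_A_vec:
  assumes "v \<in> carrier_vec d" "i < d"
  shows "v $ i = (\<Sum>l<M. (A l *\<^sub>v v) $ i)"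
proof -
  have e: "(A l *\<^sub>v v) $ i = (\<Sum>j<d. A l $$ (i, j) * v $ j)" for l
    using assms Ac[of l] by (simp add: scalar_prod_def atLeast0LessThan)
  have "(\<Sum>l<M. (A l *\<^sub>v v) $ i) = (\<Sum>j<d. (\<Sum>l<M. A l $$ (i, j)) * v $ j)"
    unfolding e by (subst sum.swap) (simp add: sum_distrib_right)
  also have "\<dots> = (\<Sum>j<d. if j = i then v $ j else 0)"
    using sum_A[OF assms(2)] assms(2) by (intro sum.cong) auto
  finally show ?thesis using assms(2) by simp
qed

lemma weight_space_outside:
  assumes "v \<in> weight_space k" "\<And>l. l < M \<Longrightarrow> int l - int K \<noteq> k"
  shows "v = 0\<^sub>v d"
proof (rule eq_vecI)
  have vc: "v \<in> carrier_vec d" using assms by (simp add: weight_space_def)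
  fix i assume "i < dim_vec (0\<^sub>v d :: complex vec)"
  thus "v $ i = 0\<^sub>v d $ i" using sum_A_vec[OF vc, of i] A_kills[OF assms(1)] assms(2) by simp
qed (use assms in \<open>simp add: weight_space_def\<close>)

lemma A_fixes:
  assumes v: "v \<in> weight_space (int l - int K)" and l: "l < M"
  shows "A l *\<^sub>v v = v"
proof (rule eq_vecI)
  have vc: "v \<in> carrier_vec d" using v by (simp add: weight_space_def)
  fix i assume "i < dim_vec v"
  hence i: "i < d" using vc by simp
  have "v $ i = (\<Sum>k<M. (A k *\<^sub>v v) $ i)" by (rule sum_A_vec[OF vc i])
  also have "\<dots> = (\<Sum>k<M. if k = l then (A l *\<^sub>v v) $ i else 0)"
    using A_kills[OF v] i by (intro sum.cong) auto
  finally show "(A l *\<^sub>v v) $ i = v $ i" using l by simp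
qed (use v Ac[of l] in \<open>auto simp: weight_space_def\<close>)

lemma weight_space_image:
  assumes "l < M"
  shows "weight_space (int l - int K) = {A l *\<^sub>v x | x. x \<in> carrier_vec d}"
proof -
  have "\<exists>x. v = A l *\<^sub>v x \<and> x \<in> carrier_vec d" if "v \<in> weight_space (int l - int K)" for v
    using A_fixes[OF that assms] that by (intro exI[of _ v]) (auto simp: weight_space_def)
  thus ?thesis using A_in_weight_space[OF assms] by auto
qed

lemma A_column:
  assumes "i < d" "j < d"
  shows "(A l *\<^sub>v unit_vec d j) $ i = A l $$ (i, j)"
  using assms Ac[of l] by simp

lemma tr_A_zero:
  assumes "l < M" "weight_space (int l - int K) = {0\<^sub>v d}"
  shows "tr (A l) = 0" "i < d \<Longrightarrow> j < d \<Longrightarrow> A l $$ (i, j) = 0"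
proof -
  have z: "A l $$ (i, j) = 0" if "i < d" "j < d" for i j
    using A_column[OF that, of l] A_in_weight_space[OF assms(1), of "unit_vec d j"] assms(2) that by simp
  thus "i < d \<Longrightarrow> j < d \<Longrightarrow> A l $$ (i, j) = 0" by blast
  show "tr (A l) = 0" using Ac[of l] z by (simp add: tr_def)
qed

text \<open>\<open>A l\<close> is a projection of rank one: its columns are multiples c j of v, and
  that it fixes v says that the sum of c j v_j, which is its trace, equals 1.\<close>

lemma tr_A_one:
  assumes l: "l < M"
    and dim: "vectorspace.dim class_ring (module_vec TYPE(complex) d\<lparr>carrier := weight_space (int l - int K)\<rparr>) = 1"
  shows "tr (A l) = 1"
proof -
  from dim_one_line[OF Ac weight_space_image[OF l] dim] obtain v where
    v: "v \<in> weight_space (int l - int K)" "v \<noteq> 0\<^sub>v d"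
    "\<And>x. x \<in> weight_space (int l - int K) \<Longrightarrow> \<exists>a. x = a \<cdot>\<^sub>v v" by blast
  have vc: "v \<in> carrier_vec d" using v(1) by (simp add: weight_space_def)
  have "\<forall>j. \<exists>a. A l *\<^sub>v unit_vec d j = a \<cdot>\<^sub>v v" using v(3) A_in_weight_space[OF l] by simp
  then obtain c where c: "\<And>j. A l *\<^sub>v unit_vec d j = c j \<cdot>\<^sub>v v" by metis
  have e: "A l $$ (i, j) = c j * v $ i" if "i < d" "j < d" for i j
    using A_column[OF that, of l] c[of j] vc that by simp
  obtain i where i: "i < d" "v $ i \<noteq> 0" using v(2) vc by (metis carrier_vecD eq_vecI index_zero_vec)
  have "v $ i = (A l *\<^sub>v v) $ i" using A_fixes[OF v(1) l] by simp
  also have "\<dots> = (\<Sum>j<d. A l $$ (i, j) * v $ j)"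
    using i vc Ac[of l] by (simp add: scalar_prod_def atLeast0LessThan)
  also have "\<dots> = (\<Sum>j<d. c j * v $ j) * v $ i"
    using i by (simp add: e sum_distrib_left sum_distrib_right mult_ac)
  finally have "(\<Sum>j<d. c j * v $ j) = 1" using i(2) by simp
  thus ?thesis using Ac[of l] by (simp add: tr_def e)
qed

text \<open>The unit circle acts by real matrices, and conjugation inverts z there.\<close>

lemma weight_space_cnj:
  assumes real: "\<And>z i j. cmod z = 1 \<Longrightarrow> i < d \<Longrightarrow> j < d \<Longrightarrow> R z $$ (i, j) \<in> \<real>"
    and v: "v \<in> weight_space k"
  shows "map_vec cnj v \<in> weight_space (- k)"
proof -
  have vc: "v \<in> carrier_vec d" using v by (simp add: weight_space_def)
  have "R z *\<^sub>v map_vec cnj v = (z powi (- k)) \<cdot>\<^sub>v map_vec cnj v" if z: "cmod z = 1" and z0: "z \<noteq> 0" for z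
  proof (rule eq_vecI)
    have iz: "inverse z = cnj z"
      using complex_norm_square[of z] z z0 by (simp add: inverse_unique)
    fix i assume "i < dim_vec (z powi (- k) \<cdot>\<^sub>v map_vec cnj v)"
    hence i: "i < d" using vc by simp
    have "(R z *\<^sub>v map_vec cnj v) $ i = (\<Sum>j<d. R z $$ (i, j) * cnj (v $ j))"
      using i vc Rc[OF z0] by (simp add: scalar_prod_def atLeast0LessThan)
    also have "\<dots> = cnj (\<Sum>j<d. R z $$ (i, j) * v $ j)"
      using real[OF z i] by (auto simp: Reals_cnj_iff intro!: sum.cong)
    also have "(\<Sum>j<d. R z $$ (i, j) * v $ j) = (R z *\<^sub>v v) $ i"
      using i vc Rc[OF z0] by (simp add: scalar_prod_def atLeast0LessThan)
    also have "\<dots> = (z powi k) * v $ i" using v z i vc by (simp add: weight_space_def)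
    also have "cnj ((z powi k) * v $ i) = (z powi (- k)) * cnj (v $ i)"
      by (simp add: power_int_minus iz flip: power_int_inverse)
    finally show "(R z *\<^sub>v map_vec cnj v) $ i = (z powi (- k) \<cdot>\<^sub>v map_vec cnj v) $ i" using i vc by simp
  qed (use vc Rc[OF z0] in auto)
  hence "\<forall>z. cmod z = 1 \<longrightarrow> R z *\<^sub>v map_vec cnj v = (z powi (- k)) \<cdot>\<^sub>v map_vec cnj v"
    by (metis norm_zero zero_neq_one)
  thus ?thesis using vc by (simp add: weight_space_def)
qed

text \<open>The parameter u = exp s with complex s is used rather than an angle, so that the
  derivative has the integral weights themselves as eigenvalues.\<close>

lemma exp_derivative:
  assumes "i < d" "j < d"
  shows "((\<lambda>s. R (exp s) $$ (i, j)) has_field_derivative L (\<lambda>l. of_int (int l - int K)) $$ (i, j)) (at 0)"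
proof -
  have e1: "R (exp s) $$ (i, j) = (\<Sum>l<M. A l $$ (i, j) * exp (of_int (int l - int K) * s))" for s
  proof -
    have e: "exp (of_int (int l - int K) * s) = exp s ^ l / exp s ^ K" for l
      by (simp add: left_diff_distrib exp_diff exp_of_nat_mult)
    have "R (exp s) $$ (i, j) = (\<Sum>l<M. A l $$ (i, j) * exp s ^ l) / exp s ^ K"
      using expansion[of "exp s", OF _ assms] by (simp add: field_simps)
    thus ?thesis unfolding e by (simp add: sum_divide_distrib)
  qed
  have e2: "((\<lambda>s. \<Sum>l<M. A l $$ (i, j) * exp (of_int (int l - int K) * s)) has_field_derivative
      (\<Sum>l<M. A l $$ (i, j) * (exp (of_int (int l - int K) * 0) * of_int (int l - int K)))) (at 0)"
    by (intro DERIV_sum DERIV_cmult DERIV_fun_exp DERIV_cmult_Id)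
  have e3: "(\<Sum>l<M. A l $$ (i, j) * (exp (of_int (int l - int K) * 0) * of_int (int l - int K)))
      = L (\<lambda>l. of_int (int l - int K)) $$ (i, j)"
    using assms by (auto simp: L_def intro!: sum.cong)
  show ?thesis using e2 unfolding e3 by (simp only: e1)
qed

end

section \<open>Weights of the circle action and their multiplicities\<close>

lemma laurent_rep_exists:
  assumes hom: "alg_hom K' 2 circle_group d H \<rho>" and H: "H \<subseteq> carrier_mat d d" "\<And>h. h \<in> H \<Longrightarrow> det h \<noteq> 0"
  shows "\<exists>K M A. laurent_rep d (\<lambda>u. \<rho> (cpt u)) K M A"
proof -
  have car: "\<rho> (cpt u) \<in> carrier_mat d d" "det (\<rho> (cpt u)) \<noteq> 0" if "u \<noteq> 0" for u
    using hom H cpt_circle[OF that] unfolding alg_hom_def by blast+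
  have mult: "\<rho> (cpt u) * \<rho> (cpt v) = \<rho> (cpt (u * v))" if "u \<noteq> 0" "v \<noteq> 0" for u v
    using hom cpt_circle[OF that(1)] cpt_circle[OF that(2)] unfolding alg_hom_def cpt_mult[OF that, symmetric] by simp
  have one: "\<rho> (cpt 1) = 1\<^sub>m d"
    by (rule idempotent_invertible_is_one) (use car[of 1] mult[of 1 1] in auto)
  have "\<forall>i j. \<exists>P k. i < d \<longrightarrow> j < d \<longrightarrow> (\<forall>u. u \<noteq> 0 \<longrightarrow> \<rho> (cpt u) $$ (i, j) * u ^ k = poly P u)"
    using circle_hom_laurent[OF hom] by blast
  then obtain P k where P: "\<And>i j u. i < d \<Longrightarrow> j < d \<Longrightarrow> u \<noteq> 0 \<Longrightarrow> \<rho> (cpt u) $$ (i, j) * u ^ (k i j) = poly (P i j) u"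
    by metis
  \<comment> \<open>Sums over all entries bound every pole order and every degree, which gives one
    exponent \<open>K\<close> and one length \<open>M\<close> for the whole matrix.\<close>
  define K where "K = (\<Sum>i<d. \<Sum>j<d. k i j)"
  define Q where "Q i j = P i j * monom 1 (K - k i j)" for i j
  define M where "M = Suc (\<Sum>i<d. \<Sum>j<d. degree (Q i j))"
  define A where "A l = mat d d (\<lambda>(i, j). coeff (Q i j) l)" for l
  have le: "f i j \<le> (\<Sum>i<d. \<Sum>j<d. f i j)" if "i < d" "j < d" for f :: "nat \<Rightarrow> nat \<Rightarrow> nat" and i j
  proof -
    have "f i j \<le> (\<Sum>j<d. f i j)" using that by (intro member_le_sum) auto
    also have "\<dots> \<le> (\<Sum>i<d. \<Sum>j<d. f i j)" using that by (intro member_le_sum[of i _ "\<lambda>i. \<Sum>j<d. f i j"]) auto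
    finally show ?thesis .
  qed
  have "laurent_rep d (\<lambda>u. \<rho> (cpt u)) K M A"
  proof
    fix u :: complex and i j assume u: "u \<noteq> 0" and ij: "i < d" "j < d"
    have "\<rho> (cpt u) $$ (i, j) * u ^ K = \<rho> (cpt u) $$ (i, j) * u ^ k i j * u ^ (K - k i j)"
      using le[OF ij, of k] by (simp add: K_def flip: power_add mult.assoc)
    also have "\<dots> = poly (Q i j) u" using P[OF ij u] by (simp add: Q_def poly_monom)
    also have "\<dots> = (\<Sum>l\<le>degree (Q i j). coeff (Q i j) l * u ^ l)" by (rule poly_altdef)
    also have "\<dots> = (\<Sum>l<M. coeff (Q i j) l * u ^ l)"
      using le[OF ij, of "\<lambda>i j. degree (Q i j)"]
      by (intro sum.mono_neutral_left) (auto simp: M_def coeff_eq_0)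
    finally show "\<rho> (cpt u) $$ (i, j) * u ^ K = (\<Sum>l<M. A l $$ (i, j) * u ^ l)" using ij by (simp add: A_def)
  qed (use car mult one in \<open>auto simp: A_def\<close>)
  thus ?thesis by blast
qed

lemma circle_hom_real_entries:
  assumes hom: "alg_hom \<real> 2 circle_group d H \<rho>" and z: "cmod z = 1" and ij: "i < d" "j < d"
  shows "\<rho> (cpt z) $$ (i, j) \<in> \<real>"
proof -
  have z0: "z \<noteq> 0" using z by auto
  obtain p k where p: "p \<in> polyfuns \<real> 2" "\<forall>g\<in>circle_group. \<rho> g $$ (i, j) = p g / det g ^ k"
    using hom ij unfolding alg_hom_def regular_on_def by blast
  have "\<rho> (cpt z) $$ (i, j) = p (cpt z)"
    using p(2) cpt_circle[OF z0] by (auto simp: circle_group_def)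
  moreover have "p (cpt z) \<in> \<real>"
  proof (rule polyfun_real[OF p(1)])
    fix a b :: nat assume "a < 2" "b < 2"
    thus "cpt z $$ (a, b) \<in> \<real>" unfolding cpt_unit[OF z, symmetric]
      by (auto simp: circle_pt_def mat_of_rows_list_def less_2_cases_iff)
  qed
  ultimately show ?thesis by simp
qed

text \<open>The spectrum n, n - 2, ..., -n with simple multiplicities, expressed through traces of
  arbitrary functions of the weight; these give the dimension and the power sums at once. Here n =
  p0 - q0, twice the largest \<ell>.\<close>

lemma principal_traces:
  assumes L: "laurent_rep d (\<lambda>u. \<rho> (cpt u)) K M A"
    and pol: "polarized_hodge_structure d B w \<rho>" and prin: "principal_rep d w \<rho>"
  shows "\<exists>n::nat. (\<forall>f :: int \<Rightarrow> complex. (\<Sum>l<M. f (int l - int K) * tr (A l)) = (\<Sum>j\<le>n. f (int n - 2 * int j))) \<and> 1 \<le> n"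
proof -
  interpret laurent_rep d "\<lambda>u. \<rho> (cpt u)" K M A by (rule L)
  have hom: "alg_hom \<real> 2 circle_group d (aut_form d B) \<rho>" and nc: "nonconstant \<rho>"
    and m1: "\<rho> (circle_pt (-1)) = ((-1) powi w) \<cdot>\<^sub>m 1\<^sub>m d"
    using pol unfolding polarized_hodge_structure_def by auto
  have hs: "hodge_space d \<rho> p q = weight_space (p - q)" for p q
    unfolding hodge_space_def weight_space_def using cpt_unit by auto
  have real: "\<rho> (cpt z) $$ (i, j) \<in> \<real>" if "cmod z = 1" "i < d" "j < d" for z i j
    using circle_hom_real_entries[OF hom that] .
  have zero: "0\<^sub>v d \<in> weight_space k" for k
  proof -
    have "\<rho> (cpt z) *\<^sub>v 0\<^sub>v d = z powi k \<cdot>\<^sub>v 0\<^sub>v d" if "cmod z = 1" for z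
    proof -
      have "z \<noteq> 0" using that by auto
      from Rc[OF this] show ?thesis by (intro eq_vecI) auto
    qed
    thus ?thesis by (simp add: weight_space_def)
  qed
  have cnj0: "weight_space (- k) = {0\<^sub>v d}" if "weight_space k = {0\<^sub>v d}" for k
  proof -
    have "v = 0\<^sub>v d" if v: "v \<in> weight_space (- k)" for v
    proof -
      have "map_vec cnj v = 0\<^sub>v d" using weight_space_cnj[OF real v] \<open>weight_space k = {0\<^sub>v d}\<close> by simp
      moreover have "v \<in> carrier_vec d" using v by (simp add: weight_space_def)
      ultimately show ?thesis
        by (intro eq_vecI) (auto dest!: arg_cong[of _ _ "\<lambda>x. x $ _"] simp: vec_eq_iff)
    qed
    thus ?thesis using zero by blast
  qed
  obtain p0 q0 where pq: "p0 + q0 = w" "weight_space (p0 - q0) \<noteq> {0\<^sub>v d}"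
    "\<And>p q. p + q = w \<Longrightarrow> p0 < p \<Longrightarrow> weight_space (p - q) = {0\<^sub>v d}"
    "\<And>p q. p + q = w \<Longrightarrow> q0 \<le> p \<Longrightarrow> p \<le> p0 \<Longrightarrow> hodge_number d \<rho> p q = 1"
    using prin unfolding principal_rep_def hs by blast
  \<comment> \<open>Otherwise conjugating the nonzero space of type (p0, q0) would give a nonzero
    one of type (q0, p0), beyond the maximal first index.\<close>
  have n0: "q0 \<le> p0"
  proof (rule ccontr)
    assume "\<not> q0 \<le> p0"
    hence "weight_space (q0 - p0) = {0\<^sub>v d}" using pq(1) pq(3)[of q0 p0] by simp
    hence "weight_space (- (q0 - p0)) = {0\<^sub>v d}" by (rule cnj0)
    thus False using pq(2) by simp
  qed
  define n where "n = nat (p0 - q0)"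
  have n: "int n = p0 - q0" using n0 by (simp add: n_def)
  have empty: "weight_space k = {0\<^sub>v d}" if ev: "even (k + w)" and gt: "int n < \<bar>k\<bar>" for k
  proof -
    obtain p where p: "k + w = 2 * p" using ev by (rule evenE)
    have k: "k = p - (w - p)" "- k = (w - p) - p" using p by auto
    show ?thesis
    proof (cases "k > 0")
      case True
      hence "p0 < p" using p gt n pq(1) by linarith
      hence "weight_space (p - (w - p)) = {0\<^sub>v d}" by (intro pq(3)) auto
      thus ?thesis unfolding k(1)[symmetric] .
    next
      case False
      hence "p0 < w - p" using p gt n pq(1) by linarith
      hence "weight_space ((w - p) - p) = {0\<^sub>v d}" by (intro pq(3)) auto
      hence "weight_space (- k) = {0\<^sub>v d}" unfolding k(2)[symmetric] .
      thus ?thesis using cnj0[of "- k"] by simp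
    qed
  qed
  \<comment> \<open>Weights of the wrong parity are not of the form p - q with p + q = w, so the
    Hodge spaces say nothing about them; the action of -1 by (-1)^w excludes them.\<close>
  have parity: "A l $$ (i, j) = 0" if "l < M" "odd (int l - int K + w)" "i < d" "j < d" for l i j
  proof -
    have "cpt (-1) = circle_pt (-1)" by (simp add: cpt_unit)
    hence R: "\<rho> (cpt (-1)) = ((-1) powi w) \<cdot>\<^sub>m 1\<^sub>m d" using m1 by simp
    have "((-1) powi (int l - int K)) \<cdot>\<^sub>m A l = ((-1) powi w) \<cdot>\<^sub>m A l"
      using weight_of_A(1)[OF that(1), of "-1"] unfolding R using Ac[of l] by (simp add: mult_smult_assoc_mat[of _ d d _ d])
    from arg_cong[OF this, of "\<lambda>X. X $$ (i, j)"] have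
      "((-1) powi (int l - int K)) * A l $$ (i, j) = ((-1) powi w) * A l $$ (i, j)"
      using Ac[of l] that by simp
    thus ?thesis using that(2) by (auto simp: power_int_minus_left split: if_splits)
  qed
  have dim1: "vectorspace.dim class_ring (module_vec TYPE(complex) d\<lparr>carrier := weight_space k\<rparr>) = 1"
    if ev: "even (k + w)" and le: "\<bar>k\<bar> \<le> int n" for k
  proof -
    obtain p where p: "k + w = 2 * p" using ev by (rule evenE)
    have "hodge_number d \<rho> p (w - p) = 1" using pq(4)[of p "w - p"] p le n pq(1) by simp
    moreover have "p - (w - p) = k" using p by simp
    ultimately show ?thesis by (simp add: hodge_number_def hs)
  qed
  define T where "T = (\<lambda>j. int n - 2 * int j) ` {..n}"
  have T: "k \<in> T \<longleftrightarrow> even (k + w) \<and> \<bar>k\<bar> \<le> int n" for k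
  proof
    assume "k \<in> T"
    then obtain j where "k = int n - 2 * int j" "j \<le> n" by (auto simp: T_def)
    thus "even (k + w) \<and> \<bar>k\<bar> \<le> int n" using n pq(1) by auto
  next
    assume k: "even (k + w) \<and> \<bar>k\<bar> \<le> int n"
    hence "even (int n - k)" using n pq(1) by presburger
    then obtain j where j: "int n - k = 2 * j" by blast
    hence "0 \<le> j" "j \<le> int n" using k by auto
    hence "k = int n - 2 * int (nat j)" "nat j \<in> {..n}" using j by auto
    thus "k \<in> T" unfolding T_def by (rule image_eqI)
  qed
  have trA: "tr (A l) = (if int l - int K \<in> T then 1 else 0)" if l: "l < M" for l
  proof (cases "int l - int K \<in> T")
    case True
    thus ?thesis using tr_A_one[OF l dim1] T by simp
  next
    case False
    show ?thesis
    proof (cases "even (int l - int K + w)")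
      case True
      hence "weight_space (int l - int K) = {0\<^sub>v d}" using empty False T by auto
      thus ?thesis using tr_A_zero[OF l] False by simp
    next
      case odd: False
      thus ?thesis using parity[OF l odd] Ac[of l] False by (simp add: tr_def)
    qed
  qed
  \<comment> \<open>Every weight of dimension one must occur in the Laurent expansion: otherwise its
    space is zero, and writing it as the image of the zero matrix contradicts
    \<open>dim_one_line\<close>.\<close>
  have Tl: "\<exists>l<M. int l - int K = k" if k: "k \<in> T" for k
  proof (rule ccontr)
    assume "\<not> ?thesis"
    hence "weight_space k = {0\<^sub>v d}" using weight_space_outside[of _ k] zero by blast
    moreover have z: "0\<^sub>m d d *\<^sub>v x = 0\<^sub>v d" if "x \<in> carrier_vec d" for x :: "complex vec"
      using that by (intro eq_vecI) auto
    have "{0\<^sub>m d d *\<^sub>v x | x :: complex vec. x \<in> carrier_vec d} = {0\<^sub>v d}"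
    proof (intro equalityI subsetI)
      fix y :: "complex vec" assume "y \<in> {0\<^sub>v d}"
      hence "y = 0\<^sub>m d d *\<^sub>v 0\<^sub>v d" using z[OF zero_carrier_vec] by simp
      thus "y \<in> {0\<^sub>m d d *\<^sub>v x | x. x \<in> carrier_vec d}" using zero_carrier_vec by blast
    qed (use z in fast)
    ultimately have W: "weight_space k = {0\<^sub>m d d *\<^sub>v x | x. x \<in> carrier_vec d}" "weight_space k = {0\<^sub>v d}"
      by simp_all
    have "vectorspace.dim class_ring (module_vec TYPE(complex) d\<lparr>carrier := weight_space k\<rparr>) = 1"
      using dim1 k T by blast
    from dim_one_line[OF zero_carrier_mat W(1) this] W(2) show False by fast
  qed
  have sums: "(\<Sum>l<M. f (int l - int K) * tr (A l)) = (\<Sum>j\<le>n. f (int n - 2 * int j))" for f :: "int \<Rightarrow> complex"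
  proof -
    have "(\<Sum>l<M. f (int l - int K) * tr (A l)) = (\<Sum>l<M. if int l - int K \<in> T then f (int l - int K) else 0)"
      using trA by (intro sum.cong) auto
    also have "\<dots> = (\<Sum>l\<in>{l\<in>{..<M}. int l - int K \<in> T}. f (int l - int K))"
      by (rule sum.inter_filter[symmetric]) simp
    also have "\<dots> = (\<Sum>k\<in>T. f k)"
      by (rule sum.reindex_bij_betw) (use Tl in \<open>auto simp: bij_betw_def inj_on_def image_iff\<close>)
    also have "\<dots> = (\<Sum>j\<le>n. f (int n - 2 * int j))"
      unfolding T_def by (subst sum.reindex) (auto simp: inj_on_def)
    finally show ?thesis .
  qed
  \<comment> \<open>If n = 0, only weight 0 survives in the expansion, so the circle acts by a
    constant matrix.\<close>
  have "1 \<le> n"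
  proof (rule ccontr)
    assume "\<not> 1 \<le> n"
    hence n0: "n = 0" by simp
    have A0: "A l $$ (i, j) = 0" if "l < M" "l \<noteq> K" "i < d" "j < d" for l i j
    proof (cases "even (int l - int K + w)")
      case True
      have "int n < \<bar>int l - int K\<bar>" using n0 that(2) by simp
      thus ?thesis using tr_A_zero(2)[OF that(1) empty[OF True]] that by blast
    next
      case False
      thus ?thesis using parity that by blast
    qed
    have const: "\<rho> (cpt u) $$ (i, j) = (if K < M then A K $$ (i, j) else 0)" if u: "u \<noteq> 0" and ij: "i < d" "j < d" for u i j
    proof -
      have "\<rho> (cpt u) $$ (i, j) * u ^ K = (\<Sum>l<M. A l $$ (i, j) * u ^ l)" by (rule expansion[OF u ij])
      also have "\<dots> = (\<Sum>l<M. if l = K then A K $$ (i, j) * u ^ K else 0)"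
        using A0[OF _ _ ij] by (intro sum.cong) auto
      also have "\<dots> = (if K < M then A K $$ (i, j) else 0) * u ^ K" by simp
      finally show ?thesis using u by simp
    qed
    have "\<rho> (cpt u) = \<rho> (cpt v)" if "u \<noteq> 0" "v \<noteq> 0" for u v
      using const Rc[OF that(1)] Rc[OF that(2)] that by (intro eq_matI) auto
    thus False using nc circle_cpt unfolding nonconstant_def by metis
  qed
  thus ?thesis using sums by blast
qed

section \<open>The generator of the circle inside E_6 or E_7, and the contradiction\<close>

lemma lie_iso_no_principal:
  assumes n: "n = 6 \<or> n = 7" and iso: "lie_iso_E n N (lie_algebra N G)"
    and rep: "hodge_representation N G d B w \<pi> \<phi>"
  shows "\<not> principal_rep d w (\<pi> \<circ> \<phi>)"
proof
  assume prin: "principal_rep d w (\<pi> \<circ> \<phi>)"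
  let ?L = "lie_algebra N G" and ?C = "e_carrier n"
  have G: "alg_group \<rat> N G" and hom: "alg_hom \<rat> N G d (aut_form d B) \<pi>"
    and \<phi>: "alg_hom \<real> 2 circle_group N G \<phi>" and pol: "polarized_hodge_structure d B w (\<pi> \<circ> \<phi>)"
    using rep unfolding hodge_representation_def by auto
  note Gd = alg_groupD[OF G]
  have aut: "aut_form d B \<subseteq> carrier_mat d d" "\<And>h. h \<in> aut_form d B \<Longrightarrow> det h \<noteq> 0"
    by (auto simp: aut_form_def)
  interpret P: regular_hom \<rat> N d G "aut_form d B" \<pi> by unfold_locales (use G hom aut in auto)
  have homc: "alg_hom \<real> 2 circle_group d (aut_form d B) (\<pi> \<circ> \<phi>)"
    using pol unfolding polarized_hodge_structure_def by auto
  obtain K M A where L: "laurent_rep d (\<lambda>u. (\<pi> \<circ> \<phi>) (cpt u)) K M A"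
    using laurent_rep_exists[OF homc aut] by blast
  interpret C: laurent_rep d "\<lambda>u. (\<pi> \<circ> \<phi>) (cpt u)" K M A by (rule L)
  obtain KG MG AG where LG: "laurent_rep N (\<lambda>u. \<phi> (cpt u)) KG MG AG"
    using laurent_rep_exists[OF \<phi>] Gd by blast
  interpret CG: laurent_rep N "\<lambda>u. \<phi> (cpt u)" KG MG AG by (rule LG)
  \<comment> \<open>The velocity of the circle at the unit, computed in G; it is tangent to G, and
    the differential of \<pi> maps it to the generator \<open>Y\<close> of the circle action on
    V.\<close>
  define X where "X = CG.L (\<lambda>l. of_int (int l - int KG))"
  have \<gamma>: "\<phi> (cpt (exp s)) \<in> G" for s
    using \<phi> cpt_circle[of "exp s"] unfolding alg_hom_def by simp
  have \<gamma>0: "\<phi> (cpt (exp 0)) = 1\<^sub>m N" using CG.Rone by simp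
  have XL: "X \<in> ?L"
    by (rule curve_tangent[OF G, of "\<lambda>s. \<phi> (cpt (exp s))"]) (use \<gamma> \<gamma>0 CG.L_carrier CG.exp_derivative in \<open>auto simp: X_def\<close>)
  define Y where "Y = C.L (\<lambda>l. of_int (int l - int K))"
  have DX: "P.D X = Y"
  proof (rule eq_matI)
    fix i j assume "i < dim_row Y" "j < dim_col Y"
    hence ij: "i < d" "j < d" using carrier_matD[OF C.L_carrier] by (auto simp: Y_def)
    have "((\<lambda>s. \<pi> (\<phi> (cpt (exp s))) $$ (i, j)) has_field_derivative P.D X $$ (i, j)) (at 0)"
      by (rule P.D_curve[of "\<lambda>s. \<phi> (cpt (exp s))", OF _ _ XL _ ij]) (use \<gamma> \<gamma>0 CG.exp_derivative in \<open>auto simp: X_def\<close>)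
    thus "P.D X $$ (i, j) = Y $$ (i, j)" using C.exp_derivative[OF ij] DERIV_unique unfolding Y_def by fastforce
  qed (use P.D_carrier[of X] in \<open>auto simp: Y_def C.L_def\<close>)
  obtain F where F: "bij_betw F ?C ?L"
    and Flin: "\<And>u v a b. u \<in> ?C \<Longrightarrow> v \<in> ?C \<Longrightarrow> F (e_lincomb a u b v) = a \<cdot>\<^sub>m F u + b \<cdot>\<^sub>m F v"
    and Fbr: "\<And>u v. u \<in> ?C \<Longrightarrow> v \<in> ?C \<Longrightarrow> F (e_bracket n u v) = F u * F v - F v * F u"
    using iso unfolding lie_iso_E_def by blast
  have FL: "F u \<in> ?L" if "u \<in> ?C" for u using F that by (auto simp: bij_betw_def)
  \<comment> \<open>The isomorphism is controlled only on the carrier, while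
    \<open>e_representation\<close> quantifies over all pairs of functions. Composition with this
    projection closes the gap, since the bracket sees only the coordinates retained by it.\<close>
  define pr :: "e_elt \<Rightarrow> e_elt" where
    "pr u = ((\<lambda>i. if i \<in> {1..n} then fst u i else 0), (\<lambda>\<alpha>. if \<alpha> \<in> e_roots n then snd u \<alpha> else 0))" for u
  have prC: "pr u \<in> ?C" for u by (auto simp: pr_def e_carrier_def)
  have prid: "pr u = u" if "u \<in> ?C" for u using that by (auto simp: pr_def e_carrier_def)
  have prlin: "pr (e_lincomb a u b v) = e_lincomb a (pr u) b (pr v)" for a u b v
    by (auto simp: pr_def e_lincomb_def)
  have prbr: "e_bracket n (pr u) (pr v) = e_bracket n u v" for u v
  proof -
    obtain h x k y where uv: "u = (h, x)" "v = (k, y)" by fastforce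
    have w: "e_weight n \<gamma> (\<lambda>i. if Suc 0 \<le> i \<and> i \<le> n then f i else 0) = e_weight n \<gamma> f" for \<gamma> f
      unfolding e_weight_def by (intro sum.cong) auto
    show ?thesis unfolding uv pr_def e_bracket_def
      using e_roots_uminus[of _ n] by (auto simp: w cong: if_cong intro!: sum.cong ext)
  qed
  define \<psi> where "\<psi> u = P.D (F (pr u))" for u
  have lincC: "e_lincomb a u b v \<in> ?C" if "u \<in> ?C" "v \<in> ?C" for a u b v
    using that by (auto simp: e_lincomb_def e_carrier_def)
  interpret E: e_representation n d \<psi>
  proof
    show "n = 6 \<or> n = 7" by (rule n)
    show "\<psi> u \<in> carrier_mat d d" for u using P.D_carrier by (simp add: \<psi>_def)
    fix a b u v
    have "F (e_lincomb a (pr u) b (pr v)) \<in> ?L" using FL lincC prC by blast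
    thus "\<psi> (e_lincomb a u b v) = a \<cdot>\<^sub>m \<psi> u + b \<cdot>\<^sub>m \<psi> v"
      unfolding \<psi>_def prlin Flin[OF prC prC] using P.D_linear FL prC by blast
    have "F (e_bracket n (pr u) (pr v)) \<in> ?L" using FL e_bracket_carrier by blast
    hence "P.D (F (pr u) * F (pr v) - F (pr v) * F (pr u)) = P.D (F (pr u)) * P.D (F (pr v)) - P.D (F (pr v)) * P.D (F (pr u))"
      unfolding Fbr[OF prC prC] using P.D_bracket FL prC by blast
    thus "\<psi> (e_bracket n u v) = \<psi> u * \<psi> v - \<psi> v * \<psi> u"
      unfolding \<psi>_def prid[OF e_bracket_carrier] Fbr[OF prC prC, unfolded prbr] .
  qed
  obtain t where t: "t \<in> ?C" "F t = X" using F XL by (metis bij_betw_def imageE)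
  have \<psi>t: "\<psi> t = Y" using t DX by (simp add: \<psi>_def prid)
  obtain m where m: "1 \<le> m"
    "\<And>f :: int \<Rightarrow> complex. (\<Sum>l<M. f (int l - int K) * tr (A l)) = (\<Sum>j\<le>m. f (int m - 2 * int j))"
    using principal_traces[OF L pol prin] by blast
  have d: "d = m + 1"
  proof -
    have "of_nat d = tr (1\<^sub>m d)" by (simp add: tr_def)
    also have "1\<^sub>m d = C.L (\<lambda>_. 1)" using C.sum_A by (intro eq_matI) (auto simp: C.L_def)
    also have "tr \<dots> = of_nat (m + 1)" unfolding C.tr_L using m(2)[of "\<lambda>_. 1"] by simp
    finally show ?thesis by (simp only: of_nat_eq_iff)
  qed
  define s2 where "s2 = (\<Sum>j\<le>m. (real m - 2 * real j)\<^sup>2)"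
  define s4 where "s4 = (\<Sum>j\<le>m. (real m - 2 * real j) ^ 4)"
  have 2: "tr (Y * Y) = of_real s2"
    unfolding Y_def C.L_mult C.tr_L using m(2)[of "\<lambda>k. of_int k * of_int k"]
    by (simp add: s2_def power2_eq_square)
  have 4: "tr (Y * (Y * (Y * Y))) = of_real s4"
    unfolding Y_def C.L_mult C.tr_L using m(2)[of "\<lambda>k. of_int k * (of_int k * (of_int k * of_int k))"]
    by (simp add: s4_def power4_eq_xxxx mult.assoc)
  have s2: "s2 = real m * (real m + 1) * (real m + 2) / 3"
    unfolding s2_def sum_squares_progression by (simp add: field_simps power2_eq_square)
  have s4: "s4 = s2 * (3 * (real m)\<^sup>2 + 6 * real m - 4) / 5"
    unfolding s4_def s2 sum_fourth_powers_progression
    by (simp add: field_simps power2_eq_square power3_eq_cube power4_eq_xxxx)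
  have s2pos: "s2 > 0" unfolding s2 using m(1) by (intro divide_pos_pos mult_pos_pos) auto
  obtain c :: real where c: "9 \<le> 5 * d * c" "tr (Y * (Y * (Y * Y))) = of_real c * (tr (Y * Y))\<^sup>2"
  proof -
    \<comment> \<open>That the trace form is nonzero comes from the circle itself: its generator has
      positive trace of the square.\<close>
    have "tr (\<psi> t * \<psi> t) \<noteq> 0" unfolding \<psi>t 2 using s2pos by simp
    from E.quartic_trace_identity[OF t(1) this] t(1) show thesis using that unfolding \<psi>t[symmetric] by blast
  qed
  have "s4 = c * s2\<^sup>2"
  proof -
    have "complex_of_real s4 = of_real (c * s2\<^sup>2)" using c(2) unfolding 2 4 by simp
    thus ?thesis by (simp only: of_real_eq_iff)
  qed
  hence "s2 * (5 * (c * s2)) = 5 * s4" by (simp add: power2_eq_square)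
  also have "\<dots> = s2 * (3 * (real m)\<^sup>2 + 6 * real m - 4)" unfolding s4 by simp
  finally have cs: "5 * (c * s2) = 3 * (real m)\<^sup>2 + 6 * real m - 4" using s2pos by simp
  have "9 * s2 \<le> d * (5 * (c * s2))" using mult_right_mono[OF c(1), of s2] s2pos by (simp add: mult_ac)
  hence "9 * s2 \<le> d * (3 * (real m)\<^sup>2 + 6 * real m - 4)" unfolding cs .
  \<comment> \<open>With d = m + 1 the left side is d (3 m^2 + 6 m), so it exceeds the upper bound
    just obtained by exactly 4 d.\<close>
  moreover have "9 * s2 = 3 * (real m * (real m + 1) * (real m + 2))" by (simp add: s2)
  ultimately have "(real m + 1) * 4 \<le> 0" using d by (simp add: power2_eq_square algebra_simps)
  thus False by simp
qed

theorem theorem5p1: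
  fixes N :: nat and G :: "complex mat set"
  assumes "hodge_group N G"
    and "lie_iso_E 6 N (lie_algebra N G) \<or> lie_iso_E 7 N (lie_algebra N G)"
  shows "\<not> (\<exists>(d::nat) (B::rat mat) (w::int) \<pi> \<phi>.
            hodge_representation N G d B w \<pi> \<phi> \<and> principal_rep d w (\<pi> \<circ> \<phi>))"
  using assms(2) lie_iso_no_principal[of 6] lie_iso_no_principal[of 7] by blast

end
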